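(* Let $X$ be a separable reflexive real Banach space, $p\in[1,\infty)$, $p^*=\frac{p}{p-1}\in(1,\infty]$, and let $\Lambda$ be a Borel probability measure on $(\mathcal{P}_p,\mathbb{W}_p)$. Let $(\mathcal{E},\mathcal{D}(\mathcal{E}))$ be a symmetric, conservative Dirichlet form in $L^2(\mathcal{P}_p,\Lambda)$. Assume: $(C_1)$ $\mathcal{F}C_b^1(\mathcal{P}_p)\subseteq\mathcal{D}(\mathcal{E})$ and there is a constant $C\in(0,\infty)$ such that $$\mathcal{E}(f,f)\le C\sup_{\mu\in\mathcal{P}_p}\|Df(\mu)\|^2_{T^*_{\mu,p}}\quad\text{for all } f\in\mathcal{F}C_b^1(\mathcal{P}_p);$$ $(C_2)$ the Hilbert space $(\mathcal{D}(\mathcal{E}),\mathcal{E}_1^{1/2})$ has a dense subspace consisting of quasi-continuous functions. Then $(\mathcal{E},\mathcal{D}(\mathcal{E}))$ is quasi-regular.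
   Context: $\mathcal{P}_p$ is the set of Borel probability measures $\mu$ on $X$ with $\int_X\|x\|_X^p\,d\mu<\infty$, equipped with the $p$-Wasserstein distance $\mathbb{W}_p(\mu,\nu)=\inf_{\pi}\big(\int_{X\times X}\|x-y\|_X^p\,d\pi(x,y)\big)^{1/p}$, infimum over couplings $\pi$ of $\mu,\nu$; it is a Polish space. For $\mu\in\mathcal{P}_p$, $T_{\mu,p}:=L^p(X\to X,\mu)$ and its dual is identified with $T^*_{\mu,p}:=L^{p^*}(X\to X^*,\mu)$ via $\langle\phi',\phi\rangle=\int_X {}_{X^*}\langle\phi'(x),\phi(x)\rangle_X\,\mu(dx)$. For a continuous $f:\mathcal{P}_p\to\mathbb{R}$, $f$ is intrinsically differentiable if for every $\mu$ the map $\phi\mapsto D_\phi f(\mu):=\lim_{\varepsilon\to0}\frac{f(\mu\circ(\mathrm{id}+\varepsilon\phi)^{-1})-f(\mu)}{\varepsilon}$ is a bounded linear functional on $T_{\mu,p}$; $Df(\mu)\in T^*_{\mu,p}$ denotes the representing element. $\mathcal{F}C_b^1(X)$ is the set of functions $x\mapsto g({}_{X^*}\langle x_1',x\rangle_X,\dots,{}_{X^*}\langle x_n',x\rangle_X)$ with $n\in\mathbb{N}$, $x_i'\in X^*$, $g\in C_b^1(\mathbb{R}^n)$. $\mathcal{F}C_b^1(\mathcal{P}_p)$ is the set of functions $\mu\mapsto g(\mu(\psi_1),\dots,\mu(\psi_n))$ on $\mathcal{P}_p$ with $n\in\mathbb{N}$, $\psi_i\in\mathcal{F}C_b^1(X)$,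 $g\in C_b^1(\mathbb{R}^n)$ (here $\mu(\psi)=\int\psi\,d\mu$); for such $f$, $Df(\mu)(x)=\sum_i\partial_ig(\mu(\psi_1),\dots,\mu(\psi_n))\nabla\psi_i(x)$. Dirichlet form notions: $\mathcal{E}_1(f,g)=\Lambda(fg)+\mathcal{E}(f,g)$; conservative means $1\in\mathcal{D}(\mathcal{E})$, $\mathcal{E}(1,1)=0$. For open $O$, $\mathrm{Cap}_1(O)=\inf\{\mathcal{E}_1(f,f): f\in\mathcal{D}(\mathcal{E}), f\ge1\ \Lambda\text{-a.e. on }O\}$, and for arbitrary $A$, $\mathrm{Cap}_1(A)=\inf\{\mathrm{Cap}_1(O):A\subseteq O \text{ open}\}$. A nest is an increasing sequence of closed sets $K_n$ with $\mathrm{Cap}_1(\mathcal{P}_p\setminus K_n)\to0$. A function is quasi-continuous if there is a nest with $f|_{K_n}$ continuous for all $n$. "Quasi-everywhere" means outside a set of zero capacity. $(\mathcal{E},\mathcal{D}(\mathcal{E}))$ is quasi-regular if: (1) there is a nest of compact sets; (2) $\mathcal{D}(\mathcal{E})$ has an $\mathcal{E}_1^{1/2}$-dense subspace of quasi-continuous functions; (3) there is a set $N$ with $\mathrm{Cap}_1(N)=0$ and a sequence of quasi-continuous $f_i\in\mathcal{D}(\mathcal{E})$ separating the points of $\mathcal{P}_p\setminus N$. *)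

theory Defs
  imports "HOL-Analysis.Analysis" "HOL-Probability.Probability"
begin

definition reflexive_space :: "'a::real_normed_vector itself \<Rightarrow> bool" where
  "reflexive_space _ \<longleftrightarrow>
     (\<forall>\<Phi> :: ('a \<Rightarrow>\<^sub>L real) \<Rightarrow>\<^sub>L real. \<exists>x::'a. \<forall>l. blinfun_apply \<Phi> l = blinfun_apply l x)"

definition Pp :: "real \<Rightarrow> ('a::{banach,second_countable_topology}) measure set" where
  "Pp p = {\<mu>. prob_space \<mu> \<and> sets \<mu> = sets borel \<and>
              (\<integral>\<^sup>+ x. ennreal (norm x powr p) \<partial>\<mu>) < \<infinity>}"

definition couplings :: "('a::{banach,second_countable_topology}) measure \<Rightarrow> 'a measure \<Rightarrow> ('a \<times> 'a) measure set" where
  "couplings \<mu> \<nu> = {\<pi>. prob_space \<pi> \<and> sets \<pi> = sets (borel \<Otimes>\<^sub>M borel) \<and>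
                        distr \<pi> borel fst = \<mu> \<and> distr \<pi> borel snd = \<nu>}"

definition Wdist :: "real \<Rightarrow> ('a::{banach,second_countable_topology}) measure \<Rightarrow> 'a measure \<Rightarrow> real" where
  "Wdist p \<mu> \<nu> = enn2real (INF \<pi>\<in>couplings \<mu> \<nu>. \<integral>\<^sup>+ z. ennreal (norm (fst z - snd z) powr p) \<partial>\<pi>) powr (1 / p)"

definition Wtop :: "real \<Rightarrow> ('a::{banach,second_countable_topology}) measure topology" where
  "Wtop p = Metric_space.mtopology (Pp p) (Wdist p)"

definition Wborel :: "real \<Rightarrow> ('a::{banach,second_countable_topology}) measure measure" where
  "Wborel p = sigma (topspace (Wtop p)) {U. openin (Wtop p) U}"

text \<open>C_b^1(R^n), with R^n represented by the first n coordinates of nat \<Rightarrow> real: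
  g depends only on the first n coordinates, is bounded and continuous, and its
  first partial derivatives exist everywhere and are bounded and continuous.\<close>
definition Cb1 :: "nat \<Rightarrow> ((nat \<Rightarrow> real) \<Rightarrow> real) \<Rightarrow> bool" where
  "Cb1 n g \<longleftrightarrow>
     (\<forall>y. g y = g (\<lambda>i. if i < n then y i else 0)) \<and>
     bounded (range g) \<and> continuous_on UNIV g \<and>
     (\<forall>i<n. \<exists>dg. (\<forall>y. ((\<lambda>t. g (y(i := t))) has_real_derivative dg y) (at (y i))) \<and>
                 bounded (range dg) \<and> continuous_on UNIV dg)"

definition FCb1_X :: "('a::{banach,second_countable_topology} \<Rightarrow> real) set" where
  "FCb1_X = {\<psi>. \<exists>n g (l :: nat \<Rightarrow> ('a \<Rightarrow>\<^sub>L real)). Cb1 n g \<and>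
                 \<psi> = (\<lambda>x. g (\<lambda>i. if i < n then blinfun_apply (l i) x else 0))}"

definition FCb1_P :: "('a::{banach,second_countable_topology} measure \<Rightarrow> real) set" where
  "FCb1_P = {f. \<exists>n g (\<psi> :: nat \<Rightarrow> 'a \<Rightarrow> real). Cb1 n g \<and> (\<forall>i<n. \<psi> i \<in> FCb1_X) \<and>
                 f = (\<lambda>\<mu>. g (\<lambda>i. if i < n then (\<integral>x. \<psi> i x \<partial>\<mu>) else 0))}"

definition Lp_fun :: "real \<Rightarrow> ('a::{banach,second_countable_topology}) measure \<Rightarrow> ('a \<Rightarrow> 'a) set" where
  "Lp_fun p \<mu> = {\<phi>. \<phi> \<in> borel_measurable \<mu> \<and> (\<integral>\<^sup>+ x. ennreal (norm (\<phi> x) powr p) \<partial>\<mu>) < \<infinity>}"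

definition Lp_norm :: "real \<Rightarrow> ('a::{banach,second_countable_topology}) measure \<Rightarrow> ('a \<Rightarrow> 'a) \<Rightarrow> real" where
  "Lp_norm p \<mu> \<phi> = enn2real (\<integral>\<^sup>+ x. ennreal (norm (\<phi> x) powr p) \<partial>\<mu>) powr (1 / p)"

definition dir_deriv :: "(('a::{banach,second_countable_topology}) measure \<Rightarrow> real) \<Rightarrow> 'a measure \<Rightarrow> ('a \<Rightarrow> 'a) \<Rightarrow> real" where
  "dir_deriv f \<mu> \<phi> = Lim (at (0::real)) (\<lambda>\<epsilon>. (f (distr \<mu> borel (\<lambda>x. x + \<epsilon> *\<^sub>R \<phi> x)) - f \<mu>) / \<epsilon>)"

definition Dnorm :: "real \<Rightarrow> (('a::{banach,second_countable_topology}) measure \<Rightarrow> real) \<Rightarrow> 'a measure \<Rightarrow> ennreal" where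
  "Dnorm p f \<mu> = (SUP \<phi>\<in>{\<phi>\<in>Lp_fun p \<mu>. Lp_norm p \<mu> \<phi> \<le> 1}. ennreal \<bar>dir_deriv f \<mu> \<phi>\<bar>)"

text \<open>Elements of L^2 and of the domain are represented by functions; D is
  closed under M-a.e. modification and E does not see such modifications.\<close>
definition L2 :: "'b measure \<Rightarrow> ('b \<Rightarrow> real) set" where
  "L2 M = {f. f \<in> borel_measurable M \<and> integrable M (\<lambda>x. (f x)\<^sup>2)}"

definition E1 :: "'b measure \<Rightarrow> (('b \<Rightarrow> real) \<Rightarrow> ('b \<Rightarrow> real) \<Rightarrow> real) \<Rightarrow> ('b \<Rightarrow> real) \<Rightarrow> ('b \<Rightarrow> real) \<Rightarrow> real" where
  "E1 M E f g = (\<integral>x. f x * g x \<partial>M) + E f g"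

definition symmetric_dirichlet_form ::
  "'b measure \<Rightarrow> ('b \<Rightarrow> real) set \<Rightarrow> (('b \<Rightarrow> real) \<Rightarrow> ('b \<Rightarrow> real) \<Rightarrow> real) \<Rightarrow> bool" where
  "symmetric_dirichlet_form M D E \<longleftrightarrow>
     \<comment> \<open>domain: linear subspace of L^2, well-defined on a.e.-classes\<close>
     D \<subseteq> L2 M \<and> (\<lambda>_. 0) \<in> D \<and>
     (\<forall>f\<in>D. \<forall>g\<in>D. (\<lambda>x. f x + g x) \<in> D) \<and>
     (\<forall>c. \<forall>f\<in>D. (\<lambda>x. c * f x) \<in> D) \<and>
     (\<forall>f\<in>D. \<forall>g\<in>L2 M. (AE x in M. f x = g x) \<longrightarrow>
          g \<in> D \<and> (\<forall>h\<in>D. E f h = E g h \<and> E h f = E h g)) \<and>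
     \<comment> \<open>symmetric, bilinear, non-negative definite\<close>
     (\<forall>f\<in>D. \<forall>g\<in>D. E f g = E g f) \<and>
     (\<forall>f\<in>D. \<forall>g\<in>D. \<forall>h\<in>D. E (\<lambda>x. f x + g x) h = E f h + E g h) \<and>
     (\<forall>c. \<forall>f\<in>D. \<forall>g\<in>D. E (\<lambda>x. c * f x) g = c * E f g) \<and>
     (\<forall>f\<in>D. 0 \<le> E f f) \<and>
     \<comment> \<open>densely defined in L^2(M)\<close>
     (\<forall>g\<in>L2 M. \<forall>\<epsilon>>0. \<exists>f\<in>D. (\<integral>x. (f x - g x)\<^sup>2 \<partial>M) < \<epsilon>) \<and>
     \<comment> \<open>closed: (D, E_1^{1/2}) is complete\<close>
     (\<forall>u::nat \<Rightarrow> 'b \<Rightarrow> real. (\<forall>n. u n \<in> D) \<and>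
        (\<forall>\<epsilon>>0. \<exists>N. \<forall>m\<ge>N. \<forall>n\<ge>N. E1 M E (\<lambda>x. u m x - u n x) (\<lambda>x. u m x - u n x) < \<epsilon>) \<longrightarrow>
        (\<exists>f\<in>D. (\<lambda>n. E1 M E (\<lambda>x. u n x - f x) (\<lambda>x. u n x - f x)) \<longlonglongrightarrow> 0)) \<and>
     \<comment> \<open>Markovian: the unit contraction operates\<close>
     (\<forall>f\<in>D. (\<lambda>x. min 1 (max 0 (f x))) \<in> D \<and>
        E (\<lambda>x. min 1 (max 0 (f x))) (\<lambda>x. min 1 (max 0 (f x))) \<le> E f f)"

definition conservative :: "('b \<Rightarrow> real) set \<Rightarrow> (('b \<Rightarrow> real) \<Rightarrow> ('b \<Rightarrow> real) \<Rightarrow> real) \<Rightarrow> bool" where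
  "conservative D E \<longleftrightarrow> (\<lambda>_. 1) \<in> D \<and> E (\<lambda>_. 1) (\<lambda>_. 1) = 0"

definition Cap1_open :: "'b measure \<Rightarrow> ('b \<Rightarrow> real) set \<Rightarrow> (('b \<Rightarrow> real) \<Rightarrow> ('b \<Rightarrow> real) \<Rightarrow> real) \<Rightarrow> 'b set \<Rightarrow> ennreal" where
  "Cap1_open M D E U = (INF f\<in>{f\<in>D. AE x in M. x \<in> U \<longrightarrow> 1 \<le> f x}. ennreal (E1 M E f f))"

definition Cap1 :: "'b topology \<Rightarrow> 'b measure \<Rightarrow> ('b \<Rightarrow> real) set \<Rightarrow> (('b \<Rightarrow> real) \<Rightarrow> ('b \<Rightarrow> real) \<Rightarrow> real) \<Rightarrow> 'b set \<Rightarrow> ennreal" where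
  "Cap1 T M D E A = (INF U\<in>{U. openin T U \<and> A \<subseteq> U}. Cap1_open M D E U)"

definition nest :: "'b topology \<Rightarrow> 'b measure \<Rightarrow> ('b \<Rightarrow> real) set \<Rightarrow> (('b \<Rightarrow> real) \<Rightarrow> ('b \<Rightarrow> real) \<Rightarrow> real) \<Rightarrow> (nat \<Rightarrow> 'b set) \<Rightarrow> bool" where
  "nest T M D E K \<longleftrightarrow> incseq K \<and> (\<forall>n. closedin T (K n)) \<and>
     (\<lambda>n. Cap1 T M D E (topspace T - K n)) \<longlonglongrightarrow> 0"

definition quasi_continuous :: "'b topology \<Rightarrow> 'b measure \<Rightarrow> ('b \<Rightarrow> real) set \<Rightarrow> (('b \<Rightarrow> real) \<Rightarrow> ('b \<Rightarrow> real) \<Rightarrow> real) \<Rightarrow> ('b \<Rightarrow> real) \<Rightarrow> bool" where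
  "quasi_continuous T M D E f \<longleftrightarrow>
     (\<exists>K. nest T M D E K \<and> (\<forall>n. continuous_map (subtopology T (K n)) euclideanreal f))"

definition E1_dense_subspace :: "'b measure \<Rightarrow> ('b \<Rightarrow> real) set \<Rightarrow> (('b \<Rightarrow> real) \<Rightarrow> ('b \<Rightarrow> real) \<Rightarrow> real) \<Rightarrow> ('b \<Rightarrow> real) set \<Rightarrow> bool" where
  "E1_dense_subspace M D E S \<longleftrightarrow> S \<subseteq> D \<and> (\<lambda>_. 0) \<in> S \<and>
     (\<forall>f\<in>S. \<forall>g\<in>S. (\<lambda>x. f x + g x) \<in> S) \<and> (\<forall>c. \<forall>f\<in>S. (\<lambda>x. c * f x) \<in> S) \<and>
     (\<forall>f\<in>D. \<forall>\<epsilon>>0. \<exists>g\<in>S. E1 M E (\<lambda>x. f x - g x) (\<lambda>x. f x - g x) < \<epsilon>)"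

definition quasi_regular :: "'b topology \<Rightarrow> 'b measure \<Rightarrow> ('b \<Rightarrow> real) set \<Rightarrow> (('b \<Rightarrow> real) \<Rightarrow> ('b \<Rightarrow> real) \<Rightarrow> real) \<Rightarrow> bool" where
  "quasi_regular T M D E \<longleftrightarrow>
     (\<exists>K. nest T M D E K \<and> (\<forall>n. compactin T (K n))) \<and>
     (\<exists>S. E1_dense_subspace M D E S \<and> (\<forall>f\<in>S. quasi_continuous T M D E f)) \<and>
     (\<exists>N (f :: nat \<Rightarrow> 'b \<Rightarrow> real). Cap1 T M D E N = 0 \<and>
        (\<forall>i. f i \<in> D \<and> quasi_continuous T M D E (f i)) \<and>
        (\<forall>x\<in>topspace T - N. \<forall>y\<in>topspace T - N. x \<noteq> y \<longrightarrow> (\<exists>i. f i x \<noteq> f i y)))"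

end

theory Submission
  imports Defs
begin

text \<open>
  Let \<open>d\<close> be a dense sequence of \<open>X\<close> with \<open>d 0 = 0\<close>, and let \<open>h\<^sub>n x\<close> be the distance of \<open>x\<close> to
  \<open>{d 0, \<dots>, d n}\<close>. A closed set of measures on which \<open>\<integral> h\<^sub>n\<^sup>p d\<mu>\<close> tends to \<open>0\<close> uniformly is
  compact for the Wasserstein distance, so it suffices to find a nest on which this happens.

  The functions \<open>F\<^sub>n \<mu> = arctan (\<integral> h\<^sub>n\<^sup>p d\<mu>)\<close> decrease to \<open>0\<close> pointwise. Smoothing the minimum and the
  norm (a supremum of countably many functionals) by log-sum-exp keeps \<open>h\<^sub>n\<close> 1-Lipschitz, and then
  \<open>a\<^sup>p\<^sup>-\<^sup>1 b \<le> a\<^sup>p + b\<^sup>p\<close> bounds the intrinsic derivative of the approximating cylinder functions by a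
  constant that depends on \<open>p\<close> only. Hence by \<open>C\<^sub>1\<close> all \<open>F\<^sub>n\<close> lie in the domain with bounded energy, and
  convex combinations \<open>v\<^sub>j\<close> of their tails tend to \<open>0\<close> in \<open>E\<^sub>1\<close>. A convex combination dominates the last
  \<open>F\<^sub>N\<close> occurring in it, so sublevel sets of the form \<open>{v\<^sub>j \<le> 2\<^sup>-\<^sup>j for all j \<ge> m}\<close> are compact; along a
  fast subsequence they form a nest.

  Condition (3) of quasi-regularity holds with the empty set, because countably many cylinder functions
  determine a measure.
\<close>

section \<open>The Wasserstein distance\<close>

text \<open>The obstacle is that \<open>C1\<close> never makes energies small: each
  \<open>h_n\<close> has Lipschitz constant 1 however large \<open>n\<close> is, so the
  \<open>F_n\<close> have bounded energy and nothing decays. Passing to convex combinations turns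
  boundedness into convergence in norm, and because the \<open>F_n\<close> decrease in
  \<open>n\<close>, a combination is as good a test function as a single \<open>F_n\<close>.

  The outer \<open>arctan\<close> does two jobs. It makes the function bounded, as a cylinder
  function has to be, and its derivative 1/(1 + S^2) absorbs the derivative of S = \<integral> h^p
  d\<mu>, which on the unit ball of L^p is at most of order S + 1.

  All functions that cut out the nest are continuous for the Wasserstein distance, not merely
  quasi-continuous, so their sublevel sets are closed and no versions have to be chosen.

  Uniform smallness of \<integral> h_n^p d\<mu> combines tightness with uniform integrability of the
  p-th moments, the two ingredients of relative compactness. The choice \<open>d 0 = 0\<close> gives
  \<open>h_n x \<le> norm x\<close> and with it integrability.\<close>

abbreviation Lp_int :: "real \<Rightarrow> 'b measure \<Rightarrow> ('b \<Rightarrow> real) \<Rightarrow> ennreal" where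
  "Lp_int p M f \<equiv> (\<integral>\<^sup>+x. ennreal (f x powr p) \<partial>M)"

section \<open>Minkowski's inequality for integrals with values in [0, \<infinity>]\<close>

lemma powr_convex_nonneg:
  fixes x y u v p :: real
  assumes "1 \<le> p" "0 \<le> x" "0 \<le> y" "0 \<le> u" "0 \<le> v" "u + v = 1"
  shows "(u * x + v * y) powr p \<le> u * x powr p + v * y powr p"
proof -
  \<comment> \<open>Settles the case of a vanishing argument: a weight \<open>w\<close> in [0, 1]
    satisfies \<open>w powr p \<le> w\<close> because \<open>p \<ge> 1\<close>.\<close>
  have aux: "(w * z) powr p \<le> w * z powr p" if "0 \<le> w" "w \<le> 1" "0 \<le> z" for w z :: real
  proof (cases "w = 0")
    case False
    have "w powr p \<le> w powr 1" using that False assms(1) by (intro powr_mono') auto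
    then show ?thesis using that False by (simp add: powr_mult mult_right_mono)
  qed simp
  consider "x = 0" | "y = 0" | "x > 0" "y > 0" using assms by linarith
  then show ?thesis
  proof cases
    case 3
    have "u = 1 - v" using assms by simp
    then show ?thesis
      using convex_onD[OF powr_convex[OF assms(1)], of v x y] assms(4,5) 3 by simp
  qed (use aux[of v y] aux[of u x] assms in auto)
qed

text \<open>Convexity of the p-th power with the weights a/(a+b) and b/(a+b), applied to f/a and
  g/b, gives a pointwise bound whose integral is (a+b)^p. Writing the bounds as
  \<open>a powr p\<close> avoids roots of possibly infinite integrals.\<close>

lemma nn_integral_Minkowski_pos:
  fixes f g :: "'b \<Rightarrow> real"
  assumes p: "1 \<le> p" and [measurable]: "f \<in> borel_measurable M" "g \<in> borel_measurable M"
    and nonneg: "\<And>x. 0 \<le> f x" "\<And>x. 0 \<le> g x" and ab: "0 < a" "0 < b"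
    and f: "Lp_int p M f \<le> ennreal (a powr p)"
    and g: "Lp_int p M g \<le> ennreal (b powr p)"
  shows "Lp_int p M (\<lambda>x. f x + g x) \<le> ennreal ((a + b) powr p)"
proof -
  define u v where "u = a / (a + b)" and "v = b / (a + b)"
  define \<alpha> \<beta> where "\<alpha> = (a + b) powr p * u / a powr p" and "\<beta> = (a + b) powr p * v / b powr p"
  have uv: "u + v = 1" "0 \<le> u" "0 \<le> v" using ab by (auto simp: u_def v_def add_divide_distrib[symmetric])
  have nn: "0 \<le> \<alpha>" "0 \<le> \<beta>" using ab uv by (auto simp: \<alpha>_def \<beta>_def)
  have pw: "(f x + g x) powr p \<le> \<alpha> * f x powr p + \<beta> * g x powr p" for x
  proof -
    have "f x + g x = (a + b) * (u * (f x / a) + v * (g x / b))"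
    proof -
      have "r / c * (z / r) = z / c" if "r \<noteq> 0" for r c z :: real using that by simp
      then have "u * (f x / a) = f x / (a + b)" "v * (g x / b) = g x / (a + b)"
        using ab unfolding u_def v_def by (metis less_irrefl)+
      then show ?thesis using ab by (simp add: add_divide_distrib[symmetric])
    qed
    then have "(f x + g x) powr p = (a + b) powr p * (u * (f x / a) + v * (g x / b)) powr p"
      using ab uv nonneg[of x] by (simp add: powr_mult)
    also have "\<dots> \<le> (a + b) powr p * (u * (f x / a) powr p + v * (g x / b) powr p)"
      using ab uv nonneg[of x] p by (intro mult_left_mono powr_convex_nonneg) auto
    also have "\<dots> = \<alpha> * f x powr p + \<beta> * g x powr p"
      using ab nonneg[of x] by (simp add: \<alpha>_def \<beta>_def powr_divide algebra_simps)
    finally show ?thesis .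
  qed
  have "Lp_int p M (\<lambda>x. f x + g x)
      \<le> (\<integral>\<^sup>+x. ennreal \<alpha> * ennreal (f x powr p) + ennreal \<beta> * ennreal (g x powr p) \<partial>M)"
    using pw nn by (intro nn_integral_mono) (simp add: ennreal_mult[symmetric] ennreal_plus[symmetric] del: ennreal_plus)
  also have "\<dots> = ennreal \<alpha> * Lp_int p M f + ennreal \<beta> * Lp_int p M g"
    by (simp add: nn_integral_add nn_integral_cmult)
  also have "\<dots> \<le> ennreal \<alpha> * ennreal (a powr p) + ennreal \<beta> * ennreal (b powr p)"
    by (intro add_mono mult_left_mono f g) auto
  also have "\<dots> = ennreal (\<alpha> * a powr p + \<beta> * b powr p)"
    using nn by (simp add: ennreal_mult)
  also have "\<alpha> * a powr p + \<beta> * b powr p = (a + b) powr p * (u + v)"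
    using ab by (simp add: \<alpha>_def \<beta>_def algebra_simps)
  finally show ?thesis using uv by simp
qed

text \<open>A bound equal to 0 is reached by enlarging both bounds by e > 0 and letting e decrease
  to 0.\<close>

lemma nn_integral_Minkowski:
  fixes f g :: "'b \<Rightarrow> real"
  assumes p: "1 \<le> p" and [measurable]: "f \<in> borel_measurable M" "g \<in> borel_measurable M"
    and nonneg: "\<And>x. 0 \<le> f x" "\<And>x. 0 \<le> g x" and ab: "0 \<le> a" "0 \<le> b"
    and f: "Lp_int p M f \<le> ennreal (a powr p)"
    and g: "Lp_int p M g \<le> ennreal (b powr p)"
  shows "Lp_int p M (\<lambda>x. f x + g x) \<le> ennreal ((a + b) powr p)"
proof (rule tendsto_lowerbound)
  have "((\<lambda>e. a + e + (b + e)) \<longlongrightarrow> a + 0 + (b + 0)) (at_right 0)"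
    by (intro tendsto_intros)
  then have "((\<lambda>e. (a + e + (b + e)) powr p) \<longlongrightarrow> (a + 0 + (b + 0)) powr p) (at_right 0)"
    by (rule tendsto_powr'[OF _ tendsto_const]) (use p ab in \<open>auto intro!: eventually_at_rightI[of 0 1]\<close>)
  then show "((\<lambda>e. ennreal ((a + e + (b + e)) powr p)) \<longlongrightarrow> ennreal ((a + b) powr p)) (at_right 0)"
    by (intro tendsto_ennrealI) simp
  have "Lp_int p M (\<lambda>x. f x + g x) \<le> ennreal ((a + e + (b + e)) powr p)" if "e > 0" for e
  proof (rule nn_integral_Minkowski_pos[OF p])
    show "Lp_int p M f \<le> ennreal ((a + e) powr p)"
      using that ab p by (intro order_trans[OF f] ennreal_leI powr_mono2) auto
    show "Lp_int p M g \<le> ennreal ((b + e) powr p)"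
      using that ab p by (intro order_trans[OF g] ennreal_leI powr_mono2) auto
  qed (use nonneg ab that in auto)
  then show "\<forall>\<^sub>F e in at_right 0. Lp_int p M (\<lambda>x. f x + g x) \<le> ennreal ((a + e + (b + e)) powr p)"
    by (auto intro!: eventually_at_rightI[of 0 1])
qed simp

section \<open>Couplings, transport cost and the infimum in the distance\<close>

definition cost :: "real \<Rightarrow> ('a::{banach,second_countable_topology} \<times> 'a) measure \<Rightarrow> ennreal" where
  "cost p \<pi> = Lp_int p \<pi> (\<lambda>z. norm (fst z - snd z))"

lemma PpD:
  assumes "\<mu> \<in> Pp p"
  shows "prob_space \<mu>" "sets \<mu> = sets borel" "space \<mu> = UNIV" 
    "Lp_int p \<mu> norm < \<infinity>"
  using assms sets_eq_imp_space_eq[of \<mu> borel] by (auto simp: Pp_def)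

lemma couplingsD:
  assumes "\<pi> \<in> couplings \<mu> \<nu>"
  shows "prob_space \<pi>" "sets \<pi> = sets (borel \<Otimes>\<^sub>M borel)" "distr \<pi> borel fst = \<mu>" "distr \<pi> borel snd = \<nu>"
    "fst \<in> measurable \<pi> borel" "snd \<in> measurable \<pi> borel"
proof -
  show *: "prob_space \<pi>" "sets \<pi> = sets (borel \<Otimes>\<^sub>M borel)" "distr \<pi> borel fst = \<mu>" "distr \<pi> borel snd = \<nu>"
    using assms by (auto simp: couplings_def)
  show "fst \<in> measurable \<pi> borel" "snd \<in> measurable \<pi> borel"
    by (simp_all add: measurable_cong_sets[OF *(2) refl])
qed

lemma Pp_moment:
  assumes "\<mu> \<in> Pp p" "1 \<le> p"
  obtains a where "0 \<le> a" "Lp_int p \<mu> norm = ennreal (a powr p)"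
proof
  let ?i = "enn2real (Lp_int p \<mu> norm)"
  show "Lp_int p \<mu> norm = ennreal ((?i powr (1/p)) powr p)"
    using PpD[OF assms(1)] assms(2) by (simp add: powr_powr)
qed simp

lemma cost_le_moments:
  assumes "\<pi> \<in> couplings \<mu> \<nu>" "1 \<le> p" "0 \<le> a" "0 \<le> b"
    and "Lp_int p \<mu> norm \<le> ennreal (a powr p)"
    and "Lp_int p \<nu> norm \<le> ennreal (b powr p)"
  shows "cost p \<pi> \<le> ennreal ((a + b) powr p)"
proof -
  note [measurable] = couplingsD(5,6)[OF assms(1)]
  have "cost p \<pi> \<le> Lp_int p \<pi> (\<lambda>z. norm (fst z) + norm (snd z))"
    unfolding cost_def using assms(2)
    by (intro nn_integral_mono ennreal_leI powr_mono2 norm_triangle_ineq4) auto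
  also have "\<dots> \<le> ennreal ((a + b) powr p)"
  proof (rule nn_integral_Minkowski[OF assms(2)])
    show "Lp_int p \<pi> (\<lambda>z. norm (fst z)) \<le> ennreal (a powr p)"
      using assms(5) unfolding couplingsD(3)[OF assms(1), symmetric] by (simp add: nn_integral_distr)
    show "Lp_int p \<pi> (\<lambda>z. norm (snd z)) \<le> ennreal (b powr p)"
      using assms(6) unfolding couplingsD(4)[OF assms(1), symmetric] by (simp add: nn_integral_distr)
  qed (use assms in auto)
  finally show ?thesis .
qed

lemma couplings_pair:
  assumes "\<mu> \<in> Pp p" "\<nu> \<in> Pp p"
  shows "\<mu> \<Otimes>\<^sub>M \<nu> \<in> couplings \<mu> \<nu>"
proof -
  interpret \<mu>: prob_space \<mu> by (rule PpD[OF assms(1)])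
  interpret \<nu>: prob_space \<nu> by (rule PpD[OF assms(2)])
  interpret pair_prob_space \<mu> \<nu> ..
  have s: "sets (\<mu> \<Otimes>\<^sub>M \<nu>) = sets (borel \<Otimes>\<^sub>M borel)"
    by (intro sets_pair_measure_cong PpD[OF assms(1)] PpD[OF assms(2)])
  have [measurable]: "fst \<in> measurable (\<mu> \<Otimes>\<^sub>M \<nu>) borel" "snd \<in> measurable (\<mu> \<Otimes>\<^sub>M \<nu>) borel"
    by (simp_all add: measurable_cong_sets[OF s refl])
  have "distr (\<mu> \<Otimes>\<^sub>M \<nu>) borel fst = \<mu>"
  proof (rule measure_eqI)
    fix A assume "A \<in> sets (distr (\<mu> \<Otimes>\<^sub>M \<nu>) borel fst)"
    then have "A \<in> sets \<mu>" "fst -` A \<inter> space (\<mu> \<Otimes>\<^sub>M \<nu>) = A \<times> space \<nu>"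
      using PpD[OF assms(1)] by (auto simp: space_pair_measure)
    then show "emeasure (distr (\<mu> \<Otimes>\<^sub>M \<nu>) borel fst) A = emeasure \<mu> A"
      using PpD[OF assms(1)]
      by (simp add: emeasure_distr \<nu>.emeasure_pair_measure_Times \<nu>.emeasure_space_1)
  qed (use PpD[OF assms(1)] in simp)
  moreover have "distr (\<mu> \<Otimes>\<^sub>M \<nu>) borel snd = \<nu>"
  proof (rule measure_eqI)
    fix A assume "A \<in> sets (distr (\<mu> \<Otimes>\<^sub>M \<nu>) borel snd)"
    then have "A \<in> sets \<nu>" "snd -` A \<inter> space (\<mu> \<Otimes>\<^sub>M \<nu>) = space \<mu> \<times> A"
      using PpD[OF assms(2)] by (auto simp: space_pair_measure)
    then show "emeasure (distr (\<mu> \<Otimes>\<^sub>M \<nu>) borel snd) A = emeasure \<nu> A"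
      using PpD[OF assms(2)]
      by (simp add: emeasure_distr \<nu>.emeasure_pair_measure_Times \<mu>.emeasure_space_1)
  qed (use PpD[OF assms(2)] in simp)
  ultimately show ?thesis using s by (simp add: couplings_def prob_space_axioms)
qed

text \<open>\<open>Wdist\<close> is built with \<open>enn2real\<close>, which sends \<infinity> to
  0. The product coupling has finite cost for measures with finite p-th moments, so the infimum is
  finite and a small distance does yield a cheap coupling.\<close>

lemma Wdist_lessD:
  assumes "\<mu> \<in> Pp p" "\<nu> \<in> Pp p" "1 \<le> p" "Wdist p \<mu> \<nu> < r"
  obtains \<pi> where "\<pi> \<in> couplings \<mu> \<nu>" "cost p \<pi> \<le> ennreal (r powr p)"
proof -
  obtain a b where ab: "0 \<le> a" "Lp_int p \<mu> norm = ennreal (a powr p)"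
    "0 \<le> b" "Lp_int p \<nu> norm = ennreal (b powr p)"
    using Pp_moment[OF assms(1,3)] Pp_moment[OF assms(2,3)] by metis
  define I where "I = (INF \<pi>\<in>couplings \<mu> \<nu>. cost p \<pi>)"
  have "I \<le> cost p (\<mu> \<Otimes>\<^sub>M \<nu>)"
    unfolding I_def by (intro INF_lower couplings_pair[OF assms(1,2)])
  also have "\<dots> \<le> ennreal ((a + b) powr p)"
    using ab assms by (intro cost_le_moments[OF couplings_pair[OF assms(1,2)]]) auto
  finally have "I < \<infinity>" using ennreal_less_top le_less_trans by (metis infinity_ennreal_def)
  then have I: "I = ennreal (enn2real I)" by simp
  have W: "Wdist p \<mu> \<nu> = enn2real I powr (1/p)" by (simp add: Wdist_def I_def cost_def)
  have "enn2real I = (enn2real I powr (1/p)) powr p" using assms(3) by (simp add: powr_powr)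
  also have "\<dots> < r powr p" using assms W by (intro powr_less_mono2) auto
  finally have "I < ennreal (r powr p)" by (subst I) (simp add: ennreal_less_iff)
  then obtain \<pi> where "\<pi> \<in> couplings \<mu> \<nu>" "cost p \<pi> < ennreal (r powr p)"
    unfolding I_def INF_less_iff by blast
  then show ?thesis using that by force
qed

lemma Wdist_leI:
  assumes "\<pi> \<in> couplings \<mu> \<nu>" "cost p \<pi> \<le> ennreal (r powr p)" "1 \<le> p" "0 \<le> r"
  shows "Wdist p \<mu> \<nu> \<le> r"
proof -
  have "(INF \<pi>\<in>couplings \<mu> \<nu>. cost p \<pi>) \<le> ennreal (r powr p)"
    using assms by (metis INF_lower order_trans)
  then have "enn2real (INF \<pi>\<in>couplings \<mu> \<nu>. cost p \<pi>) \<le> r powr p"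
    by (intro enn2real_leI) auto
  then have "Wdist p \<mu> \<nu> \<le> (r powr p) powr (1/p)"
    unfolding Wdist_def cost_def using assms by (intro powr_mono2) auto
  then show ?thesis using assms by (simp add: powr_powr)
qed

lemma couplings_swap:
  assumes "\<pi> \<in> couplings \<mu> \<nu>"
  shows "distr \<pi> (borel \<Otimes>\<^sub>M borel) prod.swap \<in> couplings \<nu> \<mu>" 
    "cost p (distr \<pi> (borel \<Otimes>\<^sub>M borel) prod.swap) = cost p \<pi>"
proof -
  note d = couplingsD[OF assms]
  note [measurable] = d(5,6)
  have [measurable]: "prod.swap \<in> measurable \<pi> (borel \<Otimes>\<^sub>M borel)"
    unfolding prod.swap_def by measurable
  show "distr \<pi> (borel \<Otimes>\<^sub>M borel) prod.swap \<in> couplings \<nu> \<mu>" using d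
    by (auto simp: couplings_def distr_distr o_def intro!: prob_space.prob_space_distr)
  show "cost p (distr \<pi> (borel \<Otimes>\<^sub>M borel) prod.swap) = cost p \<pi>"
    unfolding cost_def by (subst nn_integral_distr) (auto simp: norm_minus_commute)
qed

lemma Wdist_sym: "Wdist p \<mu> \<nu> = Wdist p \<nu> \<mu>"
proof -
  have "(INF \<pi>\<in>couplings \<mu> \<nu>. cost p \<pi>) \<le> (INF \<pi>\<in>couplings \<nu> \<mu>. cost p \<pi>)" for \<mu> \<nu> :: "'a measure"
    by (intro INF_greatest) (metis INF_lower couplings_swap)
  then have "(INF \<pi>\<in>couplings \<mu> \<nu>. cost p \<pi>) = (INF \<pi>\<in>couplings \<nu> \<mu>. cost p \<pi>)"
    by (intro antisym)
  then show ?thesis by (simp add: Wdist_def cost_def[symmetric])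
qed

section \<open>Countable partitions, gluing of couplings and the triangle inequality\<close>

lemma dense_sequence:
  obtains d :: "nat \<Rightarrow> 'a::{real_normed_vector,second_countable_topology}"
  where "d 0 = 0" "\<And>x e. 0 < e \<Longrightarrow> \<exists>i. dist x (d i) < e"
proof -
  obtain S :: "'a set" where S: "countable S" "\<And>U. open U \<Longrightarrow> U \<noteq> {} \<Longrightarrow> \<exists>d\<in>S. d \<in> U"
    using countable_dense_exists by metis
  have "S \<noteq> {}" using S(2)[of UNIV] by auto
  define d where "d = (\<lambda>n. case n of 0 \<Rightarrow> 0 | Suc m \<Rightarrow> from_nat_into S m)"
  have "\<exists>i. dist x (d i) < e" if e: "0 < e" for x :: 'a and e
  proof -
    obtain s where s: "s \<in> S" "dist x s < e" using S(2)[of "ball x e"] e by auto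
    obtain m where "s = from_nat_into S m" using s S by (metis from_nat_into_surj)
    then have "dist x (d (Suc m)) < e" using s by (simp add: d_def)
    then show ?thesis ..
  qed
  then show ?thesis using that[of d] by (auto simp: d_def)
qed

lemma sets_Collect_eq_nat:
  fixes f g :: "'b \<Rightarrow> nat"
  assumes "f \<in> measurable M (count_space UNIV)" "g \<in> measurable M (count_space UNIV)"
  shows "{x\<in>space M. f x = g x} \<in> sets M"
proof -
  have "{x\<in>space M. f x = g x} = (\<Union>n. (f -` {n} \<inter> space M) \<inter> (g -` {n} \<inter> space M))" by auto
  then show ?thesis using measurable_sets[OF assms(1)] measurable_sets[OF assms(2)] by (auto intro!: sets.Int)
qed

text \<open>The cell of a point is the index of the first member of a dense sequence within
  \<epsilon>/2 of it.\<close>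

lemma countable_cells:
  fixes \<epsilon> :: real
  assumes "0 < \<epsilon>"
  obtains c :: "'a::{banach,second_countable_topology} \<Rightarrow> nat"
  where "c \<in> measurable borel (count_space UNIV)" "\<And>x y. c x = c y \<Longrightarrow> norm (x - y) \<le> \<epsilon>"
proof -
  obtain d :: "nat \<Rightarrow> 'a" where "\<And>x e. 0 < e \<Longrightarrow> \<exists>i. dist x (d i) < e"
    using dense_sequence by metis
  then have ex: "\<exists>i. dist x (d i) < \<epsilon>/2" for x using half_gt_zero[OF assms] by blast
  define c where "c = (\<lambda>x. LEAST i. dist x (d i) < \<epsilon>/2)"
  have "norm (x - y) \<le> \<epsilon>" if "c x = c y" for x y
    using LeastI_ex[OF ex[of x]] LeastI_ex[OF ex[of y]] that dist_triangle2[of x y "d (c x)"]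
    unfolding c_def[symmetric] by (simp add: dist_norm c_def)
  moreover have "c \<in> measurable borel (count_space UNIV)" unfolding c_def by measurable
  ultimately show ?thesis using that by blast
qed

text \<open>Couplings of \<open>(\<mu>, \<nu>)\<close> and \<open>(\<nu>, \<rho>)\<close> are glued only up to the cells of a countable partition of the middle
  space, by a density with respect to the product measure; this avoids disintegration.\<close>

lemma glued_marginal:
  fixes c :: "'c \<Rightarrow> nat"
  assumes "prob_space M" "prob_space N" and [measurable]: "f \<in> measurable M L" "g \<in> measurable N L"
    and eq: "distr M L f = distr N L g" and [measurable]: "c \<in> measurable L (count_space UNIV)"
    and [measurable]: "h \<in> borel_measurable M"
  defines "w \<equiv> \<lambda>n. 1 / emeasure M {x\<in>space M. c (f x) = n}"
  shows "(\<integral>\<^sup>+ x. \<integral>\<^sup>+ y. (if c (f x) = c (g y) then w (c (f x)) else 0) * h x \<partial>N \<partial>M) = (\<integral>\<^sup>+ x. h x \<partial>M)"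
proof (rule nn_integral_cong_AE)
  interpret M: prob_space M by fact
  interpret N: prob_space N by fact
  have eq': "emeasure N {y\<in>space N. c (g y) = n} = emeasure M {x\<in>space M. c (f x) = n}" for n
  proof -
    have "emeasure (distr M L f) {x\<in>space L. c x = n} = emeasure (distr N L g) {x\<in>space L. c x = n}"
      using eq by simp
    moreover have "f -` {x\<in>space L. c x = n} \<inter> space M = {x\<in>space M. c (f x) = n}"
      using measurable_space[OF assms(3)] by auto
    moreover have "g -` {x\<in>space L. c x = n} \<inter> space N = {x\<in>space N. c (g x) = n}"
      using measurable_space[OF assms(4)] by auto
    ultimately show ?thesis by (simp add: emeasure_distr)
  qed
  \<comment> \<open>On a cell of mass zero \<open>w\<close> is 1/0 = \<infinity>. There are only
    countably many cells, so almost every \<open>x\<close> lies in a cell of positive mass.\<close>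
  have "AE x in M. \<forall>n. emeasure M {x\<in>space M. c (f x) = n} = 0 \<longrightarrow> c (f x) \<noteq> n"
    unfolding AE_all_countable
  proof
    fix n
    show "AE x in M. emeasure M {x\<in>space M. c (f x) = n} = 0 \<longrightarrow> c (f x) \<noteq> n"
      by (cases "emeasure M {x\<in>space M. c (f x) = n} = 0") (auto intro!: AE_I'[of "{x\<in>space M. c (f x) = n}"])
  qed
  then show "AE x in M. (\<integral>\<^sup>+ y. (if c (f x) = c (g y) then w (c (f x)) else 0) * h x \<partial>N) = h x"
  proof (rule AE_mp, intro AE_I2 impI)
    fix x assume x: "x \<in> space M" "\<forall>n. emeasure M {x\<in>space M. c (f x) = n} = 0 \<longrightarrow> c (f x) \<noteq> n"
    have "(\<integral>\<^sup>+ y. (if c (f x) = c (g y) then w (c (f x)) else 0) * h x \<partial>N)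
        = (\<integral>\<^sup>+ y. (w (c (f x)) * h x) * indicator {y\<in>space N. c (g y) = c (f x)} y \<partial>N)"
      by (intro nn_integral_cong) (auto simp: indicator_def)
    also have "\<dots> = w (c (f x)) * h x * emeasure M {y\<in>space M. c (f y) = c (f x)}"
      by (subst nn_integral_cmult_indicator) (auto simp: eq')
    also have "\<dots> = h x"
    proof -
      let ?e = "emeasure M {y\<in>space M. c (f y) = c (f x)}"
      have "?e \<noteq> 0" "?e \<noteq> \<infinity>" using x M.emeasure_finite by auto
      then have "1 / ?e * ?e = 1" by (simp add: ennreal_divide_times ennreal_divide_self top.not_eq_extremum[symmetric])
      then show ?thesis by (simp add: w_def ac_simps)
    qed
    finally show "(\<integral>\<^sup>+ y. (if c (f x) = c (g y) then w (c (f x)) else 0) * h x \<partial>N) = h x" .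
  qed
qed


lemma emeasure_distr_nn_integral:
  assumes "f \<in> measurable M N" "A \<in> sets N"
  shows "emeasure (distr M N f) A = (\<integral>\<^sup>+z. indicator A (f z) \<partial>M)"
proof -
  have "emeasure (distr M N f) A = (\<integral>\<^sup>+x. indicator A x \<partial>distr M N f)"
    using assms by (intro nn_integral_indicator[symmetric]) simp
  also have "\<dots> = (\<integral>\<^sup>+z. indicator A (f z) \<partial>M)"
    by (rule nn_integral_distr) (use assms in auto)
  finally show ?thesis .
qed

lemma distr_eqI_nn_integral:
  assumes "f \<in> measurable M L" "g \<in> measurable N L"
    and "\<And>A. A \<in> sets L \<Longrightarrow> (\<integral>\<^sup>+x. indicator A (f x) \<partial>M) = (\<integral>\<^sup>+x. indicator A (g x) \<partial>N)"
  shows "distr M L f = distr N L g"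
  using assms by (intro measure_eqI) (simp_all add: emeasure_distr_nn_integral)

text \<open>\<open>W\<close> couples a pair from \<open>\<pi>1\<close> with a pair from
  \<open>\<pi>2\<close> as soon as their middle points share a cell, and the normalisation by the
  mass of the cell keeps both projections of \<open>M\<close> equal to \<open>\<pi>1\<close> and
  \<open>\<pi>2\<close>. The middle points then differ by at most \<epsilon>, which is the extra
  term in the cost.\<close>

lemma glued_coupling:
  fixes c :: "'a::{banach,second_countable_topology} \<Rightarrow> nat" and \<mu> \<nu> \<rho> :: "'a measure"
  assumes p: "1 \<le> p" and \<pi>1: "\<pi>1 \<in> couplings \<mu> \<nu>" and \<pi>2: "\<pi>2 \<in> couplings \<nu> \<rho>" and \<epsilon>: "0 \<le> \<epsilon>"
    and c[measurable]: "c \<in> measurable borel (count_space UNIV)" and cells: "\<And>x y. c x = c y \<Longrightarrow> norm (x - y) \<le> \<epsilon>"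
    and r: "0 \<le> r" "cost p \<pi>1 \<le> ennreal (r powr p)" "0 \<le> s" "cost p \<pi>2 \<le> ennreal (s powr p)"
  shows "\<exists>\<pi>\<in>couplings \<mu> \<rho>. cost p \<pi> \<le> ennreal ((r + (\<epsilon> + s)) powr p)"
proof -
  note [measurable] = couplingsD(5,6)[OF \<pi>1] couplingsD(5,6)[OF \<pi>2]
  interpret \<pi>1: prob_space \<pi>1 by (rule couplingsD[OF \<pi>1])
  interpret \<pi>2: prob_space \<pi>2 by (rule couplingsD[OF \<pi>2])
  interpret pair_prob_space \<pi>1 \<pi>2 ..
  define w where "w = (\<lambda>n. 1 / emeasure \<pi>1 {z\<in>space \<pi>1. c (snd z) = n})"
  define w' where "w' = (\<lambda>n. 1 / emeasure \<pi>2 {z\<in>space \<pi>2. c (fst z) = n})"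
  define W where "W = (\<lambda>z::('a \<times> 'a) \<times> 'a \<times> 'a. if c (snd (fst z)) = c (fst (snd z)) then w (c (snd (fst z))) else 0)"
  define M where "M = density (\<pi>1 \<Otimes>\<^sub>M \<pi>2) W"
  have [measurable]: "W \<in> borel_measurable (\<pi>1 \<Otimes>\<^sub>M \<pi>2)"
  proof -
    have "(\<lambda>z. c (snd (fst z))) \<in> measurable (\<pi>1 \<Otimes>\<^sub>M \<pi>2) (count_space UNIV)"
      "(\<lambda>z. c (fst (snd z))) \<in> measurable (\<pi>1 \<Otimes>\<^sub>M \<pi>2) (count_space UNIV)"
      by (intro measurable_compose[OF _ c] measurable_compose[OF measurable_fst] 
            measurable_compose[OF measurable_snd] couplingsD(5,6)[OF \<pi>1] couplingsD(5,6)[OF \<pi>2])+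
    have "(\<lambda>x. if f x = g x then w (f x) else 0) \<in> borel_measurable N"
      if f: "f \<in> measurable N (count_space UNIV)" and g: "g \<in> measurable N (count_space UNIV)"
      for f g :: "('a \<times> 'a) \<times> 'a \<times> 'a \<Rightarrow> nat" and N
    proof (rule measurable_If)
      show "(\<lambda>x. w (f x)) \<in> borel_measurable N" by (rule measurable_compose[OF f]) simp
      show "{x\<in>space N. f x = g x} \<in> sets N" by (rule sets_Collect_eq_nat[OF f g])
    qed simp
    with \<open>(\<lambda>z. c (snd (fst z))) \<in> _\<close> \<open>(\<lambda>z. c (fst (snd z))) \<in> _\<close> show ?thesis unfolding W_def by blast
  qed
  \<comment> \<open>Both are reciprocals of the mass of the cell under \<open>\<nu>\<close>. Hence
    the density can be normalised from either side, and \<open>glued_marginal\<close> applies to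
    both projections.\<close>
  have ww': "w = w'"
  proof
    fix n
    have "emeasure (distr \<pi>1 borel snd) {x. c x = n} = emeasure (distr \<pi>2 borel fst) {x. c x = n}"
      by (simp add: couplingsD[OF \<pi>1] couplingsD[OF \<pi>2])
    then show "w n = w' n" by (simp add: emeasure_distr w_def w'_def vimage_def Int_def conj_commute)
  qed
  have m1: "(\<integral>\<^sup>+z. h (fst z) \<partial>M) = (\<integral>\<^sup>+z. h z \<partial>\<pi>1)" if [measurable]: "h \<in> borel_measurable \<pi>1" for h
  proof -
    have "(\<integral>\<^sup>+z. h (fst z) \<partial>M) = (\<integral>\<^sup>+z. W z * h (fst z) \<partial>(\<pi>1 \<Otimes>\<^sub>M \<pi>2))"
      unfolding M_def by (rule nn_integral_density) auto
    also have "\<dots> = (\<integral>\<^sup>+x. \<integral>\<^sup>+y. W (x, y) * h x \<partial>\<pi>2 \<partial>\<pi>1)"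
      by (subst \<pi>2.nn_integral_fst[symmetric]) auto
    also have "\<dots> = (\<integral>\<^sup>+x. \<integral>\<^sup>+y. (if c (snd x) = c (fst y) then w (c (snd x)) else 0) * h x \<partial>\<pi>2 \<partial>\<pi>1)"
      by (intro nn_integral_cong) (auto simp: W_def)
    also have "\<dots> = (\<integral>\<^sup>+z. h z \<partial>\<pi>1)"
      unfolding w_def
      by (rule glued_marginal[where f=snd and g=fst and L=borel and M=\<pi>1 and N=\<pi>2 and c=c and h=h])
         (simp_all add: \<pi>1.prob_space_axioms \<pi>2.prob_space_axioms couplingsD[OF \<pi>1] couplingsD[OF \<pi>2])
    finally show ?thesis .
  qed
  have m2: "(\<integral>\<^sup>+z. h (snd z) \<partial>M) = (\<integral>\<^sup>+z. h z \<partial>\<pi>2)" if [measurable]: "h \<in> borel_measurable \<pi>2" for h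
  proof -
    have "(\<integral>\<^sup>+z. h (snd z) \<partial>M) = (\<integral>\<^sup>+z. W z * h (snd z) \<partial>(\<pi>1 \<Otimes>\<^sub>M \<pi>2))"
      unfolding M_def by (rule nn_integral_density) auto
    also have "\<dots> = (\<integral>\<^sup>+y. \<integral>\<^sup>+x. W (x, y) * h y \<partial>\<pi>1 \<partial>\<pi>2)"
      by (subst nn_integral_snd[symmetric]) auto
    also have "\<dots> = (\<integral>\<^sup>+y. \<integral>\<^sup>+x. (if c (fst y) = c (snd x) then w (c (fst y)) else 0) * h y \<partial>\<pi>1 \<partial>\<pi>2)"
      by (intro nn_integral_cong) (auto simp: W_def)
    also have "\<dots> = (\<integral>\<^sup>+z. h z \<partial>\<pi>2)"
      unfolding ww' w'_def
      by (rule glued_marginal[where f=fst and g=snd and L=borel and M=\<pi>2 and N=\<pi>1 and c=c and h=h])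
         (simp_all add: \<pi>1.prob_space_axioms \<pi>2.prob_space_axioms couplingsD[OF \<pi>1] couplingsD[OF \<pi>2])
    finally show ?thesis .
  qed
  have [simp]: "sets M = sets (\<pi>1 \<Otimes>\<^sub>M \<pi>2)" "space M = space (\<pi>1 \<Otimes>\<^sub>M \<pi>2)" by (auto simp: M_def)
  have meas[measurable_cong]: "sets M = sets (\<pi>1 \<Otimes>\<^sub>M \<pi>2)" by simp
  have "emeasure M (space M) = 1"
    using m1[of "\<lambda>_. 1"] \<pi>1.emeasure_space_1 by simp
  then interpret M: prob_space M by (rule prob_spaceI)
  have "distr M borel (\<lambda>z. fst (fst z)) = distr \<pi>1 borel fst"
    by (rule distr_eqI_nn_integral) (simp_all add: m1[of "\<lambda>z. indicator _ (fst z)", simplified])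
  then have d1: "distr M borel (\<lambda>z. fst (fst z)) = \<mu>" by (simp add: couplingsD[OF \<pi>1])
  have "distr M borel (\<lambda>z. snd (snd z)) = distr \<pi>2 borel snd"
    by (rule distr_eqI_nn_integral) (simp_all add: m2[of "\<lambda>z. indicator _ (snd z)", simplified])
  then have d2: "distr M borel (\<lambda>z. snd (snd z)) = \<rho>" by (simp add: couplingsD[OF \<pi>2])
  define \<pi> where "\<pi> = distr M (borel \<Otimes>\<^sub>M borel) (\<lambda>z. (fst (fst z), snd (snd z)))"
  have "\<pi> \<in> couplings \<mu> \<rho>"
    unfolding couplings_def \<pi>_def by (auto simp: distr_distr o_def d1 d2 intro!: M.prob_space_distr)
  moreover have "cost p \<pi> \<le> ennreal ((r + (\<epsilon> + s)) powr p)"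
  proof -
    \<comment> \<open>The density \<open>W\<close> vanishes where the middle points lie in different
      cells.\<close>
    have ae: "AE z in M. c (snd (fst z)) = c (fst (snd z))"
    proof -
      have "AE z in \<pi>1 \<Otimes>\<^sub>M \<pi>2. 0 < W z \<longrightarrow> c (snd (fst z)) = c (fst (snd z))"
        by (intro AE_I2) (auto simp: W_def)
      then show ?thesis unfolding M_def by (subst AE_density) simp_all
    qed
    have "cost p \<pi> = Lp_int p M (\<lambda>z. norm (fst (fst z) - snd (snd z)))"
      unfolding cost_def \<pi>_def by (subst nn_integral_distr) auto
    also have "\<dots> \<le> Lp_int p M (\<lambda>z. norm (fst (fst z) - snd (fst z)) + (\<epsilon> + norm (fst (snd z) - snd (snd z))))"
    proof (rule nn_integral_mono_AE, use ae in \<open>eventually_elim\<close>)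
      fix z :: "('a \<times> 'a) \<times> 'a \<times> 'a" assume "c (snd (fst z)) = c (fst (snd z))"
      then have "norm (snd (fst z) - fst (snd z)) \<le> \<epsilon>" by (rule cells)
      moreover have "fst (fst z) - snd (snd z) = (fst (fst z) - snd (fst z)) + ((snd (fst z) - fst (snd z)) + (fst (snd z) - snd (snd z)))"
        by simp
      ultimately have "norm (fst (fst z) - snd (snd z)) \<le> norm (fst (fst z) - snd (fst z)) + (\<epsilon> + norm (fst (snd z) - snd (snd z)))"
        by (smt (verit) norm_triangle_ineq)
      then show "ennreal (norm (fst (fst z) - snd (snd z)) powr p) \<le> ennreal ((norm (fst (fst z) - snd (fst z)) + (\<epsilon> + norm (fst (snd z) - snd (snd z)))) powr p)"
        using p by (intro ennreal_leI powr_mono2) auto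
    qed
    also have "\<dots> \<le> ennreal ((r + (\<epsilon> + s)) powr p)"
    proof (rule nn_integral_Minkowski[OF p])
      show "Lp_int p M (\<lambda>z. norm (fst (fst z) - snd (fst z))) \<le> ennreal (r powr p)"
        using m1[of "\<lambda>z. ennreal (norm (fst z - snd z) powr p)"] r(2) by (simp add: cost_def)
      show "Lp_int p M (\<lambda>z. \<epsilon> + norm (fst (snd z) - snd (snd z))) \<le> ennreal ((\<epsilon> + s) powr p)"
      proof (rule nn_integral_Minkowski[OF p])
        show "Lp_int p M (\<lambda>z. norm (fst (snd z) - snd (snd z))) \<le> ennreal (s powr p)"
          using m2[of "\<lambda>z. ennreal (norm (fst z - snd z) powr p)"] r(4) by (simp add: cost_def)
        show "Lp_int p M (\<lambda>z. \<epsilon>) \<le> ennreal (\<epsilon> powr p)"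
          using M.emeasure_space_1 by simp
      qed (use r \<epsilon> in auto)
    qed (use r \<epsilon> in auto)
    finally show ?thesis .
  qed
  ultimately show ?thesis by blast
qed

lemma Wdist_nonneg: "0 \<le> Wdist p \<mu> \<nu>"
  by (simp add: Wdist_def)

text \<open>The slack \<open>e\<close> is shared equally by the two near-optimal couplings and the
  diameter of the cells used for gluing.\<close>

lemma Wdist_triangle:
  fixes \<mu> \<nu> \<rho> :: "'a::{banach,second_countable_topology} measure"
  assumes "\<mu> \<in> Pp p" "\<nu> \<in> Pp p" "\<rho> \<in> Pp p" "1 \<le> p"
  shows "Wdist p \<mu> \<rho> \<le> Wdist p \<mu> \<nu> + Wdist p \<nu> \<rho>"
proof (rule field_le_epsilon)
  fix e :: real assume e: "0 < e"
  define r s where "r = Wdist p \<mu> \<nu> + e/3" and "s = Wdist p \<nu> \<rho> + e/3"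
  obtain \<pi>1 where 1: "\<pi>1 \<in> couplings \<mu> \<nu>" "cost p \<pi>1 \<le> ennreal (r powr p)"
    using Wdist_lessD[OF assms(1,2,4), of r] e by (auto simp: r_def)
  obtain \<pi>2 where 2: "\<pi>2 \<in> couplings \<nu> \<rho>" "cost p \<pi>2 \<le> ennreal (s powr p)"
    using Wdist_lessD[OF assms(2,3,4), of s] e by (auto simp: s_def)
  obtain c :: "'a \<Rightarrow> nat" where c: "c \<in> measurable borel (count_space UNIV)" "\<And>x y. c x = c y \<Longrightarrow> norm (x - y) \<le> e/3"
    using countable_cells[of "e/3"] e by auto
  have rs: "0 \<le> r" "0 \<le> s" using e Wdist_nonneg[of p] by (auto simp: r_def s_def intro!: add_nonneg_nonneg)
  obtain \<pi> where "\<pi> \<in> couplings \<mu> \<rho>" "cost p \<pi> \<le> ennreal ((r + (e/3 + s)) powr p)"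
    using glued_coupling[OF assms(4) 1(1) 2(1) _ c rs(1) 1(2) rs(2) 2(2)] e by auto
  then have "Wdist p \<mu> \<rho> \<le> r + (e/3 + s)"
    using rs e assms(4) by (intro Wdist_leI) auto
  then show "Wdist p \<mu> \<rho> \<le> Wdist p \<mu> \<nu> + Wdist p \<nu> \<rho> + e" by (simp add: r_def s_def)
qed

lemma Wdist_self:
  assumes "\<mu> \<in> Pp p" "1 \<le> p"
  shows "Wdist p \<mu> \<mu> = 0"
proof -
  note m = PpD[OF assms(1)]
  interpret prob_space \<mu> by (rule m)
  have [measurable]: "(\<lambda>x. x) \<in> measurable \<mu> borel" using m by (simp add: measurable_ident_sets)
  have "distr \<mu> (borel \<Otimes>\<^sub>M borel) (\<lambda>x. (x, x)) \<in> couplings \<mu> \<mu>"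
    unfolding couplings_def using m
    by (auto simp: distr_distr o_def intro!: prob_space_distr distr_id2)
  moreover have "cost p (distr \<mu> (borel \<Otimes>\<^sub>M borel) (\<lambda>x. (x, x))) \<le> ennreal (0 powr p)"
    unfolding cost_def by (subst nn_integral_distr) auto
  ultimately have "Wdist p \<mu> \<mu> \<le> 0" using assms by (intro Wdist_leI) auto
  then show ?thesis using Wdist_nonneg[of p \<mu> \<mu>] by simp
qed

section \<open>Functionals that are Lipschitz for the Wasserstein distance\<close>

lemma integral_Lipschitz_Wdist:
  fixes \<psi> :: "'a::{banach,second_countable_topology} \<Rightarrow> real"
  assumes "\<mu> \<in> Pp p" "\<nu> \<in> Pp p" and p: "1 \<le> p" and L: "0 \<le> L"
    and lip: "\<And>x y. \<bar>\<psi> x - \<psi> y\<bar> \<le> L * norm (x - y)" and bnd: "\<And>x. \<bar>\<psi> x\<bar> \<le> B"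
    and [measurable]: "\<psi> \<in> borel_measurable borel"
  shows "\<bar>(\<integral>x. \<psi> x \<partial>\<mu>) - (\<integral>x. \<psi> x \<partial>\<nu>)\<bar> \<le> 2 * L * Wdist p \<mu> \<nu>"
proof -
  have "\<bar>(\<integral>x. \<psi> x \<partial>\<mu>) - (\<integral>x. \<psi> x \<partial>\<nu>)\<bar> \<le> 2 * L * e" if e: "Wdist p \<mu> \<nu> < e" for e
  proof -
    have e0: "0 < e" using e Wdist_nonneg[of p \<mu> \<nu>] by simp
    obtain \<pi> where \<pi>: "\<pi> \<in> couplings \<mu> \<nu>" "cost p \<pi> \<le> ennreal (e powr p)"
      using Wdist_lessD[OF assms(1,2) p e] .
    note [measurable] = couplingsD(5,6)[OF \<pi>(1)]
    interpret prob_space \<pi> by (rule couplingsD[OF \<pi>(1)])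
    have int: "integrable \<pi> (\<lambda>z. \<psi> (fst z))" "integrable \<pi> (\<lambda>z. \<psi> (snd z))"
      using bnd by (auto intro!: integrable_const_bound[where B=B])
    have eq: "(\<integral>x. \<psi> x \<partial>\<mu>) - (\<integral>x. \<psi> x \<partial>\<nu>) = (\<integral>z. \<psi> (fst z) - \<psi> (snd z) \<partial>\<pi>)"
      using int by (simp add: couplingsD(3,4)[OF \<pi>(1), symmetric] integral_distr)
    \<comment> \<open>Stands in for Hoelder's inequality: a distance above \<open>e\<close> is at
      most e^(1-p) times its p-th power. As the cost is at most e^p, both summands integrate to at
      most \<open>L * e\<close>, which is where the factor 2 comes from.\<close>
    have pw: "\<bar>\<psi> x - \<psi> y\<bar> \<le> L * (e + e powr (1 - p) * norm (x - y) powr p)" for x y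
    proof (cases "norm (x - y) \<le> e")
      case True
      have "\<bar>\<psi> x - \<psi> y\<bar> \<le> L * norm (x - y)" by (rule lip)
      also have "\<dots> \<le> L * (e + e powr (1 - p) * norm (x - y) powr p)"
        using L True by (intro mult_left_mono) (auto intro: add_increasing2)
      finally show ?thesis .
    next
      case False
      have "norm (x - y) = norm (x - y) powr (1 - p) * norm (x - y) powr p"
        using False e0 by (simp add: powr_add[symmetric])
      also have "\<dots> \<le> e powr (1 - p) * norm (x - y) powr p"
        using False e0 p by (intro mult_right_mono powr_mono2') auto
      finally have "norm (x - y) \<le> e + e powr (1 - p) * norm (x - y) powr p" using e0 by simp
      then show ?thesis using lip[of x y] L by (meson mult_left_mono order_trans)
    qed
    have "ennreal \<bar>\<integral>z. \<psi> (fst z) - \<psi> (snd z) \<partial>\<pi>\<bar> \<le> (\<integral>\<^sup>+z. ennreal \<bar>\<psi> (fst z) - \<psi> (snd z)\<bar> \<partial>\<pi>)"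
      using integral_norm_bound_ennreal[of \<pi> "\<lambda>z. \<psi> (fst z) - \<psi> (snd z)"] int by simp
    also have "\<dots> \<le> (\<integral>\<^sup>+z. ennreal (L * e) + ennreal (L * e powr (1 - p)) * ennreal (norm (fst z - snd z) powr p) \<partial>\<pi>)"
      using pw L e0 by (intro nn_integral_mono) (auto simp: ennreal_mult[symmetric] ennreal_plus[symmetric] algebra_simps simp del: ennreal_plus)
    also have "\<dots> = ennreal (L * e) + ennreal (L * e powr (1 - p)) * cost p \<pi>"
      using emeasure_space_1 by (simp add: nn_integral_add nn_integral_cmult cost_def)
    also have "\<dots> \<le> ennreal (L * e) + ennreal (L * e powr (1 - p)) * ennreal (e powr p)"
      using \<pi>(2) by (intro add_mono mult_left_mono) auto
    also have "\<dots> = ennreal (L * e + L * e)"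
      using L e0 by (simp add: ennreal_mult[symmetric] mult.assoc powr_add[symmetric] ennreal_plus[symmetric] del: ennreal_plus)
    finally show ?thesis using L e0 eq by simp
  qed
  then have "\<bar>(\<integral>x. \<psi> x \<partial>\<mu>) - (\<integral>x. \<psi> x \<partial>\<nu>)\<bar> \<le> 2 * L * Wdist p \<mu> \<nu> + d" if "d > 0" for d
  proof (cases "L = 0")
    case True then show ?thesis using that \<open>\<And>e. Wdist p \<mu> \<nu> < e \<Longrightarrow> _\<close>[of "Wdist p \<mu> \<nu> + 1"] by simp
  next
    case False
    then show ?thesis using that L \<open>\<And>e. Wdist p \<mu> \<nu> < e \<Longrightarrow> _\<close>[of "Wdist p \<mu> \<nu> + d / (2 * L)"] by (simp add: algebra_simps)
  qed
  then show ?thesis by (rule field_le_epsilon)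
qed

text \<open>Minkowski's inequality under a coupling of cost at most r^p: the L^p norm of a
  non-negative 1-Lipschitz function changes by no more than the distance of the measures. The
  continuity of \<open>tight_fun\<close> rests on this.\<close>

lemma Lp_norm_Lipschitz_Wdist:
  fixes h :: "'a::{banach,second_countable_topology} \<Rightarrow> real"
  assumes "\<mu> \<in> Pp p" "\<nu> \<in> Pp p" and p: "1 \<le> p"
    and lip: "\<And>x y. h x \<le> h y + norm (x - y)" and nn: "\<And>x. 0 \<le> h x"
    and [measurable]: "h \<in> borel_measurable borel" and a: "0 \<le> a"
    and le: "Lp_int p \<nu> h \<le> ennreal (a powr p)" and W: "Wdist p \<mu> \<nu> < r"
  shows "Lp_int p \<mu> h \<le> ennreal ((a + r) powr p)"
proof -
  obtain \<pi> where \<pi>: "\<pi> \<in> couplings \<mu> \<nu>" "cost p \<pi> \<le> ennreal (r powr p)"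
    using Wdist_lessD[OF assms(1,2) p W] .
  note [measurable] = couplingsD(5,6)[OF \<pi>(1)]
  have "Lp_int p \<mu> h = Lp_int p \<pi> (\<lambda>z. h (fst z))"
    unfolding couplingsD(3)[OF \<pi>(1), symmetric] by (simp add: nn_integral_distr)
  also have "\<dots> \<le> Lp_int p \<pi> (\<lambda>z. h (snd z) + norm (fst z - snd z))"
    using p nn lip by (intro nn_integral_mono ennreal_leI powr_mono2) auto
  also have "\<dots> \<le> ennreal ((a + r) powr p)"
  proof (rule nn_integral_Minkowski[OF p])
    show "Lp_int p \<pi> (\<lambda>z. h (snd z)) \<le> ennreal (a powr p)"
      using le unfolding couplingsD(4)[OF \<pi>(1), symmetric] by (simp add: nn_integral_distr)
  qed (use nn a \<pi>(2) W Wdist_nonneg[of p \<mu> \<nu>] in \<open>auto simp: cost_def\<close>)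
  finally show ?thesis .
qed

lemma Wdist_distr_le:
  fixes Z Z' :: "'b \<Rightarrow> 'a::{banach,second_countable_topology}"
  assumes "prob_space \<Omega>" and [measurable]: "Z \<in> borel_measurable \<Omega>" "Z' \<in> borel_measurable \<Omega>"
    and "1 \<le> p" "0 \<le> r" "Lp_int p \<Omega> (\<lambda>\<omega>. norm (Z \<omega> - Z' \<omega>)) \<le> ennreal (r powr p)"
  shows "Wdist p (distr \<Omega> borel Z) (distr \<Omega> borel Z') \<le> r"
proof (rule Wdist_leI)
  interpret prob_space \<Omega> by fact
  show "distr \<Omega> (borel \<Otimes>\<^sub>M borel) (\<lambda>\<omega>. (Z \<omega>, Z' \<omega>)) \<in> couplings (distr \<Omega> borel Z) (distr \<Omega> borel Z')"
    unfolding couplings_def by (auto simp: distr_distr o_def intro!: prob_space_distr)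
  show "cost p (distr \<Omega> (borel \<Otimes>\<^sub>M borel) (\<lambda>\<omega>. (Z \<omega>, Z' \<omega>))) \<le> ennreal (r powr p)"
    unfolding cost_def using assms by (subst nn_integral_distr) auto
qed (use assms in auto)

section \<open>Norming functionals and measure-determining cylinder functions\<close>

text \<open>Hahn-Banach by successive flattening: \<open>flatten q y\<close> is the largest sublinear functional below \<open>q\<close> that
  is linear along \<open>y\<close>. Flattening along a dense sequence makes the limit linear, without Zorn's lemma.\<close>

definition norm_sublinear :: "('a::real_normed_vector \<Rightarrow> real) \<Rightarrow> bool" where
  "norm_sublinear q \<longleftrightarrow> (\<forall>x y. q (x + y) \<le> q x + q y) \<and> (\<forall>c>0. \<forall>x. q (c *\<^sub>R x) = c * q x) \<and> (\<forall>x. q x \<le> norm x)"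

definition flatten :: "('a::real_normed_vector \<Rightarrow> real) \<Rightarrow> 'a \<Rightarrow> 'a \<Rightarrow> real" where
  "flatten q y x = (INF t\<in>{0..}. q (x + t *\<^sub>R y) - t * q y)"

lemma norm_sublinearD:
  assumes "norm_sublinear q"
  shows "q (x + y) \<le> q x + q y" "c > 0 \<Longrightarrow> q (c *\<^sub>R x) = c * q x" "q x \<le> norm x" "q 0 = 0" "- q (- x) \<le> q x"
proof -
  show *: "q (x + y) \<le> q x + q y" "c > 0 \<Longrightarrow> q (c *\<^sub>R x) = c * q x" "q x \<le> norm x" for x y c
    using assms by (auto simp: norm_sublinear_def)
  show "q 0 = 0" using *(2)[of 2 0] by simp
  then show "- q (- x) \<le> q x" using *(1)[of x "-x"] by simp
qed

text \<open>By subadditivity the values are bounded below by \<open>- q (- x)\<close>, so the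
  infimum over the reals is a genuine one.\<close>

lemma flatten_le:
  assumes q: "norm_sublinear q" and "0 \<le> t"
  shows "flatten q y x \<le> q (x + t *\<^sub>R y) - t * q y"
proof -
  note d = norm_sublinearD[OF q]
  have "- q (- x) \<le> q (x + t *\<^sub>R y) - t * q y" if "0 \<le> t" for t
  proof (cases "t = 0")
    case False
    then have "t * q y = q (t *\<^sub>R y)" using that d(2)[of t y] by simp
    also have "\<dots> \<le> q (x + t *\<^sub>R y) + q (- x)" using d(1)[of "x + t *\<^sub>R y" "- x"] by simp
    finally show ?thesis by simp
  qed (use d(5)[of x] in simp)
  then have "bdd_below ((\<lambda>t. q (x + t *\<^sub>R y) - t * q y) ` {0..})"
    by (intro bdd_belowI2[of _ "- q (- x)"]) auto
  then show ?thesis unfolding flatten_def using assms(2) by (intro cINF_lower) auto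
qed

lemma flatten_greatest: "(\<And>t. 0 \<le> t \<Longrightarrow> b \<le> q (x + t *\<^sub>R y) - t * q y) \<Longrightarrow> b \<le> flatten q y x"
  unfolding flatten_def by (intro cINF_greatest) auto

lemma norm_sublinear_flatten:
  assumes q: "norm_sublinear q"
  shows "norm_sublinear (flatten q y)"
proof -
  note d = norm_sublinearD[OF q]
  have "flatten q y (u + v) \<le> flatten q y u + flatten q y v" for u v
  proof -
    have "flatten q y (u + v) - flatten q y u \<le> flatten q y v"
    proof (rule flatten_greatest)
      fix t :: real assume t: "0 \<le> t"
      have "flatten q y (u + v) - (q (v + t *\<^sub>R y) - t * q y) \<le> flatten q y u"
      proof (rule flatten_greatest)
        fix s :: real assume s: "0 \<le> s"
        \<comment> \<open>The parameter \<open>s + t\<close> is admissible for \<open>u + v\<close>,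
          and its share of \<open>y\<close> can be split between \<open>u\<close> and
          \<open>v\<close>.\<close>
        have "flatten q y (u + v) \<le> q ((u + v) + (s + t) *\<^sub>R y) - (s + t) * q y"
          using s t by (intro flatten_le[OF q]) auto
        also have "(u + v) + (s + t) *\<^sub>R y = (u + s *\<^sub>R y) + (v + t *\<^sub>R y)" by (simp add: algebra_simps)
        finally show "flatten q y (u + v) - (q (v + t *\<^sub>R y) - t * q y) \<le> q (u + s *\<^sub>R y) - s * q y"
          using d(1)[of "u + s *\<^sub>R y" "v + t *\<^sub>R y"] by (simp add: algebra_simps)
      qed
      then show "flatten q y (u + v) - flatten q y u \<le> q (v + t *\<^sub>R y) - t * q y" by simp
    qed
    then show ?thesis by simp
  qed
  moreover have le: "flatten q y (c *\<^sub>R x) \<le> c * flatten q y x" if c: "c > 0" for c x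
  proof -
    have "flatten q y (c *\<^sub>R x) / c \<le> flatten q y x"
    proof (rule flatten_greatest)
      fix t :: real assume t: "0 \<le> t"
      have "flatten q y (c *\<^sub>R x) \<le> q (c *\<^sub>R x + (c * t) *\<^sub>R y) - (c * t) * q y"
        using t c by (intro flatten_le[OF q]) auto
      also have "c *\<^sub>R x + (c * t) *\<^sub>R y = c *\<^sub>R (x + t *\<^sub>R y)" by (simp add: algebra_simps)
      also have "q \<dots> = c * q (x + t *\<^sub>R y)" by (rule d(2)[OF c])
      finally show "flatten q y (c *\<^sub>R x) / c \<le> q (x + t *\<^sub>R y) - t * q y" using c by (simp add: field_simps)
    qed
    then show ?thesis using c by (simp add: field_simps)
  qed
  moreover have "flatten q y (c *\<^sub>R x) = c * flatten q y x" if c: "c > 0" for c x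
  proof (rule antisym[OF le[OF c]])
    show "c * flatten q y x \<le> flatten q y (c *\<^sub>R x)"
      using le[of "inverse c" "c *\<^sub>R x"] c by (simp add: field_simps)
  qed
  moreover have "flatten q y x \<le> norm x" for x
    using flatten_le[OF q, of 0 y x] d(3)[of x] by simp
  ultimately show ?thesis unfolding norm_sublinear_def by blast
qed

lemma flatten_minus_le: "norm_sublinear q \<Longrightarrow> flatten q y (- y) \<le> - q y"
  using flatten_le[of q 1 y "- y"] norm_sublinearD(4)[of q] by simp

text \<open>The first direction is \<open>x0\<close> itself: flattening the norm along it forces
  \<open>l (- x0) \<le> - norm x0\<close>. Along the dense sequence the flattenings give
  \<open>l u + l (- u) \<le> 0\<close>, which extends to all \<open>u\<close> because
  \<open>l\<close> is 1-Lipschitz. A sublinear functional with this property is linear.\<close>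

lemma Hahn_Banach_norming:
  fixes x0 :: "'a::{real_normed_vector,second_countable_topology}"
  shows "\<exists>l :: 'a \<Rightarrow>\<^sub>L real. norm l \<le> 1 \<and> blinfun_apply l x0 = norm x0"
proof -
  obtain d :: "nat \<Rightarrow> 'a" where d: "\<And>x e. 0 < e \<Longrightarrow> \<exists>i. dist x (d i) < e"
    using dense_sequence by metis
  define y where "y = (\<lambda>n. case n of 0 \<Rightarrow> x0 | Suc m \<Rightarrow> d m)"
  define Q where "Q = rec_nat norm (\<lambda>n q. flatten q (y n))"
  have Q0: "Q 0 = norm" and QS: "Q (Suc n) = flatten (Q n) (y n)" for n by (auto simp: Q_def)
  have sub: "norm_sublinear (Q n)" for n
    by (induction n) (auto simp: Q0 QS norm_sublinear_flatten, auto simp: norm_sublinear_def norm_triangle_ineq)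
  note s = norm_sublinearD[OF sub]
  have dec: "decseq (\<lambda>n. Q n x)" for x
    unfolding decseq_Suc_iff QS using flatten_le[OF sub, of 0] by simp
  have lb: "- norm x \<le> Q n x" for n x using s(5)[of n x] s(3)[of n "-x"] by simp
  have "\<exists>L. (\<lambda>n. Q n x) \<longlonglongrightarrow> L" for x
    using decseq_convergent[OF dec] lb by metis
  then obtain l where l: "\<And>x. (\<lambda>n. Q n x) \<longlonglongrightarrow> l x" by metis
  have l_le: "l x \<le> Q n x" for n x by (rule decseq_ge[OF dec l])
  have l_add: "l (u + v) \<le> l u + l v" for u v
    by (rule LIMSEQ_le[OF l tendsto_add[OF l l]]) (use s(1) in auto)
  have l_scale: "l (c *\<^sub>R x) = c * l x" if "c > 0" for c x
    by (rule LIMSEQ_unique[OF l]) (use s(2)[OF that] tendsto_mult_left[OF l, of c x] in simp)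
  have l_norm: "l x \<le> norm x" for x using l_le[of x 0] by (simp add: Q0)
  have l_lip: "\<bar>l u - l v\<bar> \<le> norm (u - v)" for u v
    using l_add[of "u - v" v] l_add[of "v - u" u] l_norm[of "u - v"] l_norm[of "v - u"]
    by (simp add: norm_minus_commute)
  have l_y: "l (y n) + l (- y n) \<le> 0" for n
    using l_le[of "y n" n] l_le[of "- y n" "Suc n"] flatten_minus_le[OF sub, of n "y n"] by (simp add: QS)
  have l_neg_le: "l u + l (- u) \<le> 0" for u
  proof (rule field_le_epsilon)
    fix e :: real assume "0 < e"
    then obtain i where i: "dist u (d i) < e/2" using d[of "e/2" u] by auto
    have "l u \<le> l (d i) + dist u (d i)" "l (- u) \<le> l (- d i) + dist u (d i)"
      using l_lip[of u "d i"] l_lip[of "- u" "- d i"] by (auto simp: dist_norm norm_minus_commute)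
    then show "l u + l (- u) \<le> 0 + e" using i l_y[of "Suc i"] by (simp add: y_def)
  qed
  have l0: "l 0 = 0" using l_scale[of 2 0] by simp
  have l_neg: "l (- u) = - l u" for u using l_neg_le[of u] l_add[of u "-u"] l0 by simp
  have lin: "l (u + v) = l u + l v" for u v
    using l_add[of u v] l_add[of "u + v" "- v"] l_add[of "u+v" "-u"] l_neg[of v] by simp
  have sc: "l (c *\<^sub>R x) = c * l x" for c x
    using l_scale[of c x] l_scale[of "- c" x] l0 l_neg[of "c *\<^sub>R x"]
    by (cases "c = 0"; cases "c > 0") auto
  have bl: "bounded_linear l"
    by (rule bounded_linear_intro[of _ 1]) (use lin sc l_lip[of _ 0] l0 in auto)
  have app: "blinfun_apply (Blinfun l) = l" using bl by (simp add: bounded_linear_Blinfun_apply)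
  have "norm (Blinfun l) \<le> 1"
    by (rule norm_blinfun_bound) (use l_lip[of _ 0] l0 app in auto)
  moreover have "l x0 = norm x0"
    using l_norm[of x0] l_le[of "- y 0" "Suc 0"] flatten_minus_le[OF sub, of 0 "y 0"] l_neg[of x0]
    by (simp add: QS y_def Q0)
  ultimately show ?thesis using app by metis
qed

section \<open>Norming functionals and a countable generator of the Borel sets\<close>

definition norming_seq :: "(nat \<Rightarrow> 'a::real_normed_vector \<Rightarrow>\<^sub>L real) \<Rightarrow> bool" where
  "norming_seq l \<longleftrightarrow> (\<forall>j x. \<bar>l j x\<bar> \<le> norm x) \<and> (\<forall>x. \<forall>e>0. \<exists>j. norm x - e < l j x)"

text \<open>Take norming functionals at the points of a dense sequence. The norm and each
  \<open>l j\<close> are 1-Lipschitz, so replacing \<open>x\<close> by a point within e/2 costs less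
  than \<open>e\<close> in total.\<close>

lemma norming_seq_exists:
  "\<exists>l :: nat \<Rightarrow> 'a::{real_normed_vector,second_countable_topology} \<Rightarrow>\<^sub>L real. norming_seq l"
proof -
  obtain d :: "nat \<Rightarrow> 'a" where d: "\<And>x e. 0 < e \<Longrightarrow> \<exists>i. dist x (d i) < e"
    using dense_sequence by metis
  have "\<forall>j. \<exists>l :: 'a \<Rightarrow>\<^sub>L real. norm l \<le> 1 \<and> blinfun_apply l (d j) = norm (d j)"
    using Hahn_Banach_norming by blast
  then obtain l :: "nat \<Rightarrow> 'a \<Rightarrow>\<^sub>L real" where l: "\<And>j. norm (l j) \<le> 1" "\<And>j. l j (d j) = norm (d j)" by metis
  have b: "\<bar>l j x\<bar> \<le> norm x" for j x
    using norm_blinfun[of "l j" x] mult_right_mono[OF l(1)[of j], of "norm x"] by simp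
  moreover have "\<exists>j. norm x - e < l j x" if e: "0 < e" for x e
  proof -
    obtain j where j: "dist x (d j) < e/2" using d[of "e/2" x] e by auto
    have "l j (d j) - l j x = l j (d j - x)" by (simp add: blinfun.diff_right)
    then have "norm (d j) - l j x \<le> norm (d j - x)" using b[of j "d j - x"] l(2)[of j] by simp
    moreover have "norm x \<le> norm (d j) + norm (d j - x)" by (metis norm_minus_commute norm_triangle_sub)
    ultimately have "norm x - e < l j x" using j by (simp add: dist_norm norm_minus_commute)
    then show ?thesis ..
  qed
  ultimately show ?thesis unfolding norming_seq_def by blast
qed

lemma norm_le_iff_norming:
  assumes "norming_seq l"
  shows "norm x \<le> r \<longleftrightarrow> (\<forall>j. l j x \<le> r)"
proof
  assume le: "\<forall>j. l j x \<le> r"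
  have "norm x \<le> r + e" if e: "e > 0" for e
  proof -
    obtain j where "norm x - e < l j x" using assms e unfolding norming_seq_def by blast
    then show ?thesis using le[rule_format, of j] by simp
  qed
  then show "norm x \<le> r" by (rule field_le_epsilon)
next
  assume "norm x \<le> r"
  then show "\<forall>j. l j x \<le> r" using assms unfolding norming_seq_def by (meson abs_le_D1 order_trans)
qed

text \<open>Lists with rational levels make the family countable, which later yields a countable
  separating family, and concatenation makes it closed under intersection, as uniqueness of measures
  requires.\<close>

definition half_spaces :: "(nat \<Rightarrow> 'a::real_normed_vector \<Rightarrow>\<^sub>L real) \<Rightarrow> (nat \<times> rat) list \<Rightarrow> 'a set" where
  "half_spaces l xs = {x. \<forall>i<length xs. l (fst (xs ! i)) x \<le> of_rat (snd (xs ! i))}"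

lemma half_spaces_append: "half_spaces l (xs @ ys) = half_spaces l xs \<inter> half_spaces l ys"
proof -
  have "half_spaces l zs = {x. \<forall>z\<in>set zs. l (fst z) x \<le> of_rat (snd z)}" for zs
    by (auto simp: half_spaces_def all_set_conv_all_nth)
  then show ?thesis by auto
qed

text \<open>The norm is the supremum of the \<open>l j\<close>, so a closed ball is a countable
  intersection of half-spaces; every open set is a countable union of closed balls with radii
  \<open>1 / Suc n\<close> around points of a dense sequence.\<close>

lemma borel_eq_half_spaces:
  fixes l :: "nat \<Rightarrow> 'a::{real_normed_vector,second_countable_topology} \<Rightarrow>\<^sub>L real"
  assumes l: "norming_seq l"
  shows "sets borel = sigma_sets UNIV (range (half_spaces l))"
proof
  define S where "S = sigma UNIV (range (half_spaces l))"
  have sS: "sets S = sigma_sets UNIV (range (half_spaces l))" "space S = UNIV" by (auto simp: S_def sets_measure_of)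
  have le1: "{x. l j x \<le> a} \<in> sets S" for j a
  proof -
    have "half_spaces l [(j, q)] = {x. l j x \<le> of_rat q}" for q by (auto simp: half_spaces_def)
    then have "{x. l j x \<le> of_rat q} \<in> sets S" for q unfolding sS by (metis range_eqI sigma_sets.Basic)
    moreover have "{x. l j x \<le> a} = (\<Inter>q\<in>{q. a < of_rat q}. {x. l j x \<le> of_rat q})"
    proof (auto, rule ccontr)
      fix x assume H: "\<forall>q. a < of_rat q \<longrightarrow> l j x \<le> of_rat q" "\<not> l j x \<le> a"
      then obtain q where "a < of_rat q" "of_rat q < l j x" using of_rat_dense[of a "l j x"] by auto
      then show False using H by force
    qed
    moreover obtain q where "a < of_rat q" using of_rat_dense[of a "a + 1"] by auto
    ultimately show ?thesis
      by (auto intro!: sets.countable_INT)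
  qed
  have cb: "cball c r \<in> sets S" for c r
  proof -
    have "cball c r = (\<Inter>j. {x. l j x \<le> l j c + r})"
      using norm_le_iff_norming[OF l, of "_ - c" r] by (auto simp: dist_norm norm_minus_commute blinfun.diff_right algebra_simps)
    then show ?thesis using le1 by (auto intro!: sets.countable_INT'')
  qed
  have op: "U \<in> sets S" if "open U" for U :: "'a set"
  proof -
    obtain d :: "nat \<Rightarrow> 'a" where d: "\<And>x e. 0 < e \<Longrightarrow> \<exists>i. dist x (d i) < e"
      using dense_sequence by metis
    have "U = (\<Union>z\<in>{z. cball (d (fst z)) (1 / Suc (snd z)) \<subseteq> U}. cball (d (fst z)) (1 / Suc (snd z)))"
    proof (intro equalityI subsetI)
      fix x assume "x \<in> U"
      then obtain e where e: "e > 0" "ball x e \<subseteq> U" using \<open>open U\<close> open_contains_ball by metis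
      obtain n where n: "1 / Suc n < e/2" using nat_approx_posE[of "e/2"] e by (metis half_gt_zero of_nat_Suc)
      obtain i where i: "dist x (d i) < 1 / Suc n" using d[of "1 / Suc n" x] by auto
      have "cball (d i) (1 / Suc n) \<subseteq> ball x e"
      proof
        fix y assume "y \<in> cball (d i) (1 / Suc n)"
        then show "y \<in> ball x e" using i n dist_triangle[of x y "d i"] by simp
      qed
      then show "x \<in> (\<Union>z\<in>{z. cball (d (fst z)) (1 / Suc (snd z)) \<subseteq> U}. cball (d (fst z)) (1 / Suc (snd z)))"
        using e i by (intro UN_I[of "(i, n)"]) (auto simp: dist_commute)
    qed auto
    also have "\<dots> \<in> sets S" by (intro sets.countable_UN'') (auto intro: cb)
    finally show ?thesis .
  qed
  have "sigma_sets (space S) {U. open U} \<subseteq> sets S"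
    by (rule sets.sigma_sets_subset) (use op in auto)
  then show "sets borel \<subseteq> sigma_sets UNIV (range (half_spaces l))"
    by (simp add: borel_def sets_measure_of sS)
  have "closed (half_spaces l xs)" for xs
    unfolding half_spaces_def by (intro closed_Collect_all closed_Collect_imp open_Collect_const closed_Collect_le continuous_intros)
  then have "half_spaces l xs \<in> sets borel" for xs by (rule borel_closed)
  then show "sigma_sets UNIV (range (half_spaces l)) \<subseteq> sets borel"
    using sets.sigma_sets_subset[of "range (half_spaces l)" borel] by auto
qed

text \<open>The sum is the squared violation of the constraints. The value is 1 where all of them
  hold and decreases to 0 elsewhere as \<open>k\<close> grows; squaring the positive parts makes the
  function continuously differentiable.\<close>

definition soft_half_spaces :: "(nat \<times> rat) list \<Rightarrow> nat \<Rightarrow> (nat \<Rightarrow> real) \<Rightarrow> real" where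
  "soft_half_spaces xs k y = 1 / (1 + real k * (\<Sum>i<length xs. (max 0 (y i - of_rat (snd (xs ! i))))\<^sup>2))"

lemma DERIV_max_sq: "((\<lambda>t::real. (max 0 (t - a))\<^sup>2) has_real_derivative 2 * max 0 (x - a)) (at x)"
proof -
  consider "x < a" | "x = a" | "x > a" by linarith
  then show ?thesis
  proof cases
    case 1
    have d: "((\<lambda>t::real. 0) has_real_derivative 2 * max 0 (x - a)) (at x)" using 1 by auto
    have ev: "eventually (\<lambda>t. 0 = (max 0 (t - a))\<^sup>2) (nhds x)"
      using 1 eventually_nhds_in_open[of "{..<a}" x] by (auto elim!: eventually_mono)
    show ?thesis by (rule DERIV_cong_ev[OF refl ev refl, THEN iffD1, OF d])
  next
    case 3
    have d: "((\<lambda>t::real. (t - a)\<^sup>2) has_real_derivative 2 * max 0 (x - a)) (at x)" using 3 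
      by (auto intro!: derivative_eq_intros)
    have ev: "eventually (\<lambda>t. (t - a)\<^sup>2 = (max 0 (t - a))\<^sup>2) (nhds x)"
      using 3 eventually_nhds_in_open[of "{a<..}" x] by (auto elim!: eventually_mono)
    show ?thesis by (rule DERIV_cong_ev[OF refl ev refl, THEN iffD1, OF d])
  next
    case 2
    have "(\<lambda>h. (max 0 h)\<^sup>2 / h) \<midarrow>0\<rightarrow> (0::real)"
    proof (rule Lim_null_comparison)
      show "\<forall>\<^sub>F h in at 0. norm ((max 0 h)\<^sup>2 / h) \<le> \<bar>h::real\<bar>"
        by (intro always_eventually) (auto simp: power2_eq_square max_def)
      show "(\<lambda>h. \<bar>h\<bar>) \<midarrow>0\<rightarrow> (0::real)" by (intro tendsto_eq_intros) auto
    qed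
    then show ?thesis using 2 by (simp add: DERIV_def)
  qed
qed

lemma Cb1_soft_half_spaces: "Cb1 (length xs) (soft_half_spaces xs k)"
proof -
  let ?n = "length xs" and ?g = "soft_half_spaces xs k"
  let ?a = "\<lambda>i. real_of_rat (snd (xs ! i))"
  let ?S = "\<lambda>y. \<Sum>i<?n. (max 0 (y i - ?a i))\<^sup>2"
  have S0: "0 \<le> ?S y" for y by (intro sum_nonneg) auto
  have den: "1 \<le> 1 + k * ?S y" for y using S0[of y] by simp
  have ne: "1 + k * ?S y \<noteq> 0" for y using den[of y] by linarith
  have cS: "continuous_on UNIV ?S"
    by (intro continuous_intros continuous_on_max) (auto intro: continuous_on_product_coordinates)
  have c1: "?g y = ?g (\<lambda>i. if i < ?n then y i else 0)" for y
    by (simp add: soft_half_spaces_def)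
  have c2: "bounded (range ?g)"
    unfolding bounded_iff using den by (intro exI[of _ 1]) (auto simp: soft_half_spaces_def divide_le_eq_1 S0)
  have c3: "continuous_on UNIV ?g"
    unfolding soft_half_spaces_def using ne by (intro continuous_intros cS) auto
  have c4: "\<exists>dg. (\<forall>y. ((\<lambda>t. ?g (y(i := t))) has_real_derivative dg y) (at (y i))) \<and>
                 bounded (range dg) \<and> continuous_on UNIV dg" if i: "i < ?n" for i
  proof (intro exI conjI allI)
    let ?dg = "\<lambda>y. - (k * (2 * max 0 (y i - ?a i))) / (1 + k * ?S y)\<^sup>2"
    fix y
    have Seq: "?S (y(i := t)) = (max 0 (t - ?a i))\<^sup>2 + (\<Sum>j\<in>{..<?n}-{i}. (max 0 (y j - ?a j))\<^sup>2)" for t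
      using i by (subst sum.remove[of _ i]) auto
    have "((\<lambda>t. ?S (y(i := t))) has_real_derivative 2 * max 0 (y i - ?a i)) (at (y i))"
      unfolding Seq using DERIV_add[OF DERIV_max_sq[of "?a i" "y i"] DERIV_const] by simp
    from DERIV_cmult[OF this, of k]
    have "((\<lambda>t. 1 + k * ?S (y(i := t))) has_real_derivative k * (2 * max 0 (y i - ?a i))) (at (y i))"
      using DERIV_add[OF DERIV_const[of 1]] by fastforce
    from DERIV_inverse'[OF this] ne[of y]
    show "((\<lambda>t. ?g (y(i := t))) has_real_derivative ?dg y) (at (y i))"
      unfolding soft_half_spaces_def by (simp add: divide_inverse power2_eq_square ac_simps)
  next
    let ?dg = "\<lambda>y. - (k * (2 * max 0 (y i - ?a i))) / (1 + k * ?S y)\<^sup>2"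
    show "bounded (range ?dg)"
      unfolding bounded_iff
    proof (intro exI[of _ "real k + 1"] ballI, elim rangeE)
      fix z y assume z: "z = ?dg y"
      \<comment> \<open>The bound k + 1 arises from 2m \<le> 1 + m^2 \<le> 1 + S and k(1 + S) \<le>
        (k + 1)(1 + kS), where S is the sum in the denominator; as 1 + kS \<ge> 1, the last factor
        may be squared.\<close>
      define m where "m = max 0 (y i - ?a i)"
      have m: "0 \<le> m" by (simp add: m_def)
      have "m\<^sup>2 \<le> ?S y" unfolding m_def using i by (intro member_le_sum) auto
      then have "2 * m \<le> 1 + ?S y" using sum_squares_bound[of 1 m] by simp
      then have "k * (2 * m) \<le> k * (1 + ?S y)" by (intro mult_left_mono) auto
      also have "\<dots> \<le> (real k + 1) * (1 + k * ?S y)" using S0[of y] by (simp add: algebra_simps)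
      also have "\<dots> \<le> (real k + 1) * (1 + k * ?S y)\<^sup>2"
        using den[of y] by (intro mult_left_mono) (auto simp: power2_eq_square)
      finally have "k * (2 * m) / (1 + k * ?S y)\<^sup>2 \<le> real k + 1" using ne[of y] by (simp add: divide_le_eq)
      then show "norm z \<le> real k + 1" unfolding z m_def[symmetric] using m by simp
    qed
    show "continuous_on UNIV ?dg"
      using ne by (intro continuous_intros cS continuous_on_max) (auto intro: continuous_on_product_coordinates)
  qed
  show ?thesis unfolding Cb1_def by (intro conjI allI impI c1 c2 c3 c4)
qed

text \<open>\<open>Cb1\<close> speaks of partial derivatives, so \<open>y\<close> is turned into
  \<open>z\<close> one coordinate at a time, with the mean value inequality for each change.\<close>

lemma Cb1_Lipschitz:
  assumes "Cb1 n g"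
  shows "\<exists>L\<ge>0. \<forall>y z. \<bar>g y - g z\<bar> \<le> L * (\<Sum>i<n. \<bar>y i - z i\<bar>)"
proof -
  have "\<forall>i<n. \<exists>B dg. (\<forall>y. ((\<lambda>t. g (y(i := t))) has_real_derivative dg y) (at (y i))) \<and> (\<forall>y. \<bar>dg y\<bar> \<le> B)"
    using assms unfolding Cb1_def bounded_iff by (metis rangeI real_norm_def)
  then obtain B dg where dg: "\<And>i y. i < n \<Longrightarrow> ((\<lambda>t. g (y(i := t))) has_real_derivative dg i y) (at (y i))"
    "\<And>i y. i < n \<Longrightarrow> \<bar>dg i y\<bar> \<le> B i" by metis
  define L where "L = (\<Sum>i<n. \<bar>B i\<bar>)"
  have L: "0 \<le> L" by (auto simp: L_def intro: sum_nonneg)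
  have BL: "\<bar>dg i y\<bar> \<le> L" if "i < n" for i y
  proof -
    have "\<bar>dg i y\<bar> \<le> \<bar>B i\<bar>" using dg(2)[OF that, of y] by simp
    also have "\<dots> \<le> L" unfolding L_def using that by (intro member_le_sum) auto
    finally show ?thesis .
  qed
  have step: "\<bar>g (y(i := s)) - g (y(i := t))\<bar> \<le> L * \<bar>s - t\<bar>" if "i < n" for i y s t
  proof -
    have "((\<lambda>t. g (y(i := t))) has_field_derivative dg i (y(i := u))) (at u within UNIV)" for u
      using dg(1)[OF that, of "y(i := u)"] by simp
    then show ?thesis
      using field_differentiable_bound[of UNIV "\<lambda>t. g (y(i := t))" "\<lambda>u. dg i (y(i := u))" L t s] BL[OF that]
      by (simp add: abs_minus_commute)
  qed
  have trunc: "g y = g (\<lambda>i. if i < n then y i else 0)" for y using assms by (auto simp: Cb1_def)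
  have "\<bar>g y - g z\<bar> \<le> L * (\<Sum>i<n. \<bar>y i - z i\<bar>)" for y z
  proof -
    have "k \<le> n \<Longrightarrow> \<bar>g y - g (\<lambda>i. if i < k then z i else y i)\<bar> \<le> L * (\<Sum>i<k. \<bar>y i - z i\<bar>)" for k
    proof (induction k)
      case (Suc k)
      let ?w = "\<lambda>i. if i < k then z i else y i"
      have a: "?w(k := z k) = (\<lambda>i. if i < Suc k then z i else y i)" and b: "?w(k := y k) = ?w" by (auto simp: less_Suc_eq)
      have "\<bar>g (?w(k := y k)) - g (?w(k := z k))\<bar> \<le> L * \<bar>y k - z k\<bar>"
        using step[of k] Suc.prems by simp
      then have "\<bar>g ?w - g (\<lambda>i. if i < Suc k then z i else y i)\<bar> \<le> L * \<bar>y k - z k\<bar>"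
        unfolding a b .
      then show ?case using Suc by (simp add: algebra_simps)
    qed simp
    from this[of n] have "\<bar>g y - g (\<lambda>i. if i < n then z i else y i)\<bar> \<le> L * (\<Sum>i<n. \<bar>y i - z i\<bar>)" by simp
    moreover have "g (\<lambda>i. if i < n then z i else y i) = g z"
    proof -
      have "(\<lambda>i. if i < n then (if i < n then z i else y i) else 0) = (\<lambda>i. if i < n then z i else 0)" by auto
      then show ?thesis using trunc[of "\<lambda>i. if i < n then z i else y i"] trunc[of z] by metis
    qed
    ultimately show ?thesis by simp
  qed
  with L show ?thesis by blast
qed

lemma FCb1_X_Lipschitz:
  assumes "\<psi> \<in> FCb1_X"
  obtains L where "0 \<le> L" "\<And>x y. \<bar>\<psi> x - \<psi> y\<bar> \<le> L * norm (x - y)"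
proof -
  obtain n g and l :: "nat \<Rightarrow> 'a \<Rightarrow>\<^sub>L real" where g: "Cb1 n g" 
    and \<psi>: "\<psi> = (\<lambda>x. g (\<lambda>i. if i < n then blinfun_apply (l i) x else 0))"
    using assms unfolding FCb1_X_def by blast
  obtain L where L: "0 \<le> L" "\<And>y z. \<bar>g y - g z\<bar> \<le> L * (\<Sum>i<n. \<bar>y i - z i\<bar>)" using Cb1_Lipschitz[OF g] by blast
  have "\<bar>\<psi> x - \<psi> y\<bar> \<le> (L * (\<Sum>i<n. norm (l i))) * norm (x - y)" for x y
  proof -
    have "\<bar>\<psi> x - \<psi> y\<bar> \<le> L * (\<Sum>i<n. \<bar>l i x - l i y\<bar>)" unfolding \<psi> by (rule order_trans[OF L(2)]) simp
    also have "\<dots> \<le> L * (\<Sum>i<n. norm (l i) * norm (x - y))"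
      using norm_blinfun by (intro mult_left_mono sum_mono L(1)) (auto simp flip: blinfun.diff_right simp: real_norm_def[symmetric] simp del: real_norm_def)
    finally show ?thesis by (simp add: sum_distrib_right mult.assoc)
  qed
  then show ?thesis using that[of "L * (\<Sum>i<n. norm (l i))"] L by (simp add: sum_nonneg)
qed

lemma FCb1_X_bounded:
  assumes "\<psi> \<in> FCb1_X"
  obtains B where "\<And>x. \<bar>\<psi> x\<bar> \<le> B"
  using assms unfolding FCb1_X_def Cb1_def bounded_iff by auto

lemma continuous_on_Lipschitz_real:
  fixes \<psi> :: "'a::real_normed_vector \<Rightarrow> real"
  assumes "\<And>x y. \<bar>\<psi> x - \<psi> y\<bar> \<le> L * norm (x - y)"
  shows "continuous_on UNIV \<psi>"
proof (intro lipschitz_on_continuous_on[of "\<bar>L\<bar>"] lipschitz_onI)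
  fix x y
  show "dist (\<psi> x) (\<psi> y) \<le> \<bar>L\<bar> * dist x y"
    using assms[of x y] mult_right_mono[OF abs_ge_self[of L], of "norm (x - y)"] by (simp add: dist_norm)
qed simp

lemma FCb1_X_measurable: "\<psi> \<in> FCb1_X \<Longrightarrow> \<psi> \<in> borel_measurable borel"
  using FCb1_X_Lipschitz continuous_on_Lipschitz_real borel_measurable_continuous_onI by metis

definition soft_cylinder where
  "soft_cylinder l xs k = (\<lambda>x::'a::{banach,second_countable_topology}. soft_half_spaces xs k (\<lambda>i. if i < length xs then blinfun_apply (l (fst (xs ! i))) x else 0))"

lemma soft_cylinder_FCb1_X: "soft_cylinder l xs k \<in> FCb1_X"
  unfolding FCb1_X_def soft_cylinder_def
  by (intro CollectI exI[of _ "length xs"] exI[of _ "soft_half_spaces xs k"] exI[of _ "\<lambda>i. l (fst (xs ! i))"]) 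
     (simp add: Cb1_soft_half_spaces)

lemma soft_cylinder_tendsto: "(\<lambda>k. soft_cylinder l xs k x) \<longlonglongrightarrow> indicator (half_spaces l xs) x"
proof -
  define s where "s = (\<Sum>i<length xs. (max 0 (l (fst (xs ! i)) x - of_rat (snd (xs ! i))))\<^sup>2)"
  have eq: "soft_cylinder l xs k x = 1 / (1 + real k * s)" for k
    unfolding soft_cylinder_def soft_half_spaces_def s_def by simp
  have [simp]: "max 0 (u - v) = 0 \<longleftrightarrow> u \<le> v" for u v :: real by auto
  have s0: "s = 0 \<longleftrightarrow> x \<in> half_spaces l xs"
    unfolding s_def half_spaces_def by (subst sum_nonneg_eq_0_iff) auto
  have "0 \<le> s" unfolding s_def by (intro sum_nonneg) auto
  show ?thesis
  proof (cases "x \<in> half_spaces l xs")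
    case True then show ?thesis using s0 by (simp add: eq)
  next
    case False
    then have "s > 0" using s0 \<open>0 \<le> s\<close> by force
    then have "filterlim (\<lambda>k. real k * s) at_top sequentially"
      by (intro filterlim_at_top_mult_tendsto_pos[OF tendsto_const _ filterlim_real_sequentially, THEN filterlim_cong[THEN iffD1, OF refl refl, rotated]]) (auto simp: mult.commute)
    then have "filterlim (\<lambda>k. 1 + real k * s) at_infinity sequentially"
      by (intro filterlim_at_top_imp_at_infinity filterlim_tendsto_add_at_top[OF tendsto_const])
    then have "(\<lambda>k. 1 / (1 + real k * s)) \<longlonglongrightarrow> 0"
      by (intro tendsto_divide_0[OF tendsto_const])
    then show ?thesis using False by (simp add: eq)
  qed
qed

lemma soft_cylinder_bounds: "\<bar>soft_cylinder l xs k x\<bar> \<le> 1"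
proof -
  have "0 \<le> real k * (\<Sum>i<length xs. (max 0 (l (fst (xs ! i)) x - of_rat (snd (xs ! i))))\<^sup>2)"
    by (intro mult_nonneg_nonneg sum_nonneg) auto
  then show ?thesis unfolding soft_cylinder_def soft_half_spaces_def by (simp add: divide_le_eq_1)
qed

text \<open>By dominated convergence the integrals determine the masses of all sets
  \<open>half_spaces l xs\<close>, which form an intersection-stable generator of the Borel
  sets.\<close>

lemma measure_eqI_soft_cylinder:
  fixes \<mu> \<nu> :: "'a::{banach,second_countable_topology} measure"
  assumes l: "norming_seq l" and "prob_space \<mu>" "prob_space \<nu>" and s: "sets \<mu> = sets borel" "sets \<nu> = sets borel"
    and eq: "\<And>xs k. (\<integral>x. soft_cylinder l xs k x \<partial>\<mu>) = (\<integral>x. soft_cylinder l xs k x \<partial>\<nu>)"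
  shows "\<mu> = \<nu>"
proof -
  interpret \<mu>: prob_space \<mu> by fact
  interpret \<nu>: prob_space \<nu> by fact
  have h[measurable]: "half_spaces l xs \<in> sets borel" for xs
    unfolding borel_eq_half_spaces[OF l] by auto
  have lim: "(\<lambda>k. \<integral>x. soft_cylinder l xs k x \<partial>M) \<longlonglongrightarrow> measure M (half_spaces l xs)"
    if "prob_space M" "sets M = sets borel" for M xs
  proof -
    interpret M: prob_space M by fact
    have [measurable_cong]: "sets M = sets borel" by fact
    have [measurable]: "soft_cylinder l xs k \<in> borel_measurable borel" for k
      by (rule FCb1_X_measurable[OF soft_cylinder_FCb1_X])
    have "(\<lambda>k. \<integral>x. soft_cylinder l xs k x \<partial>M) \<longlonglongrightarrow> (\<integral>x. indicator (half_spaces l xs) x \<partial>M)"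
      by (rule integral_dominated_convergence[where w="\<lambda>_. 1"])
         (auto simp: soft_cylinder_tendsto soft_cylinder_bounds)
    then show ?thesis using sets_eq_imp_space_eq[OF that(2)] by simp
  qed
  have m: "measure \<mu> (half_spaces l xs) = measure \<nu> (half_spaces l xs)" for xs
    by (rule LIMSEQ_unique[OF lim[OF assms(2) s(1), unfolded eq] lim[OF assms(3) s(2)]])
  show ?thesis
  proof (rule measure_eqI_generator_eq[where E="range (half_spaces l)" and \<Omega>=UNIV and A="\<lambda>_. half_spaces l []"])
    show "Int_stable (range (half_spaces l))"
      unfolding Int_stable_def by (auto simp: half_spaces_append[symmetric])
    show "emeasure \<mu> X = emeasure \<nu> X" if "X \<in> range (half_spaces l)" for X
      using that m by (auto simp: \<mu>.emeasure_eq_measure \<nu>.emeasure_eq_measure)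
    show "sets \<mu> = sigma_sets UNIV (range (half_spaces l))" "sets \<nu> = sigma_sets UNIV (range (half_spaces l))"
      using s borel_eq_half_spaces[OF l] by auto
    show "range (\<lambda>_. half_spaces l []) \<subseteq> range (half_spaces l)" by blast
  qed (auto simp: half_spaces_def)
qed

section \<open>Smooth cylinder approximations of the distance to a finite set\<close>

text \<open>Directional derivatives that are continuous in the base point take the place of Frechet
  derivatives on \<open>nat \<Rightarrow> real\<close>. The class is closed under sums and under
  composition with scalar C^1 functions; unit vectors give the partial derivatives, and other
  directions give the derivative of a cylinder function along a vector of \<open>X\<close>.\<close>

definition has_C1_dir :: "((nat \<Rightarrow> real) \<Rightarrow> real) \<Rightarrow> ((nat \<Rightarrow> real) \<Rightarrow> (nat \<Rightarrow> real) \<Rightarrow> real) \<Rightarrow> bool" where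
  "has_C1_dir g dg \<longleftrightarrow> continuous_on UNIV g \<and>
     (\<forall>y w. ((\<lambda>t. g (\<lambda>i. y i + t * w i)) has_real_derivative dg y w) (at 0)) \<and>
     (\<forall>w. continuous_on UNIV (\<lambda>y. dg y w))"

definition C1_dir :: "((nat \<Rightarrow> real) \<Rightarrow> real) \<Rightarrow> bool" where
  "C1_dir g \<longleftrightarrow> (\<exists>dg. has_C1_dir g dg)"

lemma has_C1_dirD:
  assumes "has_C1_dir g dg"
  shows "continuous_on UNIV g" "((\<lambda>t. g (\<lambda>i. y i + t * w i)) has_real_derivative dg y w) (at 0)"
    "continuous_on UNIV (\<lambda>y. dg y w)"
proof -
  show "continuous_on UNIV g" using assms unfolding has_C1_dir_def by (elim conjE)
  have 1: "\<forall>y w. ((\<lambda>t. g (\<lambda>i. y i + t * w i)) has_real_derivative dg y w) (at 0)"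
    and 2: "\<forall>w. continuous_on UNIV (\<lambda>y. dg y w)"
    using assms unfolding has_C1_dir_def by simp_all
  show "((\<lambda>t. g (\<lambda>i. y i + t * w i)) has_real_derivative dg y w) (at 0)" by (rule 1[rule_format])
  show "continuous_on UNIV (\<lambda>y. dg y w)" by (rule 2[rule_format])
qed

lemma C1_dirI:
  assumes "continuous_on UNIV g" "\<And>y w. ((\<lambda>t. g (\<lambda>i. y i + t * w i)) has_real_derivative dg y w) (at 0)"
    "\<And>w. continuous_on UNIV (\<lambda>y. dg y w)"
  shows "C1_dir g"
  unfolding C1_dir_def has_C1_dir_def by (intro exI[of _ dg] conjI allI assms)

lemma C1_dir_coord: "C1_dir (\<lambda>y. y j)"
  by (rule C1_dirI[where dg="\<lambda>y w. w j"]) (auto intro!: derivative_eq_intros continuous_on_product_coordinates)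

lemma C1_dir_sum:
  assumes "\<And>j. j \<in> A \<Longrightarrow> C1_dir (g j)"
  shows "C1_dir (\<lambda>y. \<Sum>j\<in>A. g j y)"
proof -
  obtain dg where dg: "\<And>j. j \<in> A \<Longrightarrow> has_C1_dir (g j) (dg j)"
    using assms unfolding C1_dir_def by metis
  show ?thesis
    by (rule C1_dirI[where dg="\<lambda>y w. \<Sum>j\<in>A. dg j y w"])
       (intro continuous_on_sum DERIV_sum has_C1_dirD[OF dg]; assumption)+
qed

lemma C1_dir_comp:
  assumes g: "C1_dir g" and S: "\<And>y. g y \<in> S" and \<phi>: "\<And>s. s \<in> S \<Longrightarrow> (\<phi> has_real_derivative \<phi>' s) (at s)"
    and c: "continuous_on S \<phi>'"
  shows "C1_dir (\<lambda>y. \<phi> (g y))"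
proof -
  obtain dg where "has_C1_dir g dg" using g unfolding C1_dir_def by blast
  note cg = has_C1_dirD(1)[OF this] and dg = has_C1_dirD(2,3)[OF this]
  have c\<phi>: "continuous_on S \<phi>" using \<phi> by (intro DERIV_continuous_on) (auto intro: has_field_derivative_at_within)
  show ?thesis
  proof (rule C1_dirI[where dg="\<lambda>y w. \<phi>' (g y) * dg y w"])
    show "continuous_on UNIV (\<lambda>y. \<phi> (g y))"
      by (rule continuous_on_compose2[OF c\<phi> cg]) (use S in auto)
    show "((\<lambda>t. \<phi> (g (\<lambda>i. y i + t * w i))) has_real_derivative \<phi>' (g y) * dg y w) (at 0)" for y w
      by (rule DERIV_chain2[OF _ dg(1)]) (use \<phi>[OF S[of y]] in simp)
    show "continuous_on UNIV (\<lambda>y. \<phi>' (g y) * dg y w)" for w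
      by (intro continuous_on_mult dg(2) continuous_on_compose2[OF c cg]) (use S in auto)
  qed
qed

lemma DERIV_abs_le:
  assumes "(f has_real_derivative D) (at x)" "\<And>t. \<bar>f t - f x\<bar> \<le> r * \<bar>t - x\<bar>"
  shows "\<bar>D\<bar> \<le> r"
proof (rule tendsto_upperbound)
  show "((\<lambda>t. \<bar>(f t - f x) / (t - x)\<bar>) \<longlongrightarrow> \<bar>D\<bar>) (at x)"
    using assms(1) unfolding has_field_derivative_iff by (rule tendsto_rabs)
  show "\<forall>\<^sub>F t in at x. \<bar>(f t - f x) / (t - x)\<bar> \<le> r"
    using eventually_neq_at_within[of x x UNIV] 
    by eventually_elim (use assms(2) in \<open>simp add: divide_le_eq abs_divide\<close>)
qed simp

text \<open>The partial derivatives are the derivatives in unit directions, and their boundedness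
  comes from the Lipschitz bound, so that no explicit formula for them has to be estimated.\<close>

lemma Cb1_of_C1_dir:
  assumes g: "C1_dir g" and dep: "\<And>y. g y = g (\<lambda>i. if i < n then y i else 0)"
    and bnd: "\<And>y. \<bar>g y\<bar> \<le> B" and lip: "\<And>y k t. \<bar>g (y(k := t)) - g y\<bar> \<le> L * \<bar>t - y k\<bar>"
  shows "Cb1 n g"
proof -
  obtain dg where "has_C1_dir g dg" using g unfolding C1_dir_def by blast
  note cg = has_C1_dirD(1)[OF this] and dg = has_C1_dirD(2,3)[OF this]
  have "\<exists>d. (\<forall>y. ((\<lambda>t. g (y(i := t))) has_real_derivative d y) (at (y i))) \<and> bounded (range d) \<and> continuous_on UNIV d" for i
  proof (intro exI[of _ "\<lambda>y. dg y (\<lambda>j. if j = i then 1 else 0)"] conjI allI dg(2))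
    have *: "((\<lambda>t. g (y(i := t))) has_real_derivative dg y (\<lambda>j. if j = i then 1 else 0)) (at (y i))" for y
    proof -
      have eq: "(\<lambda>j. y j + (t - y i) * (if j = i then 1 else 0)) = y(i := t)" for t by auto
      have "((\<lambda>t. g (\<lambda>j. y j + t * (if j = i then 1 else 0))) has_real_derivative dg y (\<lambda>j. if j = i then 1 else 0)) (at (y i - y i))"
        using dg(1) by simp
      moreover have "((\<lambda>t. t - y i) has_real_derivative 1) (at (y i))" by (auto intro!: derivative_eq_intros)
      ultimately have "((\<lambda>t. g (\<lambda>j. y j + (t - y i) * (if j = i then 1 else 0))) has_real_derivative dg y (\<lambda>j. if j = i then 1 else 0) * 1) (at (y i))"
        by (rule DERIV_chain2)
      then show ?thesis unfolding eq by simp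
    qed
    then show "((\<lambda>t. g (y(i := t))) has_real_derivative dg y (\<lambda>j. if j = i then 1 else 0)) (at (y i))" for y .
    have "\<bar>dg y (\<lambda>j. if j = i then 1 else 0)\<bar> \<le> L" for y
      by (rule DERIV_abs_le[OF *]) (use lip[of y i] in simp)
    then show "bounded (range (\<lambda>y. dg y (\<lambda>j. if j = i then 1 else 0)))"
      unfolding bounded_iff by (auto intro!: exI[of _ L])
  qed
  moreover have "bounded (range g)" unfolding bounded_iff using bnd by (auto intro!: exI[of _ B])
  ultimately show ?thesis unfolding Cb1_def by (intro conjI allI impI dep cg)
qed

text \<open>\<open>smin\<close> smooths \<open>min\<^sub>i max\<^sub>j (y j - c i j)\<close>. It is monotone and commutes with the addition of constants,
  hence 1-Lipschitz for the maximum norm.\<close>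

definition smin_den :: "(nat \<Rightarrow> nat \<Rightarrow> real) \<Rightarrow> nat \<Rightarrow> real \<Rightarrow> nat \<Rightarrow> (nat \<Rightarrow> real) \<Rightarrow> real" where
  "smin_den c m \<beta> i y = (\<Sum>j\<le>m. exp (\<beta> * (y j - c i j)))"

definition smin :: "(nat \<Rightarrow> nat \<Rightarrow> real) \<Rightarrow> nat \<Rightarrow> nat \<Rightarrow> real \<Rightarrow> (nat \<Rightarrow> real) \<Rightarrow> real" where
  "smin c n m \<beta> y = - ln (\<Sum>i\<le>n. inverse (smin_den c m \<beta> i y)) / \<beta>"

lemma smin_den_pos: "0 < smin_den c m \<beta> i y"
  unfolding smin_den_def by (intro sum_pos) auto

lemma smin_sum_pos: "0 < (\<Sum>i\<le>(n::nat). inverse (smin_den c m \<beta> i y))"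
  by (intro sum_pos) (auto simp: smin_den_pos)

lemma C1_dir_smin:
  assumes "0 < \<beta>"
  shows "C1_dir (smin c n m \<beta>)"
proof -
  have "C1_dir (\<lambda>y. exp (\<beta> * (y j - c i j)))" for i j
    by (rule C1_dir_comp[OF C1_dir_coord, of j UNIV "\<lambda>s. exp (\<beta> * (s - c i j))" "\<lambda>s. \<beta> * exp (\<beta> * (s - c i j))"])
       (auto intro!: derivative_eq_intros continuous_intros)
  then have "C1_dir (smin_den c m \<beta> i)" for i
    unfolding smin_den_def[abs_def] by (intro C1_dir_sum)
  then have "C1_dir (\<lambda>y. inverse (smin_den c m \<beta> i y))" for i
    by (rule C1_dir_comp[where S="{0<..}" and \<phi>'="\<lambda>s. - (inverse s * inverse s)"])
       (auto simp: smin_den_pos intro!: derivative_eq_intros continuous_intros)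
  then have "C1_dir (\<lambda>y. \<Sum>i\<le>n. inverse (smin_den c m \<beta> i y))"
    by (intro C1_dir_sum)
  then show ?thesis unfolding smin_def[abs_def]
    by (rule C1_dir_comp[where S="{0<..}" and \<phi>="\<lambda>s. - ln s / \<beta>" and \<phi>'="\<lambda>s. - inverse s / \<beta>"])
       (use assms smin_sum_pos in \<open>auto simp: divide_inverse mult.commute intro!: derivative_eq_intros continuous_intros\<close>)
qed

text \<open>Raising the coordinates by at most \<open>r\<close> multiplies each denominator by at
  most \<open>exp (\<beta> * r)\<close>; the outer logarithm turns this factor back into
  \<open>r\<close>.\<close>

lemma smin_le_add:
  assumes \<beta>: "0 < \<beta>" and le: "\<And>j. j \<le> m \<Longrightarrow> y j \<le> z j + r"
  shows "smin c n m \<beta> y \<le> smin c n m \<beta> z + r"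
proof -
  have "smin_den c m \<beta> i y \<le> exp (\<beta> * r) * smin_den c m \<beta> i z" for i
    unfolding smin_den_def sum_distrib_left
  proof (intro sum_mono)
    fix j assume "j \<in> {..m}"
    then have "\<beta> * (y j - c i j) \<le> \<beta> * (r + (z j - c i j))" using le[of j] \<beta> by (intro mult_left_mono) auto
    then show "exp (\<beta> * (y j - c i j)) \<le> exp (\<beta> * r) * exp (\<beta> * (z j - c i j))"
      unfolding exp_add[symmetric] by (simp add: algebra_simps)
  qed
  then have "inverse (exp (\<beta> * r) * smin_den c m \<beta> i z) \<le> inverse (smin_den c m \<beta> i y)" for i
    by (rule le_imp_inverse_le[OF _ smin_den_pos])
  then have "exp (- (\<beta> * r)) * (\<Sum>i\<le>n. inverse (smin_den c m \<beta> i z)) \<le> (\<Sum>i\<le>n. inverse (smin_den c m \<beta> i y))"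
    unfolding sum_distrib_left by (intro sum_mono) (simp add: exp_minus)
  then have "ln (exp (- (\<beta> * r)) * (\<Sum>i\<le>n. inverse (smin_den c m \<beta> i z))) \<le> ln (\<Sum>i\<le>n. inverse (smin_den c m \<beta> i y))"
    by (subst ln_le_cancel_iff) (auto intro!: mult_pos_pos smin_sum_pos)
  then have "- (\<beta> * r) + ln (\<Sum>i\<le>n. inverse (smin_den c m \<beta> i z)) \<le> ln (\<Sum>i\<le>n. inverse (smin_den c m \<beta> i y))"
    using smin_sum_pos[of c m \<beta> z n] by (simp add: ln_mult)
  then show ?thesis unfolding smin_def using \<beta> by (simp add: field_simps)
qed

lemma smin_Lipschitz:
  assumes "0 < \<beta>" and "\<And>j. j \<le> m \<Longrightarrow> \<bar>y j - z j\<bar> \<le> r"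
  shows "\<bar>smin c n m \<beta> y - smin c n m \<beta> z\<bar> \<le> r"
proof -
  have "y j \<le> z j + r" "z j \<le> y j + r" if "j \<le> m" for j using assms(2)[OF that] by auto
  then show ?thesis
    using smin_le_add[OF assms(1), of m y z r c n] smin_le_add[OF assms(1), of m z y r c n] by auto
qed

text \<open>\<open>trunc_pow p M\<close> is a bounded smooth version of \<open>\<bar>t\<bar>\<^sup>p\<close>; the summand \<open>1 / M\<close> keeps the base of the power
  away from \<open>0\<close>.\<close>

definition trunc_sq :: "real \<Rightarrow> real \<Rightarrow> real" where
  "trunc_sq M t = 1 / M + t\<^sup>2 / (1 + (t / M)\<^sup>2)"

definition trunc_pow :: "real \<Rightarrow> real \<Rightarrow> real \<Rightarrow> real" where
  "trunc_pow p M t = trunc_sq M t powr (p / 2)"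

definition trunc_pow_deriv :: "real \<Rightarrow> real \<Rightarrow> real \<Rightarrow> real" where
  "trunc_pow_deriv p M t = p / 2 * trunc_sq M t powr (p / 2 - 1) * (2 * t / (1 + (t / M)\<^sup>2)\<^sup>2)"

lemma one_plus_sq_pos: "0 < 1 + (t::real)\<^sup>2"
  by (simp add: add_pos_nonneg)

lemma trunc_sq_pos: "0 < M \<Longrightarrow> 0 < trunc_sq M t"
proof -
  assume "0 < M"
  moreover have "0 \<le> t\<^sup>2 / (1 + (t / M)\<^sup>2)" by (intro divide_nonneg_nonneg add_nonneg_nonneg) auto
  ultimately show ?thesis unfolding trunc_sq_def by (simp add: add_pos_nonneg)
qed

lemma trunc_sq_le:
  assumes "1 \<le> M"
  shows "trunc_sq M t \<le> 1 + t\<^sup>2" "trunc_sq M t \<le> 1 + M\<^sup>2"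
proof -
  have 1: "1 / M \<le> 1" using assms by simp
  have 2: "t\<^sup>2 / (1 + (t / M)\<^sup>2) \<le> t\<^sup>2 / 1" using one_plus_sq_pos[of "t / M"] by (intro divide_left_mono) auto
  have "t\<^sup>2 \<le> M\<^sup>2 * (1 + (t / M)\<^sup>2)" using assms by (simp add: field_simps)
  then have 3: "t\<^sup>2 / (1 + (t / M)\<^sup>2) \<le> M\<^sup>2" using one_plus_sq_pos[of "t / M"] by (simp add: divide_le_eq)
  show "trunc_sq M t \<le> 1 + t\<^sup>2" "trunc_sq M t \<le> 1 + M\<^sup>2" using 1 2 3 by (auto simp: trunc_sq_def)
qed

lemma DERIV_trunc_pow:
  assumes "0 < M"
  shows "(trunc_pow p M has_real_derivative trunc_pow_deriv p M t) (at t)"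
proof -
  have ne: "1 + (t / M)\<^sup>2 \<noteq> 0" using one_plus_sq_pos[of "t/M"] by simp
  have d1: "((\<lambda>t. t\<^sup>2) has_real_derivative 2 * t) (at t)"
    and d2: "((\<lambda>t. 1 + (t / M)\<^sup>2) has_real_derivative 2 * (t / M) * (1 / M)) (at t)"
    using assms by (auto intro!: derivative_eq_intros)
  have "((\<lambda>t. t\<^sup>2 / (1 + (t / M)\<^sup>2)) has_real_derivative (2 * t * (1 + (t / M)\<^sup>2) - t\<^sup>2 * (2 * (t / M) * (1 / M))) / ((1 + (t / M)\<^sup>2) * (1 + (t / M)\<^sup>2))) (at t)"
    by (rule DERIV_divide[OF d1 d2 ne])
  moreover have "2 * t * (1 + (t / M)\<^sup>2) - t\<^sup>2 * (2 * (t / M) * (1 / M)) = 2 * t"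
    by (simp add: power2_eq_square algebra_simps)
  ultimately have "((\<lambda>t. t\<^sup>2 / (1 + (t / M)\<^sup>2)) has_real_derivative 2 * t / (1 + (t / M)\<^sup>2)\<^sup>2) (at t)"
    by (simp only: power2_eq_square)
  then have "(trunc_sq M has_real_derivative 2 * t / (1 + (t / M)\<^sup>2)\<^sup>2) (at t)"
    unfolding trunc_sq_def[abs_def] using DERIV_add[OF DERIV_const[of "1 / M"]] by fastforce
  from DERIV_fun_powr[OF this trunc_sq_pos[OF assms], of "p/2"]
  show ?thesis unfolding trunc_pow_def[abs_def] trunc_pow_deriv_def by simp
qed

text \<open>The derivative of \<open>trunc_sq\<close> is at most twice its square root, as for t^2
  itself. The bound is therefore the derivative p |t|^(p-1) of |t|^p with \<open>trunc_sq\<close> in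
  place of t^2, and the truncation costs no constant.\<close>

lemma trunc_pow_deriv_le:
  assumes M: "0 < M" and p: "1 \<le> p"
  shows "\<bar>trunc_pow_deriv p M t\<bar> \<le> p * trunc_sq M t powr ((p - 1) / 2)"
proof -
  note pos = trunc_sq_pos[OF M, of t]
  have a: "1 \<le> 1 + (t / M)\<^sup>2" by simp
  have "(2 * t / (1 + (t / M)\<^sup>2)\<^sup>2)\<^sup>2 \<le> 4 * trunc_sq M t"
  proof -
    have "(2 * t / (1 + (t / M)\<^sup>2)\<^sup>2)\<^sup>2 = 4 * (t\<^sup>2 / (1 + (t / M)\<^sup>2) ^ 4)" by (simp add: power_divide power_mult_distrib)
    also have "\<dots> \<le> 4 * (t\<^sup>2 / (1 + (t / M)\<^sup>2))"
      using a power_increasing[of 1 4 "1 + (t / M)\<^sup>2"] one_plus_sq_pos[of "t/M"] by (intro mult_left_mono divide_left_mono) auto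
    also have "\<dots> \<le> 4 * trunc_sq M t" using M by (simp add: trunc_sq_def)
    finally show ?thesis .
  qed
  then have "\<bar>2 * t / (1 + (t / M)\<^sup>2)\<^sup>2\<bar> \<le> sqrt (4 * trunc_sq M t)" by (rule real_le_rsqrt[of "\<bar>_\<bar>", unfolded power2_abs])
  also have "\<dots> = 2 * trunc_sq M t powr (1/2)" using pos by (simp add: real_sqrt_mult powr_half_sqrt)
  finally have "\<bar>trunc_pow_deriv p M t\<bar> \<le> p / 2 * trunc_sq M t powr (p / 2 - 1) * (2 * trunc_sq M t powr (1/2))"
    unfolding trunc_pow_deriv_def abs_mult[of "p / 2 * _"] using p by (simp add: mult_left_mono del: abs_divide)
  also have "\<dots> = p * (trunc_sq M t powr (p / 2 - 1) * trunc_sq M t powr (1/2))" by simp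
  also have "\<dots> = p * trunc_sq M t powr ((p - 1) / 2)" by (simp add: powr_add[symmetric] diff_divide_distrib)
  finally show ?thesis .
qed

text \<open>A crude form of Young's inequality, obtained by replacing both factors by their maximum.
  Unlike the sharp form it includes p = 1 without a separate case.\<close>

lemma powr_mult_le_add:
  fixes a b p :: real
  assumes "1 \<le> p" "0 \<le> a" "0 \<le> b"
  shows "a powr (p - 1) * b \<le> a powr p + b powr p"
proof (cases "a = 0 \<or> b = 0")
  case False
  then have pos: "0 < a" "0 < b" using assms by auto
  define c where "c = max a b"
  have "a powr (p - 1) * b \<le> c powr (p - 1) * c"
    using pos assms by (intro mult_mono powr_mono2) (auto simp: c_def)
  also have "\<dots> = c powr p" using pos powr_add[of c "p - 1" 1] by (simp add: c_def)
  also have "\<dots> \<le> a powr p + b powr p" by (auto simp: c_def max_def)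
  finally show ?thesis .
qed auto

text \<open>With \<open>b\<close> the norm of a direction, the derivative is controlled by the
  function itself and the p-th power of the direction. Integrated, this bounds the derivative of S
  by a multiple of S + 1, uniformly in the cut-off \<open>M\<close>.\<close>

lemma trunc_pow_deriv_mult_le:
  assumes M: "0 < M" and p: "1 \<le> p" and b: "0 \<le> b"
  shows "\<bar>trunc_pow_deriv p M t\<bar> * b \<le> p * (trunc_pow p M t + b powr p)"
proof -
  have eq: "trunc_sq M t powr ((p - 1) / 2) = (trunc_sq M t powr (1/2)) powr (p - 1)"
    "trunc_pow p M t = (trunc_sq M t powr (1/2)) powr p"
    by (simp_all add: powr_powr trunc_pow_def)
  have "\<bar>trunc_pow_deriv p M t\<bar> * b \<le> p * ((trunc_sq M t powr (1/2)) powr (p - 1) * b)"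
    using trunc_pow_deriv_le[OF M p, of t] b unfolding eq(1) mult.assoc[symmetric] by (rule mult_right_mono)
  also have "\<dots> \<le> p * (trunc_pow p M t + b powr p)"
    unfolding eq(2) using p b by (intro mult_left_mono powr_mult_le_add) auto
  finally show ?thesis .
qed

lemma trunc_pow_bounds:
  assumes "1 \<le> M" "1 \<le> p"
  shows "0 \<le> trunc_pow p M t" "trunc_pow p M t \<le> (1 + \<bar>t\<bar>) powr p" "trunc_pow p M t \<le> (1 + M\<^sup>2) powr (p/2)"
    "\<bar>trunc_pow_deriv p M t\<bar> \<le> p * (1 + M\<^sup>2) powr ((p - 1) / 2)"
proof -
  have pos: "0 < trunc_sq M t" using assms by (intro trunc_sq_pos) auto
  show "0 \<le> trunc_pow p M t" by (simp add: trunc_pow_def)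
  have "trunc_pow p M t \<le> ((1 + \<bar>t\<bar>)\<^sup>2) powr (p / 2)"
    unfolding trunc_pow_def using pos trunc_sq_le(1)[OF assms(1), of t] assms
    by (intro powr_mono2) (auto simp: power2_sum)
  also have "\<dots> = (1 + \<bar>t\<bar>) powr p" by (simp add: powr_numeral[symmetric] powr_powr del: powr_numeral)
  finally show "trunc_pow p M t \<le> (1 + \<bar>t\<bar>) powr p" .
  show "trunc_pow p M t \<le> (1 + M\<^sup>2) powr (p/2)"
    unfolding trunc_pow_def using pos trunc_sq_le(2)[OF assms(1), of t] assms by (intro powr_mono2) auto
  have "trunc_sq M t powr ((p - 1) / 2) \<le> (1 + M\<^sup>2) powr ((p - 1) / 2)"
    using pos trunc_sq_le(2)[OF assms(1), of t] assms by (intro powr_mono2) auto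
  then show "\<bar>trunc_pow_deriv p M t\<bar> \<le> p * (1 + M\<^sup>2) powr ((p - 1) / 2)"
    using trunc_pow_deriv_le[of M p t] assms by (smt (verit) mult_left_mono)
qed

text \<open>This constant may grow with \<open>M\<close>; it shows that the truncated power is
  admissible in a cylinder function. The energy estimate uses \<open>trunc_pow_deriv_mult_le\<close>
  instead, which is uniform in \<open>M\<close>.\<close>

lemma trunc_pow_Lipschitz:
  assumes "1 \<le> M" "1 \<le> p"
  shows "\<bar>trunc_pow p M s - trunc_pow p M t\<bar> \<le> p * (1 + M\<^sup>2) powr ((p - 1) / 2) * \<bar>s - t\<bar>"
  using field_differentiable_bound[of UNIV "trunc_pow p M" "trunc_pow_deriv p M" _ s t]
    DERIV_trunc_pow[of M p] trunc_pow_bounds(4)[OF assms] assms by (simp add: abs_minus_commute)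

text \<open>Cut-off and argument are driven by the same index, which leaves a single sequence of
  cylinder functions in place of an iterated limit.\<close>

lemma trunc_pow_tendsto:
  assumes "a \<longlonglongrightarrow> h" "0 \<le> h" "1 \<le> p"
  shows "(\<lambda>m. trunc_pow p (real (Suc m)) (a m)) \<longlonglongrightarrow> h powr p"
proof -
  have "(\<lambda>m. a m * (1 / real (Suc m))) \<longlonglongrightarrow> h * 0"
    by (intro tendsto_mult assms(1) lim_const_over_n[THEN LIMSEQ_Suc])
  then have "(\<lambda>m. a m / real (Suc m)) \<longlonglongrightarrow> 0" by simp
  then have "(\<lambda>m. 1 / real (Suc m) + (a m)\<^sup>2 / (1 + (a m / real (Suc m))\<^sup>2)) \<longlonglongrightarrow> 0 + h\<^sup>2 / (1 + 0\<^sup>2)"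
    by (intro tendsto_intros assms(1) lim_const_over_n[THEN LIMSEQ_Suc]) auto
  then have "(\<lambda>m. trunc_sq (real (Suc m)) (a m)) \<longlonglongrightarrow> h\<^sup>2" by (simp add: trunc_sq_def)
  then have "(\<lambda>m. trunc_sq (real (Suc m)) (a m) powr (p/2)) \<longlonglongrightarrow> (h\<^sup>2) powr (p/2)"
    by (rule tendsto_powr'[OF _ tendsto_const])
       (use assms in \<open>auto intro!: always_eventually less_imp_le[OF trunc_sq_pos] simp del: of_nat_Suc\<close>)
  moreover have "(h\<^sup>2) powr (p/2) = h powr p"
    using assms(2) by (simp add: powr_numeral[symmetric] powr_powr del: powr_numeral)
  ultimately show ?thesis by (simp add: trunc_pow_def)
qed

lemma continuous_on_trunc_pow_deriv:
  assumes "0 < M"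
  shows "continuous_on UNIV (trunc_pow_deriv p M)"
proof -
  have ne: "1 + (t / M)\<^sup>2 \<noteq> 0" for t using one_plus_sq_pos[of "t / M"] by linarith
  have c: "continuous_on UNIV (trunc_sq M)"
    unfolding trunc_sq_def[abs_def] using assms ne by (intro continuous_intros) auto
  have "trunc_sq M t \<noteq> 0" for t using trunc_sq_pos[OF assms, of t] by simp
  then show ?thesis
    unfolding trunc_pow_deriv_def[abs_def] using assms ne by (intro continuous_intros c) auto
qed

section \<open>The intrinsic derivative of the arctangent of an integral\<close>

lemma Pp_norm_integrable:
  assumes "\<mu> \<in> Pp p" "1 \<le> p" "0 \<le> c"
  shows "integrable \<mu> (\<lambda>x. (c + norm x) powr p)"
proof -
  note d = PpD[OF assms(1)]
  interpret prob_space \<mu> by (rule d)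
  note [measurable_cong] = d(2)
  obtain a where a: "0 \<le> a" "Lp_int p \<mu> norm = ennreal (a powr p)"
    using Pp_moment[OF assms(1,2)] .
  have "Lp_int p \<mu> (\<lambda>x. c + norm x) \<le> ennreal ((c + a) powr p)"
    by (rule nn_integral_Minkowski[OF assms(2)]) (use a assms emeasure_space_1 in auto)
  then show ?thesis by (intro integrableI_bounded) (auto simp: le_less_trans)
qed

text \<open>For \<open>\<phi>\<close> in the unit ball of L^p the derivative of S = \<integral>
  \<psi> d\<mu> is at most K(S + 1), and \<open>arctan\<close> divides it by 1 + S^2. Since S + 1
  \<le> 2(1 + S^2), the bound depends on neither \<open>\<mu>\<close> nor \<open>B\<close> nor
  \<open>L\<close>; \<open>B\<close> gives integrability and \<open>L\<close> a dominating
  function.\<close>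

lemma Dnorm_arctan_integral_le:
  fixes \<psi> :: "'a::{banach,second_countable_topology} \<Rightarrow> real"
  assumes p: "1 \<le> p" and \<mu>: "\<mu> \<in> Pp p" and nn: "\<And>x. 0 \<le> \<psi> x" and bnd: "\<And>x. \<psi> x \<le> B"
    and lip: "\<And>x y. \<bar>\<psi> x - \<psi> y\<bar> \<le> L * norm (x - y)"
    and deriv: "\<And>x v. ((\<lambda>t. \<psi> (x + t *\<^sub>R v)) has_real_derivative d\<psi> x v) (at 0)"
    and le: "\<And>x v. \<bar>d\<psi> x v\<bar> \<le> K * (\<psi> x + norm v powr p)" and K: "0 \<le> K"
  shows "Dnorm p (\<lambda>\<mu>. arctan (\<integral>x. \<psi> x \<partial>\<mu>)) \<mu> \<le> ennreal (2 * K)"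
  unfolding Dnorm_def
proof (rule SUP_least, elim CollectE conjE)
  fix \<phi> assume "\<phi> \<in> Lp_fun p \<mu>" and norm1: "Lp_norm p \<mu> \<phi> \<le> 1"
  note m = PpD[OF \<mu>]
  interpret prob_space \<mu> by (rule m)
  note [measurable_cong] = m(2)
  have [measurable]: "\<phi> \<in> borel_measurable \<mu>" and fin: "Lp_int p \<mu> (\<lambda>x. norm (\<phi> x)) < \<infinity>"
    using \<open>\<phi> \<in> Lp_fun p \<mu>\<close> by (auto simp: Lp_fun_def)
  have [measurable]: "\<psi> \<in> borel_measurable borel"
    by (rule borel_measurable_continuous_onI[OF continuous_on_Lipschitz_real[OF lip]])
  define N where "N = enn2real (Lp_int p \<mu> (\<lambda>x. norm (\<phi> x)))"
  have "N \<le> 1"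
  proof (rule ccontr)
    assume "\<not> N \<le> 1"
    then have "1 powr (1/p) < N powr (1/p)" using p by (intro powr_less_mono2) auto
    then show False using norm1 by (simp add: Lp_norm_def N_def)
  qed
  have int\<phi>p: "integrable \<mu> (\<lambda>x. norm (\<phi> x) powr p)"
    using fin by (intro integrableI_bounded) auto
  have "(\<integral>x. norm (\<phi> x) powr p \<partial>\<mu>) = N"
    unfolding N_def by (intro integral_eq_nn_integral) auto
  have le1: "s \<le> 1 + s powr p" if "0 \<le> s" for s
    using powr_mult_le_add[OF p, of 1 s] that by simp
  have int\<phi>: "integrable \<mu> (\<lambda>x. norm (\<phi> x))"
    by (rule Bochner_Integration.integrable_bound[of _ "\<lambda>x. 1 + norm (\<phi> x) powr p"])
       (use int\<phi>p le1[OF norm_ge_zero] in auto)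
  have int\<psi>: "integrable \<mu> (\<lambda>x. \<psi> (x + t *\<^sub>R \<phi> x))" for t
    by (rule integrable_const_bound[where B=B]) (use nn bnd in auto)
  define S where "S = (\<integral>x. \<psi> x \<partial>\<mu>)"
  have S0: "0 \<le> S" unfolding S_def by (intro integral_nonneg_AE) (simp add: nn)
  define I where "I = (\<lambda>t. \<integral>x. \<psi> (x + t *\<^sub>R \<phi> x) \<partial>\<mu>)"
  have I0: "I 0 = S" by (simp add: I_def S_def)
  define I' where "I' = (\<integral>x. d\<psi> x (\<phi> x) \<partial>\<mu>)"
  have quot: "(\<lambda>k. (\<psi> (x + s k *\<^sub>R v) - \<psi> x) / s k) \<longlonglongrightarrow> d\<psi> x v"
    if "\<forall>k. s k \<in> UNIV - {0}" "s \<longlonglongrightarrow> 0" for x v s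
  proof -
    have "((\<lambda>t. (\<psi> (x + t *\<^sub>R v) - \<psi> x) / t) \<longlongrightarrow> d\<psi> x v) (at 0)"
      using deriv[of x v] by (simp add: has_field_derivative_iff)
    then show ?thesis unfolding tendsto_at_iff_sequentially o_def using that by blast
  qed
  \<comment> \<open>\<open>d\<psi>\<close> is known only as a pointwise derivative; along
    \<open>\<phi>\<close> it is measurable as a limit of difference quotients.\<close>
  have meas'[measurable]: "(\<lambda>x. d\<psi> x (\<phi> x)) \<in> borel_measurable \<mu>"
    by (rule borel_measurable_LIMSEQ_real[OF quot[of "\<lambda>k. 1 / real (Suc k)"]])
       (use LIMSEQ_inverse_real_of_nat in \<open>auto simp: inverse_eq_divide\<close>)
  have int': "integrable \<mu> (\<lambda>x. K * (\<psi> x + norm (\<phi> x) powr p))"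
    using int\<psi>[of 0] int\<phi>p by simp
  have "\<bar>I'\<bar> \<le> K * (S + 1)"
  proof -
    have "\<bar>I'\<bar> \<le> (\<integral>x. K * (\<psi> x + norm (\<phi> x) powr p) \<partial>\<mu>)"
      unfolding I'_def using le int' 
      by (intro order_trans[OF integral_abs_bound] integral_mono') (use nn K in \<open>auto intro!: mult_nonneg_nonneg add_nonneg_nonneg\<close>)
    also have "\<dots> = K * (S + N)"
      using int\<psi>[of 0] int\<phi>p \<open>(\<integral>x. norm (\<phi> x) powr p \<partial>\<mu>) = N\<close> by (simp add: S_def)
    also have "\<dots> \<le> K * (S + 1)" using K \<open>N \<le> 1\<close> by (intro mult_left_mono) auto
    finally show ?thesis .
  qed
  \<comment> \<open>Differentiation under the integral, tested on arbitrary sequences tending to 0;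
    the Lipschitz bound dominates the quotients by
    \<open>\<bar>L\<bar> * norm (\<phi> x)\<close>.\<close>
  have DI: "(I has_real_derivative I') (at 0)"
    unfolding has_field_derivative_iff tendsto_at_iff_sequentially o_def
  proof (intro allI impI)
    fix s :: "nat \<Rightarrow> real" assume s: "\<forall>i. s i \<in> UNIV - {0}" "s \<longlonglongrightarrow> 0"
    have lim: "(\<lambda>k. \<integral>x. (\<psi> (x + s k *\<^sub>R \<phi> x) - \<psi> x) / s k \<partial>\<mu>) \<longlonglongrightarrow> I'"
      unfolding I'_def
    proof (rule integral_dominated_convergence[where w="\<lambda>x. \<bar>L\<bar> * norm (\<phi> x)"])
      show "AE x in \<mu>. (\<lambda>k. (\<psi> (x + s k *\<^sub>R \<phi> x) - \<psi> x) / s k) \<longlonglongrightarrow> d\<psi> x (\<phi> x)"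
        using quot[OF s] by simp
      show "AE x in \<mu>. norm ((\<psi> (x + s k *\<^sub>R \<phi> x) - \<psi> x) / s k) \<le> \<bar>L\<bar> * norm (\<phi> x)" for k
      proof (rule AE_I2)
        fix x
        have "\<bar>\<psi> (x + s k *\<^sub>R \<phi> x) - \<psi> x\<bar> \<le> L * norm (s k *\<^sub>R \<phi> x)"
          using lip[of "x + s k *\<^sub>R \<phi> x" x] by simp
        also have "\<dots> \<le> \<bar>L\<bar> * norm (s k *\<^sub>R \<phi> x)" by (intro mult_right_mono) auto
        also have "\<dots> = \<bar>L\<bar> * norm (\<phi> x) * \<bar>s k\<bar>" by simp
        finally show "norm ((\<psi> (x + s k *\<^sub>R \<phi> x) - \<psi> x) / s k) \<le> \<bar>L\<bar> * norm (\<phi> x)"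
          using s(1) by (simp add: divide_le_eq)
      qed
    qed (use int\<phi> in auto)
    have eq: "(\<integral>x. (\<psi> (x + s k *\<^sub>R \<phi> x) - \<psi> x) / s k \<partial>\<mu>) = (I (s k) - I 0) / (s k - 0)" for k
      using Bochner_Integration.integral_diff[OF int\<psi>[of "s k"] int\<psi>[of 0]] by (simp add: I_def)
    show "(\<lambda>k. (I (s k) - I 0) / (s k - 0)) \<longlonglongrightarrow> I'" using lim unfolding eq .
  qed
  have "((\<lambda>t. arctan (I t)) has_real_derivative inverse (1 + (I 0)\<^sup>2) * I') (at 0)"
    by (rule DERIV_chain2[OF DERIV_arctan DI])
  then have "((\<lambda>t. (arctan (I t) - arctan S) / t) \<longlongrightarrow> inverse (1 + S\<^sup>2) * I') (at 0)"
    by (simp add: has_field_derivative_iff I0)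
  moreover have "arctan (\<integral>x. \<psi> x \<partial>distr \<mu> borel (\<lambda>x. x + t *\<^sub>R \<phi> x)) = arctan (I t)" for t
    unfolding I_def by (subst integral_distr) auto
  \<comment> \<open>The limit exists, so \<open>Lim\<close> in \<open>dir_deriv\<close> denotes
    it.\<close>
  ultimately have "dir_deriv (\<lambda>\<mu>. arctan (\<integral>x. \<psi> x \<partial>\<mu>)) \<mu> \<phi> = inverse (1 + S\<^sup>2) * I'"
    unfolding dir_deriv_def S_def[symmetric] by (intro tendsto_Lim) auto
  moreover have "\<bar>inverse (1 + S\<^sup>2) * I'\<bar> \<le> 2 * K"
  proof -
    have "S + 1 \<le> 2 * (1 + S\<^sup>2)"
      using sum_squares_bound[of 1 S] S0 by (simp add: power2_eq_square) (smt (verit) zero_le_square)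
    then have "K * (S + 1) \<le> K * (2 * (1 + S\<^sup>2))" using K by (rule mult_left_mono)
    then have "\<bar>I'\<bar> \<le> 2 * K * (1 + S\<^sup>2)" using \<open>\<bar>I'\<bar> \<le> K * (S + 1)\<close> by (simp add: algebra_simps)
    then show ?thesis using one_plus_sq_pos[of S] by (simp add: abs_mult field_simps)
  qed
  ultimately show "ennreal \<bar>dir_deriv (\<lambda>\<mu>. arctan (\<integral>x. \<psi> x \<partial>\<mu>)) \<mu> \<phi>\<bar> \<le> ennreal (2 * K)"
    by (simp add: ennreal_leI)
qed

lemma Cb1_arctan: "Cb1 1 (\<lambda>y. arctan (y 0))"
proof (rule Cb1_of_C1_dir)
  show "C1_dir (\<lambda>y. arctan (y 0))"
    by (rule C1_dir_comp[OF C1_dir_coord, where S=UNIV and \<phi>'="\<lambda>s. inverse (1 + s\<^sup>2)"])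
       (auto intro!: DERIV_arctan continuous_intros simp: add_nonneg_eq_0_iff)
  have lip: "\<bar>arctan s - arctan t\<bar> \<le> 1 * \<bar>s - t\<bar>" for s t
    using field_differentiable_bound[of UNIV arctan "\<lambda>s. inverse (1 + s\<^sup>2)" 1 s t] DERIV_arctan
    by (simp add: abs_minus_commute inverse_le_1_iff)
  show "\<bar>arctan ((y(k := t)) 0) - arctan (y 0)\<bar> \<le> 1 * \<bar>t - y k\<bar>" for y k t
    using lip[of t "y 0"] by simp
  show "\<bar>arctan (y 0)\<bar> \<le> pi / 2" for y :: "nat \<Rightarrow> real"
    using arctan_lbound[of "y 0"] arctan_ubound[of "y 0"] by linarith
qed simp

lemma arctan_integral_FCb1_P:
  assumes "\<psi> \<in> FCb1_X"
  shows "(\<lambda>\<mu>. arctan (\<integral>x. \<psi> x \<partial>\<mu>)) \<in> FCb1_P"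
  unfolding FCb1_P_def using Cb1_arctan assms
  by (intro CollectI exI[of _ 1] exI[of _ "\<lambda>y. arctan (y 0)"] exI[of _ "\<lambda>_. \<psi>"]) auto

section \<open>The distance to a finite set and its cylinder approximations\<close>

definition hmin :: "(nat \<Rightarrow> 'a::real_normed_vector) \<Rightarrow> nat \<Rightarrow> 'a \<Rightarrow> real" where
  "hmin d n x = Min ((\<lambda>i. norm (x - d i)) ` {..n})"

lemma hmin_le: "i \<le> n \<Longrightarrow> hmin d n x \<le> norm (x - d i)"
  unfolding hmin_def by (intro Min_le) auto

lemma hmin_ge: "(\<And>i. i \<le> n \<Longrightarrow> a \<le> norm (x - d i)) \<Longrightarrow> a \<le> hmin d n x"
  unfolding hmin_def by (intro Min.boundedI) auto

lemma hmin_attained: "\<exists>i\<le>n. hmin d n x = norm (x - d i)"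
proof -
  have "hmin d n x \<in> (\<lambda>i. norm (x - d i)) ` {..n}" unfolding hmin_def by (intro Min_in) auto
  then show ?thesis by auto
qed

lemma hmin_nonneg: "0 \<le> hmin d n x"
  by (rule hmin_ge) simp

lemma hmin_antimono: "m \<le> n \<Longrightarrow> hmin d n x \<le> hmin d m x"
  by (rule hmin_ge) (auto intro: hmin_le)

lemma hmin_triangle: "hmin d n x \<le> hmin d n y + norm (x - y)"
proof -
  obtain i where i: "i \<le> n" "hmin d n y = norm (y - d i)" using hmin_attained by blast
  have "norm (x - d i) \<le> norm (x - y) + norm (y - d i)" using norm_triangle_ineq[of "x - y" "y - d i"] by simp
  then show ?thesis using hmin_le[OF i(1), of d x] i(2) by simp
qed

lemma hmin_le_norm: "d 0 = 0 \<Longrightarrow> hmin d n x \<le> norm x"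
  using hmin_le[of 0 n d x] by simp

lemma hmin_measurable [measurable]: "hmin d n \<in> borel_measurable borel"
  using hmin_triangle[of d n]
  by (intro borel_measurable_continuous_onI continuous_on_Lipschitz_real[where L=1]) (smt (verit) norm_minus_commute)

lemma hmin_tendsto_0:
  assumes "\<And>x e. 0 < e \<Longrightarrow> \<exists>i. dist x (d i) < e"
  shows "(\<lambda>n. hmin d n x) \<longlonglongrightarrow> 0"
proof (rule LIMSEQ_I)
  fix e :: real assume "0 < e"
  then obtain i where "norm (x - d i) < e" using assms by (auto simp: dist_norm)
  then have "hmin d n x < e" if "i \<le> n" for n using hmin_le[OF that, of d x] by simp
  then show "\<exists>no. \<forall>n\<ge>no. norm (hmin d n x - 0) < e" using hmin_nonneg[of d _ x] by (intro exI[of _ i]) auto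
qed

context
  fixes d :: "nat \<Rightarrow> 'a::{banach,second_countable_topology}" and l :: "nat \<Rightarrow> 'a \<Rightarrow>\<^sub>L real"
  assumes l: "norming_seq l" and d0: "d 0 = 0"
begin

text \<open>The parameter \<beta> = \<open>Suc m\<close> grows with the number of functionals. The
  log-sum-exp errors ln (Suc m) / Suc m of the norm and ln (Suc n) / Suc m of the minimum both
  vanish, so one index drives the whole approximation.\<close>

definition dist_smooth :: "nat \<Rightarrow> nat \<Rightarrow> 'a \<Rightarrow> real" where
  "dist_smooth n m x = smin (\<lambda>i j. l j (d i)) n m (real (Suc m)) (\<lambda>j. if j < Suc m then l j x else 0)"

definition dist_cyl :: "real \<Rightarrow> nat \<Rightarrow> nat \<Rightarrow> 'a \<Rightarrow> real" where
  "dist_cyl p n m x = trunc_pow p (real (Suc m)) (dist_smooth n m x)"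

lemma norming_le: "\<bar>l j x\<bar> \<le> norm x"
  using l by (simp add: norming_seq_def)

lemma dist_smooth_den:
  "smin_den (\<lambda>i j. l j (d i)) m \<beta> i (\<lambda>j. if j < Suc m then l j x else 0) = (\<Sum>j\<le>m. exp (\<beta> * l j (x - d i)))"
  unfolding smin_den_def by (intro sum.cong) (auto simp: blinfun.diff_right)

lemma dist_smooth_Lipschitz: "\<bar>dist_smooth n m x - dist_smooth n m y\<bar> \<le> norm (x - y)"
  unfolding dist_smooth_def
  by (rule smin_Lipschitz) (use norming_le[of _ "x - y"] in \<open>auto simp: blinfun.diff_right\<close>)

text \<open>A log-sum-exp of \<open>Suc m\<close> terms exceeds their maximum by at most ln (Suc m)
  / \<beta>, and a soft minimum never exceeds its single members.\<close>

lemma dist_smooth_le: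
  assumes i: "i \<le> n"
  shows "dist_smooth n m x \<le> norm (x - d i) + ln (real (Suc m)) / real (Suc m)"
proof -
  define \<beta> where "\<beta> = real (Suc m)"
  have \<beta>: "\<beta> > 0" by (simp add: \<beta>_def)
  define P where "P = (\<lambda>i. \<Sum>j\<le>m. exp (\<beta> * l j (x - d i)))"
  have P: "0 < P i" for i unfolding P_def by (intro sum_pos) auto
  have "exp (\<beta> * l j (x - d i)) \<le> exp (\<beta> * norm (x - d i))" for j
    using norming_le[of j "x - d i"] \<beta> by simp
  then have "P i \<le> (\<Sum>j\<le>m. exp (\<beta> * norm (x - d i)))" unfolding P_def by (intro sum_mono)
  then have "P i \<le> \<beta> * exp (\<beta> * norm (x - d i))" by (simp add: \<beta>_def)
  then have "inverse (\<beta> * exp (\<beta> * norm (x - d i))) \<le> inverse (P i)" by (rule le_imp_inverse_le[OF _ P])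
  also have "\<dots> \<le> (\<Sum>i\<le>n. inverse (P i))" using i P by (intro member_le_sum) (auto intro: less_imp_le)
  finally have "ln (inverse (\<beta> * exp (\<beta> * norm (x - d i)))) \<le> ln (\<Sum>i\<le>n. inverse (P i))"
    using \<beta> by (subst ln_le_cancel_iff) (auto intro!: sum_pos P)
  then have "- (ln \<beta> + \<beta> * norm (x - d i)) \<le> ln (\<Sum>i\<le>n. inverse (P i))"
    using \<beta> by (simp add: ln_inverse ln_mult)
  then have "- ln (\<Sum>i\<le>n. inverse (P i)) / \<beta> \<le> (ln \<beta> + \<beta> * norm (x - d i)) / \<beta>"
    using \<beta> by (intro divide_right_mono) auto
  also have "\<dots> = norm (x - d i) + ln \<beta> / \<beta>" using \<beta> by (simp add: field_simps)
  finally show ?thesis unfolding dist_smooth_def smin_def dist_smooth_den P_def \<beta>_def .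
qed

text \<open>The soft minimum over \<open>Suc n\<close> centres falls below their least value by at
  most ln (Suc n) / \<beta>, while each soft maximum is at least any of its members. It therefore
  suffices that every centre has one functional detecting the distance \<open>a\<close>.\<close>

lemma dist_smooth_ge:
  assumes a: "\<And>i. i \<le> n \<Longrightarrow> \<exists>j\<le>m. a \<le> l j (x - d i)"
  shows "a - ln (real (Suc n)) / real (Suc m) \<le> dist_smooth n m x"
proof -
  define \<beta> where "\<beta> = real (Suc m)"
  have \<beta>: "\<beta> > 0" by (simp add: \<beta>_def)
  define P where "P = (\<lambda>i. \<Sum>j\<le>m. exp (\<beta> * l j (x - d i)))"
  have P: "0 < P i" for i unfolding P_def by (intro sum_pos) auto
  have "inverse (P i) \<le> inverse (exp (\<beta> * a))" if i: "i \<le> n" for i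
  proof -
    obtain j where j: "j \<le> m" "a \<le> l j (x - d i)" using a[OF i] by auto
    have "exp (\<beta> * a) \<le> exp (\<beta> * l j (x - d i))" using j \<beta> by simp
    also have "\<dots> \<le> P i" unfolding P_def using j by (intro member_le_sum) auto
    finally show ?thesis by (rule le_imp_inverse_le) simp
  qed
  then have "(\<Sum>i\<le>n. inverse (P i)) \<le> (\<Sum>i\<le>n. inverse (exp (\<beta> * a)))" by (intro sum_mono) auto
  then have "ln (\<Sum>i\<le>n. inverse (P i)) \<le> ln (real (Suc n) * inverse (exp (\<beta> * a)))"
    by (subst ln_le_cancel_iff) (auto intro!: sum_pos P simp: add_pos_nonneg)
  also have "\<dots> = ln (real (Suc n)) - \<beta> * a" by (simp add: ln_mult ln_inverse del: of_nat_Suc)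
  finally have "(\<beta> * a - ln (real (Suc n))) / \<beta> \<le> - ln (\<Sum>i\<le>n. inverse (P i)) / \<beta>"
    using \<beta> by (intro divide_right_mono) auto
  moreover have "(\<beta> * a - ln (real (Suc n))) / \<beta> = a - ln (real (Suc n)) / \<beta>" using \<beta> by (simp add: diff_divide_distrib)
  ultimately show ?thesis unfolding dist_smooth_def smin_def dist_smooth_den P_def \<beta>_def by simp
qed

lemma dist_smooth_tendsto: "(\<lambda>m. dist_smooth n m x) \<longlonglongrightarrow> hmin d n x"
proof (rule LIMSEQ_I)
  fix e :: real assume e: "0 < e"
  have "\<exists>j. norm (x - d i) - e / 2 < l j (x - d i)" for i
    using l e unfolding norming_seq_def by (meson half_gt_zero)
  \<comment> \<open>One functional per centre nearly attains the norm; there are finitely many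
    centres, so for large \<open>m\<close> all of these functionals are in use.\<close>
  then obtain J where J: "\<And>i. norm (x - d i) - e / 2 < l (J i) (x - d i)" by metis
  have lim1: "(\<lambda>m. ln (real (Suc m)) / real (Suc m)) \<longlonglongrightarrow> 0"
    by (rule LIMSEQ_Suc[OF lim_ln_over_n])
  have lim2: "(\<lambda>m. ln (real (Suc n)) / real (Suc m)) \<longlonglongrightarrow> 0"
    by (rule LIMSEQ_Suc[OF lim_const_over_n])
  have Jle: "J i \<le> Max (J ` {..n})" if "i \<le> n" for i using that by simp
  have "\<forall>\<^sub>F m in sequentially. ln (real (Suc m)) / real (Suc m) < e \<and> ln (real (Suc n)) / real (Suc m) < e/2 \<and> (\<forall>i\<le>n. J i \<le> m)"
    using order_tendstoD(2)[OF lim1 e] order_tendstoD(2)[OF lim2 half_gt_zero[OF e]] eventually_ge_at_top[of "Max (J ` {..n})"]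
    by eventually_elim (use Jle e in \<open>auto intro: order_trans\<close>)
  then obtain M where M: "\<And>m. M \<le> m \<Longrightarrow> ln (real (Suc m)) / real (Suc m) < e \<and> ln (real (Suc n)) / real (Suc m) < e/2 \<and> (\<forall>i\<le>n. J i \<le> m)"
    unfolding eventually_sequentially by blast
  have "norm (dist_smooth n m x - hmin d n x) < e" if "M \<le> m" for m
  proof -
    obtain i where i: "i \<le> n" "hmin d n x = norm (x - d i)" using hmin_attained by blast
    have "dist_smooth n m x < hmin d n x + e" using dist_smooth_le[OF i(1), of m x] M[OF that] i(2) by linarith
    moreover have "hmin d n x - e / 2 - ln (real (Suc n)) / real (Suc m) \<le> dist_smooth n m x"
    proof (rule dist_smooth_ge)
      fix i assume "i \<le> n"
      then show "\<exists>j\<le>m. hmin d n x - e / 2 \<le> l j (x - d i)"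
        using J[of i] hmin_le[of i n d x] M[OF that] by (intro exI[of _ "J i"]) auto
    qed
    then have "hmin d n x - e < dist_smooth n m x" using M[OF that] by linarith
    ultimately show ?thesis by simp
  qed
  then show "\<exists>no. \<forall>m\<ge>no. norm (dist_smooth n m x - hmin d n x) < e" by blast
qed

text \<open>Uniformity in \<open>m\<close> supplies the dominating function for the limit of the
  integrals. The upper bound uses the centre \<open>d 0 = 0\<close>, the lower one the functional
  with index 0, which is present for every \<open>m\<close>.\<close>

lemma dist_smooth_bound: "\<exists>B\<ge>0. \<forall>m x. \<bar>dist_smooth n m x\<bar> \<le> B + norm x"
proof (intro exI[of _ "1 + ln (real (Suc n)) + (\<Sum>i\<le>n. norm (d i))"] conjI allI)
  have s0: "0 \<le> (\<Sum>i\<le>n. norm (d i))" by (intro sum_nonneg) auto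
  then show "0 \<le> 1 + ln (real (Suc n)) + (\<Sum>i\<le>n. norm (d i))" by (simp del: of_nat_Suc)
  fix m x
  have "ln (real (Suc m)) \<le> real (Suc m)" using ln_le_minus_one[of "real (Suc m)"] by simp
  then have "ln (real (Suc m)) / real (Suc m) \<le> 1" by (simp only: divide_le_eq_1) (simp del: of_nat_Suc)
  then have up: "dist_smooth n m x \<le> norm x + 1" using dist_smooth_le[of 0 n m x] d0 by (simp only: diff_zero) linarith
  have "- (norm x + (\<Sum>i\<le>n. norm (d i))) - ln (real (Suc n)) / real (Suc m) \<le> dist_smooth n m x"
  proof (rule dist_smooth_ge)
    fix i assume "i \<le> n"
    then have "norm (d i) \<le> (\<Sum>i\<le>n. norm (d i))" by (intro member_le_sum) auto
    then show "\<exists>j\<le>m. - (norm x + (\<Sum>i\<le>n. norm (d i))) \<le> l j (x - d i)"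
      using norming_le[of 0 "x - d i"] norm_triangle_ineq4[of x "d i"] by (intro exI[of _ 0]) auto
  qed
  moreover have "ln (real (Suc n)) / real (Suc m) \<le> ln (real (Suc n)) / 1"
    by (intro divide_left_mono) auto
  moreover have "0 \<le> ln (real (Suc n))" by (rule ln_ge_zero) simp
  ultimately show "\<bar>dist_smooth n m x\<bar> \<le> 1 + ln (real (Suc n)) + (\<Sum>i\<le>n. norm (d i)) + norm x"
    using up s0 unfolding abs_le_iff by linarith
qed

lemma dist_cyl_FCb1_X:
  assumes "1 \<le> p"
  shows "dist_cyl p n m \<in> FCb1_X"
proof -
  let ?g = "\<lambda>y. trunc_pow p (real (Suc m)) (smin (\<lambda>i j. l j (d i)) n m (real (Suc m)) y)"
  let ?L = "p * (1 + (real (Suc m))\<^sup>2) powr ((p - 1) / 2)"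
  have M: "1 \<le> real (Suc m)" "0 < real (Suc m)" by auto
  have "C1_dir ?g"
    by (rule C1_dir_comp[OF C1_dir_smin[OF M(2)], where S=UNIV and \<phi>'="trunc_pow_deriv p (real (Suc m))"])
       (auto simp del: of_nat_Suc intro: DERIV_trunc_pow[OF M(2)] continuous_on_trunc_pow_deriv[OF M(2)])
  then have "Cb1 (Suc m) ?g"
  proof (rule Cb1_of_C1_dir)
    show "?g y = ?g (\<lambda>i. if i < Suc m then y i else 0)" for y
      by (simp add: smin_def smin_den_def)
    show "\<bar>?g y\<bar> \<le> (1 + (real (Suc m))\<^sup>2) powr (p/2)" for y
      using trunc_pow_bounds(1,3)[OF M(1) assms] by (simp add: abs_of_nonneg del: of_nat_Suc)
    show "\<bar>?g (y(k := t)) - ?g y\<bar> \<le> ?L * \<bar>t - y k\<bar>" for y k t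
    proof -
      have "\<bar>smin (\<lambda>i j. l j (d i)) n m (real (Suc m)) (y(k := t)) - smin (\<lambda>i j. l j (d i)) n m (real (Suc m)) y\<bar> \<le> \<bar>t - y k\<bar>"
        by (rule smin_Lipschitz) auto
      then show ?thesis
        by (rule order_trans[OF trunc_pow_Lipschitz[OF M(1) assms] mult_left_mono]) (use assms in auto)
    qed
  qed
  then show ?thesis unfolding FCb1_X_def dist_cyl_def[abs_def] dist_smooth_def by blast
qed

lemma dist_cyl_tendsto: "1 \<le> p \<Longrightarrow> (\<lambda>m. dist_cyl p n m x) \<longlonglongrightarrow> hmin d n x powr p"
  unfolding dist_cyl_def by (rule trunc_pow_tendsto[OF dist_smooth_tendsto hmin_nonneg])

text \<open>The inner function is 1-Lipschitz, so its derivative along \<open>v\<close> is at most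
  \<open>norm v\<close> and the general estimate applies with K = p. The result is independent of
  \<open>n\<close>, \<open>m\<close> and \<open>\<mu>\<close>, as needed for energies bounded along
  both limits.\<close>

lemma dist_cyl_Dnorm_le:
  assumes p: "1 \<le> p" and \<mu>: "\<mu> \<in> Pp p"
  shows "Dnorm p (\<lambda>\<mu>. arctan (\<integral>x. dist_cyl p n m x \<partial>\<mu>)) \<mu> \<le> ennreal (2 * p)"
proof -
  have M: "1 \<le> real (Suc m)" "0 < real (Suc m)" by auto
  obtain dg where dg: "has_C1_dir (smin (\<lambda>i j. l j (d i)) n m (real (Suc m))) dg"
    using C1_dir_smin[OF M(2)] unfolding C1_dir_def by blast
  define du where "du = (\<lambda>x v. dg (\<lambda>j. if j < Suc m then l j x else 0) (\<lambda>j. if j < Suc m then l j v else 0))"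
  have du: "((\<lambda>t. dist_smooth n m (x + t *\<^sub>R v)) has_real_derivative du x v) (at 0)" for x v
  proof -
    have "(\<lambda>j. (if j < Suc m then l j x else 0) + t * (if j < Suc m then l j v else 0)) = (\<lambda>j. if j < Suc m then l j (x + t *\<^sub>R v) else 0)" for t
      by (auto simp: blinfun.add_right blinfun.scaleR_right)
    then show ?thesis
      using has_C1_dirD(2)[OF dg, of "\<lambda>j. if j < Suc m then l j x else 0" "\<lambda>j. if j < Suc m then l j v else 0"]
      unfolding dist_smooth_def du_def by simp
  qed
  have du_le: "\<bar>du x v\<bar> \<le> norm v" for x v
    by (rule DERIV_abs_le[OF du]) (use dist_smooth_Lipschitz[of n m "x + _ *\<^sub>R v" x] in \<open>simp add: mult.commute\<close>)
  obtain L where L: "\<And>x y. \<bar>dist_cyl p n m x - dist_cyl p n m y\<bar> \<le> L * norm (x - y)"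
    using FCb1_X_Lipschitz[OF dist_cyl_FCb1_X[OF p]] by metis
  show ?thesis
  proof (rule Dnorm_arctan_integral_le[OF p \<mu> _ _ L])
    show "0 \<le> dist_cyl p n m x" "dist_cyl p n m x \<le> (1 + (real (Suc m))\<^sup>2) powr (p/2)" for x
      unfolding dist_cyl_def by (rule trunc_pow_bounds[OF M(1) p])+
    show "((\<lambda>t. dist_cyl p n m (x + t *\<^sub>R v)) has_real_derivative trunc_pow_deriv p (real (Suc m)) (dist_smooth n m x) * du x v) (at 0)" for x v
      unfolding dist_cyl_def by (rule DERIV_chain2[OF _ du]) (use DERIV_trunc_pow[OF M(2), of p "dist_smooth n m x"] in \<open>simp del: of_nat_Suc\<close>)
    show "\<bar>trunc_pow_deriv p (real (Suc m)) (dist_smooth n m x) * du x v\<bar> \<le> p * (dist_cyl p n m x + norm v powr p)" for x v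
      unfolding abs_mult dist_cyl_def
      by (rule order_trans[OF mult_left_mono[OF du_le] trunc_pow_deriv_mult_le[OF M(2) p]]) auto
  qed (use p in auto)
qed

lemma integral_dist_cyl_tendsto:
  assumes p: "1 \<le> p" and \<mu>: "\<mu> \<in> Pp p"
  shows "(\<lambda>m. \<integral>x. dist_cyl p n m x \<partial>\<mu>) \<longlonglongrightarrow> (\<integral>x. hmin d n x powr p \<partial>\<mu>)"
proof -
  note [measurable_cong] = PpD(2)[OF \<mu>]
  have [measurable]: "dist_cyl p n m \<in> borel_measurable borel" for m
    by (rule FCb1_X_measurable[OF dist_cyl_FCb1_X[OF p]])
  obtain B where B: "0 \<le> B" "\<And>m x. \<bar>dist_smooth n m x\<bar> \<le> B + norm x" using dist_smooth_bound by blast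
  show ?thesis
  proof (rule integral_dominated_convergence[where w="\<lambda>x. (1 + B + norm x) powr p"])
    show "AE x in \<mu>. (\<lambda>m. dist_cyl p n m x) \<longlonglongrightarrow> hmin d n x powr p" using dist_cyl_tendsto[OF p] by simp
    show "integrable \<mu> (\<lambda>x. (1 + B + norm x) powr p)" using B by (intro Pp_norm_integrable[OF \<mu> p]) auto
    have "\<bar>dist_cyl p n m x\<bar> \<le> (1 + B + norm x) powr p" for m x
    proof -
      have "0 \<le> dist_cyl p n m x" "dist_cyl p n m x \<le> (1 + \<bar>dist_smooth n m x\<bar>) powr p"
        unfolding dist_cyl_def by (intro trunc_pow_bounds; use p in simp)+
      moreover have "(1 + \<bar>dist_smooth n m x\<bar>) powr p \<le> (1 + B + norm x) powr p"
        using B(2)[of m x] p by (intro powr_mono2) auto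
      ultimately show ?thesis by simp
    qed
    then show "AE x in \<mu>. norm (dist_cyl p n m x) \<le> (1 + B + norm x) powr p" for m by simp
  qed auto
qed

end

section \<open>Compactness\<close>

text \<open>Binary sequences are coded as reals with base-4 digits 0 and 1, so that close codes have equal leading
  digits. This carries Helly's selection theorem and Skorohod's representation theorem, which the library
  has for real random variables, over to a separable Banach space.\<close>

definition bit_val :: "(nat \<Rightarrow> bool) \<Rightarrow> real" where
  "bit_val b = (\<Sum>k. of_bool (b k) / 4 ^ Suc k)"

lemma bit_val_summable: "summable (\<lambda>k. of_bool (b k) / 4 ^ Suc k :: real)"
proof (rule summable_comparison_test')
  show "summable (\<lambda>k. (1/4) ^ Suc k :: real)" by (intro summable_geometric summable_ignore_initial_segment[of _ 1, simplified]) simp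
  show "norm (of_bool (b k) / 4 ^ Suc k :: real) \<le> (1/4) ^ Suc k" for k
    by (auto simp: power_one_over divide_simps)
qed

lemma bit_val_rec: "bit_val b = (of_bool (b 0) + bit_val (\<lambda>k. b (Suc k))) / 4"
proof -
  have "bit_val b = (\<Sum>k. of_bool (b (Suc k)) / 4 ^ Suc (Suc k)) + of_bool (b 0) / 4"
    unfolding bit_val_def using suminf_split_head[OF bit_val_summable[of b]] by simp
  also have "(\<Sum>k. of_bool (b (Suc k)) / 4 ^ Suc (Suc k)) = bit_val (\<lambda>k. b (Suc k)) / 4"
    unfolding bit_val_def using suminf_divide[OF bit_val_summable[of "\<lambda>k. b (Suc k)"], of 4] by (simp add: field_simps)
  finally show ?thesis by simp
qed

lemma bit_val_bounds: "0 \<le> bit_val b" "bit_val b \<le> 1/3"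
proof -
  show "0 \<le> bit_val b" unfolding bit_val_def by (intro suminf_nonneg bit_val_summable) auto
  have "(\<lambda>k. (1/4) ^ Suc k :: real) sums (1/4 * (1 / (1 - 1/4)))"
    using sums_mult[OF geometric_sums[of "1/4::real"], of "1/4"] by simp
  then have "(\<Sum>k. (1/4) ^ Suc k :: real) = 1/3" "summable (\<lambda>k. (1/4) ^ Suc k :: real)" by (auto simp: sums_iff)
  moreover have "bit_val b \<le> (\<Sum>k. (1/4) ^ Suc k)"
    unfolding bit_val_def by (intro suminf_le bit_val_summable calculation) (auto simp: power_one_over divide_simps)
  ultimately show "bit_val b \<le> 1/3" by simp
qed

text \<open>A leading digit contributes 1/4 and the tails differ by at most 1/12, which leaves 1/6.
  In base 2 the tails could close the gap.\<close>

lemma bit_val_separated: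
  assumes "b 0 \<noteq> b' 0"
  shows "1 / 6 \<le> \<bar>bit_val b - bit_val b'\<bar>"
  using assms bit_val_rec[of b] bit_val_rec[of b'] bit_val_bounds[of "\<lambda>k. b (Suc k)"] bit_val_bounds[of "\<lambda>k. b' (Suc k)"]
  by (cases "b 0"; cases "b' 0") auto

lemma bit_val_close:
  assumes "\<bar>bit_val b - bit_val b'\<bar> < 1 / (6 * 4 ^ n)"
  shows "b n = b' n"
  using assms
proof (induction n arbitrary: b b')
  case 0
  then show ?case using bit_val_separated[of b b'] by auto
next
  case (Suc n)
  have "b 0 = b' 0"
  proof (rule ccontr)
    assume "b 0 \<noteq> b' 0"
    then have "1/6 \<le> \<bar>bit_val b - bit_val b'\<bar>" by (rule bit_val_separated)
    moreover have "1 \<le> (4::real) ^ Suc n" by (rule one_le_power) simp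
    then have "1 / (6 * 4 ^ Suc n) \<le> (1/6 :: real)" by (simp add: divide_simps del: power_Suc)
    ultimately show False using Suc.prems by linarith
  qed
  then have "\<bar>bit_val (\<lambda>k. b (Suc k)) - bit_val (\<lambda>k. b' (Suc k))\<bar> = 4 * \<bar>bit_val b - bit_val b'\<bar>"
    using bit_val_rec[of b] bit_val_rec[of b'] by (simp add: abs_if)
  then have "\<bar>bit_val (\<lambda>k. b (Suc k)) - bit_val (\<lambda>k. b' (Suc k))\<bar> < 1 / (6 * 4 ^ n)"
    using Suc.prems by (simp add: field_simps)
  then show ?case by (rule Suc.IH)
qed

text \<open>On codes this drops the leading base-4 digit; off the codes only measurability
  matters.\<close>

definition bit_shift :: "real \<Rightarrow> real" where
  "bit_shift y = 4 * y - of_bool (1 \<le> 4 * y)"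

definition bit_of :: "nat \<Rightarrow> real \<Rightarrow> bool" where
  "bit_of n y \<longleftrightarrow> 1 \<le> 4 * (bit_shift ^^ n) y"

lemma bit_of_bit_val: "bit_of n (bit_val b) = b n"
proof (induction n arbitrary: b)
  case 0
  show ?case using bit_val_rec[of b] bit_val_bounds[of "\<lambda>k. b (Suc k)"] by (cases "b 0") (auto simp: bit_of_def)
next
  case (Suc n)
  have "bit_shift (bit_val b) = bit_val (\<lambda>k. b (Suc k))"
    using bit_val_rec[of b] bit_val_bounds[of "\<lambda>k. b (Suc k)"] by (cases "b 0") (auto simp: bit_shift_def)
  then have "bit_of (Suc n) (bit_val b) = bit_of n (bit_val (\<lambda>k. b (Suc k)))"
    by (simp add: bit_of_def funpow_swap1)
  then show ?case using Suc by simp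
qed

lemma bit_of_measurable [measurable]: "Measurable.pred borel (bit_of n)"
proof -
  have [measurable]: "bit_shift \<in> borel_measurable borel" unfolding bit_shift_def[abs_def] of_bool_def by measurable
  have [measurable]: "(bit_shift ^^ n) \<in> borel_measurable borel" by (induction n) (auto simp: comp_def id_def)
  show ?thesis unfolding bit_of_def[abs_def] by measurable
qed

section \<open>Coding points by their nearest neighbours in a dense sequence\<close>

definition near_idx :: "(nat \<Rightarrow> 'a::real_normed_vector) \<Rightarrow> nat \<Rightarrow> 'a \<Rightarrow> nat" where
  "near_idx d n x = (LEAST i. norm (x - d i) = hmin d n x)"

text \<open>\<open>LEAST\<close> ranges over all indices, but the minimum over the first
  \<open>Suc n\<close> points is attained among them, so the first index with this value is at most
  \<open>n\<close>.\<close>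

lemma near_idx: "norm (x - d (near_idx d n x)) = hmin d n x" "near_idx d n x \<le> n"
proof -
  obtain i where i: "i \<le> n" "norm (x - d i) = hmin d n x" using hmin_attained[of n d x] by auto
  show "norm (x - d (near_idx d n x)) = hmin d n x" unfolding near_idx_def by (rule LeastI) (rule i)
  show "near_idx d n x \<le> n" unfolding near_idx_def using i Least_le[of "\<lambda>i. norm (x - d i) = hmin d n x" i] by simp
qed

lemma near_idx_measurable [measurable]:
  fixes d :: "nat \<Rightarrow> 'a::{banach,second_countable_topology}"
  shows "near_idx d n \<in> measurable borel (count_space UNIV)"
  unfolding near_idx_def[abs_def] by measurable

text \<open>The bits list the graph of n \<mapsto> \<open>near_idx d n x\<close>, so a code records
  the nearest points of \<open>x\<close> at all levels. \<open>encode\<close> is in general not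
  continuous; it is measurable, has the measurable left inverse \<open>decode\<close>, and
  sufficiently close codes agree at a given level.\<close>

definition encode :: "(nat \<Rightarrow> 'a::real_normed_vector) \<Rightarrow> 'a \<Rightarrow> real" where
  "encode d x = bit_val (\<lambda>q. near_idx d (fst (prod_decode q)) x = snd (prod_decode q))"

definition decode :: "(nat \<Rightarrow> 'a::real_normed_vector) \<Rightarrow> real \<Rightarrow> 'a" where
  "decode d y = lim (\<lambda>n. d (LEAST i. bit_of (prod_encode (n, i)) y))"

lemma encode_measurable [measurable]:
  fixes d :: "nat \<Rightarrow> 'a::{banach,second_countable_topology}"
  shows "encode d \<in> borel_measurable borel"
  unfolding encode_def[abs_def] bit_val_def of_bool_def by measurable

lemma decode_measurable [measurable]:
  fixes d :: "nat \<Rightarrow> 'a::{banach,second_countable_topology}"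
  shows "decode d \<in> borel_measurable borel"
  unfolding decode_def[abs_def] by measurable

lemma decode_encode:
  assumes "\<And>x e. 0 < e \<Longrightarrow> \<exists>i. dist x (d i) < e"
  shows "decode d (encode d x) = x"
proof -
  have "(LEAST i. bit_of (prod_encode (n, i)) (encode d x)) = near_idx d n x" for n
    unfolding encode_def bit_of_bit_val by (simp add: Least_equality)
  moreover have "(\<lambda>n. d (near_idx d n x)) \<longlonglongrightarrow> x"
    unfolding tendsto_dist_iff[of _ x] dist_norm
    using hmin_tendsto_0[OF assms, of x] near_idx(1)[of x d] by (simp add: norm_minus_commute)
  ultimately show ?thesis unfolding decode_def by (simp add: limI)
qed

text \<open>A single bit decides: the one at position \<open>(n, near_idx d n x)\<close> is set for
  \<open>x\<close>, hence also for \<open>y\<close>.\<close>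

lemma encode_close:
  assumes "\<bar>encode d x - encode d y\<bar> < 1 / (6 * 4 ^ prod_encode (n, near_idx d n x))"
  shows "near_idx d n x = near_idx d n y"
  using bit_val_close[OF assms[unfolded encode_def]] by simp

section \<open>Completeness of L^p and extraction of convergent subsequences\<close>

lemma ennreal_le_suminf: "f n \<le> (\<Sum>n. f n)" for f :: "nat \<Rightarrow> ennreal"
  using sum_le_suminf[OF summableI, of "{n}" f] by simp

lemma summable_geometric_bound:
  fixes f :: "nat \<Rightarrow> 'a::banach"
  assumes "\<And>n. norm (f n) \<le> C * (1/2) ^ n"
  shows "summable f"
proof (rule summable_comparison_test'[of "\<lambda>n. C * (1/2) ^ n" 0])
  show "summable (\<lambda>n. C * (1/2) ^ n)" by (intro summable_mult summable_geometric) simp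
qed (rule assms)

text \<open>Riesz-Fischer for vector-valued functions. Along a subsequence with gaps 4^-n,
  increments multiplied by 2^n still have p-th powers with finite total integral, so almost surely
  they are O(2^-n) and sum up. Fatou's lemma carries the Cauchy bound to the limit.\<close>

lemma Lp_complete:
  fixes p :: real and Z :: "nat \<Rightarrow> 'b \<Rightarrow> 'a::{banach,second_countable_topology}"
  assumes p: "1 \<le> p" and [measurable]: "\<And>k. Z k \<in> borel_measurable M"
    and cauchy: "\<And>\<delta>. 0 < \<delta> \<Longrightarrow> \<exists>K. \<forall>k\<ge>K. \<forall>l\<ge>K. Lp_int p M (\<lambda>\<omega>. norm (Z k \<omega> - Z l \<omega>)) \<le> ennreal (\<delta> powr p)"
  shows "\<exists>Y\<in>borel_measurable M. \<forall>\<delta>>0. \<exists>K. \<forall>k\<ge>K. Lp_int p M (\<lambda>\<omega>. norm (Z k \<omega> - Y \<omega>)) \<le> ennreal (\<delta> powr p)"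
proof -
  have "\<exists>r::nat \<Rightarrow> nat. \<forall>n. (\<forall>k\<ge>r n. \<forall>l\<ge>r n. Lp_int p M (\<lambda>\<omega>. norm (Z k \<omega> - Z l \<omega>)) \<le> ennreal (((1/4::real) ^ n) powr p)) \<and> r n < r (Suc n)"
  proof (rule dependent_nat_choice)
    show "\<exists>x. \<forall>k\<ge>x. \<forall>l\<ge>x. Lp_int p M (\<lambda>\<omega>. norm (Z k \<omega> - Z l \<omega>)) \<le> ennreal (((1/4::real) ^ 0) powr p)"
      by (rule cauchy) simp
    fix x n
    obtain K where K: "\<forall>k\<ge>K. \<forall>l\<ge>K. Lp_int p M (\<lambda>\<omega>. norm (Z k \<omega> - Z l \<omega>)) \<le> ennreal (((1/4::real) ^ Suc n) powr p)"
      using cauchy[of "(1/4) ^ Suc n"] by auto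
    then show "\<exists>y. (\<forall>k\<ge>y. \<forall>l\<ge>y. Lp_int p M (\<lambda>\<omega>. norm (Z k \<omega> - Z l \<omega>)) \<le> ennreal (((1/4::real) ^ Suc n) powr p)) \<and> x < y"
      by (intro exI[of _ "max K (Suc x)"]) auto
  qed
  then obtain r where r: "\<And>n k l. r n \<le> k \<Longrightarrow> r n \<le> l \<Longrightarrow> Lp_int p M (\<lambda>\<omega>. norm (Z k \<omega> - Z l \<omega>)) \<le> ennreal (((1/4::real) ^ n) powr p)"
    and rS: "\<And>n. r n < r (Suc n)" by blast
  have rmono: "strict_mono r" using rS by (simp add: strict_mono_Suc_iff)
  define \<Delta> where "\<Delta> = (\<lambda>n \<omega>. Z (r (Suc n)) \<omega> - Z (r n) \<omega>)"
  have [measurable]: "\<Delta> n \<in> borel_measurable M" for n unfolding \<Delta>_def by measurable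
  have "(\<integral>\<^sup>+\<omega>. (\<Sum>n. ennreal ((2 ^ n * norm (\<Delta> n \<omega>)) powr p)) \<partial>M) \<le> ennreal 2"
  proof -
    have le: "Lp_int p M (\<lambda>\<omega>. 2 ^ n * norm (\<Delta> n \<omega>)) \<le> ennreal ((1/2) ^ n)" for n
    proof -
      have "Lp_int p M (\<lambda>\<omega>. 2 ^ n * norm (\<Delta> n \<omega>)) = ennreal ((2 ^ n) powr p) * Lp_int p M (\<lambda>\<omega>. norm (\<Delta> n \<omega>))"
        by (subst nn_integral_cmult[symmetric]) (auto simp: powr_mult ennreal_mult)
      also have "\<dots> \<le> ennreal ((2 ^ n) powr p) * ennreal (((1/4::real) ^ n) powr p)"
        unfolding \<Delta>_def using rS[of n] by (intro mult_left_mono r) auto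
      also have "\<dots> = ennreal (((1/2) ^ n) powr p)"
        by (simp add: ennreal_mult[symmetric] powr_mult[symmetric] power_mult_distrib[symmetric])
      also have "\<dots> \<le> ennreal ((1/2) ^ n)"
      proof (intro ennreal_leI)
        have "((1/2::real) ^ n) powr p \<le> ((1/2) ^ n) powr 1" using p by (intro powr_mono') (auto intro: power_le_one)
        then show "((1/2::real) ^ n) powr p \<le> (1/2) ^ n" by simp
      qed
      finally show ?thesis .
    qed
    have "(\<integral>\<^sup>+\<omega>. (\<Sum>n. ennreal ((2 ^ n * norm (\<Delta> n \<omega>)) powr p)) \<partial>M) = (\<Sum>n. \<integral>\<^sup>+\<omega>. ennreal ((2 ^ n * norm (\<Delta> n \<omega>)) powr p) \<partial>M)"
      by (rule nn_integral_suminf) simp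
    also have "\<dots> \<le> (\<Sum>n. ennreal ((1/2) ^ n))" by (intro suminf_le le summableI)
    also have "\<dots> = ennreal 2"
      using geometric_sums[of "1/2::real"] by (intro suminf_ennreal_eq) auto
    finally show ?thesis .
  qed
  then have fin: "AE \<omega> in M. (\<Sum>n. ennreal ((2 ^ n * norm (\<Delta> n \<omega>)) powr p)) \<noteq> \<infinity>"
    by (intro nn_integral_PInf_AE) (auto simp: top_unique)
  define Y where "Y = (\<lambda>\<omega>. lim (\<lambda>n. Z (r n) \<omega>))"
  have [measurable]: "Y \<in> borel_measurable M" unfolding Y_def by measurable
  have conv: "AE \<omega> in M. (\<lambda>n. Z (r n) \<omega>) \<longlonglongrightarrow> Y \<omega>"
    using fin
  proof eventually_elim
    fix \<omega> assume "(\<Sum>n. ennreal ((2 ^ n * norm (\<Delta> n \<omega>)) powr p)) \<noteq> \<infinity>"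
    moreover have "\<exists>c\<ge>0. s = ennreal c" if "s \<noteq> \<infinity>" for s :: ennreal
      using that by (cases s) auto
    ultimately obtain c where c: "0 \<le> c" "(\<Sum>n. ennreal ((2 ^ n * norm (\<Delta> n \<omega>)) powr p)) = ennreal c"
      by blast
    have "norm (\<Delta> n \<omega>) \<le> (1 + c) * (1/2) ^ n" for n
    proof -
      have "ennreal ((2 ^ n * norm (\<Delta> n \<omega>)) powr p) \<le> ennreal c"
        using ennreal_le_suminf[of "\<lambda>n. ennreal ((2 ^ n * norm (\<Delta> n \<omega>)) powr p)" n] unfolding c(2) .
      then have "(2 ^ n * norm (\<Delta> n \<omega>)) powr p \<le> c" using c(1) by simp
      \<comment> \<open>s \<le> 1 + s^p passes from the bound on the p-th power to one on the norm
        without roots.\<close>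
      moreover have "2 ^ n * norm (\<Delta> n \<omega>) \<le> 1 + (2 ^ n * norm (\<Delta> n \<omega>)) powr p"
        using powr_mult_le_add[OF p, of 1 "2 ^ n * norm (\<Delta> n \<omega>)"] by simp
      ultimately have "2 ^ n * norm (\<Delta> n \<omega>) \<le> 1 + c" by simp
      then have "norm (\<Delta> n \<omega>) \<le> (1 + c) / 2 ^ n" by (simp add: pos_le_divide_eq mult.commute)
      then show ?thesis by (simp add: power_one_over)
    qed
    then have "summable (\<lambda>n. \<Delta> n \<omega>)" by (rule summable_geometric_bound)
    then have "convergent (\<lambda>n. (\<Sum>i<n. \<Delta> i \<omega>) + Z (r 0) \<omega>)"
      unfolding summable_iff_convergent by (intro convergent_add convergent_const)
    moreover have "(\<Sum>i<n. \<Delta> i \<omega>) + Z (r 0) \<omega> = Z (r n) \<omega>" for n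
      unfolding \<Delta>_def by (subst sum_lessThan_telescope) simp
    ultimately show "(\<lambda>n. Z (r n) \<omega>) \<longlonglongrightarrow> Y \<omega>" unfolding Y_def by (simp add: convergent_LIMSEQ_iff)
  qed
  have "\<exists>K. \<forall>k\<ge>K. Lp_int p M (\<lambda>\<omega>. norm (Z k \<omega> - Y \<omega>)) \<le> ennreal (\<delta> powr p)" if \<delta>: "0 < \<delta>" for \<delta>
  proof -
    obtain K where K: "\<forall>k\<ge>K. \<forall>l\<ge>K. Lp_int p M (\<lambda>\<omega>. norm (Z k \<omega> - Z l \<omega>)) \<le> ennreal (\<delta> powr p)"
      using cauchy[OF \<delta>] by blast
    have "Lp_int p M (\<lambda>\<omega>. norm (Z k \<omega> - Y \<omega>)) \<le> ennreal (\<delta> powr p)" if "K \<le> k" for k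
    proof -
      have "Lp_int p M (\<lambda>\<omega>. norm (Z k \<omega> - Y \<omega>))
          = (\<integral>\<^sup>+\<omega>. liminf (\<lambda>n. ennreal (norm (Z k \<omega> - Z (r n) \<omega>) powr p)) \<partial>M)"
      proof (rule nn_integral_cong_AE, use conv in eventually_elim)
        fix \<omega> assume lim: "(\<lambda>n. Z (r n) \<omega>) \<longlonglongrightarrow> Y \<omega>"
        have "(\<lambda>n. ennreal (norm (Z k \<omega> - Z (r n) \<omega>) powr p)) \<longlonglongrightarrow> ennreal (norm (Z k \<omega> - Y \<omega>) powr p)"
          by (intro tendsto_ennrealI tendsto_powr' tendsto_norm tendsto_diff tendsto_const lim) (use p in auto)
        then show "ennreal (norm (Z k \<omega> - Y \<omega>) powr p) = liminf (\<lambda>n. ennreal (norm (Z k \<omega> - Z (r n) \<omega>) powr p))"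
          by (intro lim_imp_Liminf[symmetric]) auto
      qed
      also have "\<dots> \<le> liminf (\<lambda>n. \<integral>\<^sup>+\<omega>. ennreal (norm (Z k \<omega> - Z (r n) \<omega>) powr p) \<partial>M)"
        by (rule nn_integral_liminf) simp
      also have "\<dots> \<le> limsup (\<lambda>n. \<integral>\<^sup>+\<omega>. ennreal (norm (Z k \<omega> - Z (r n) \<omega>) powr p) \<partial>M)"
        by (rule Liminf_le_Limsup) simp
      also have "\<dots> \<le> ennreal (\<delta> powr p)"
      proof (rule Limsup_bounded)
        show "\<forall>\<^sub>F n in sequentially. Lp_int p M (\<lambda>\<omega>. norm (Z k \<omega> - Z (r n) \<omega>)) \<le> ennreal (\<delta> powr p)"
          using eventually_ge_at_top[of K]
          by eventually_elim (use K \<open>K \<le> k\<close> seq_suble[OF rmono] order_trans in blast)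
      qed
      finally show ?thesis .
    qed
    then show ?thesis by blast
  qed
  then show ?thesis using \<open>Y \<in> borel_measurable M\<close> by blast
qed

text \<open>Codes lie in [0, 1/3], so their laws are tight, and Skorohod's theorem realises a
  subsequence by convergent random codes. The decoded variables \<open>Z k\<close> have the laws
  \<open>\<sigma> (r k)\<close>, and their nearest points at each fixed level eventually agree; with
  the smallness hypothesis they are Cauchy in L^p. The limiting code \<open>Y'\<close> need not be
  the code of a point, so the limit measure is taken as the law of the L^p limit.\<close>

lemma Wdist_convergent_subseq:
  fixes \<sigma> :: "nat \<Rightarrow> 'a::{banach,second_countable_topology} measure"
  assumes p: "1 \<le> p" and d: "\<And>x e. 0 < e \<Longrightarrow> \<exists>i. dist x (d i) < e"
    and \<sigma>: "\<And>k. \<sigma> k \<in> Pp p"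
    and small: "\<And>\<delta>. 0 < \<delta> \<Longrightarrow> \<exists>N. \<forall>k. Lp_int p (\<sigma> k) (hmin d N) \<le> ennreal (\<delta> powr p)"
  shows "\<exists>\<mu>\<in>Pp p. \<exists>r::nat \<Rightarrow> nat. strict_mono r \<and> (\<forall>\<delta>>0. \<exists>K. \<forall>k\<ge>K. Wdist p (\<sigma> (r k)) \<mu> \<le> \<delta>)"
proof -
  define \<nu> where "\<nu> = (\<lambda>k. distr (\<sigma> k) borel (encode d))"
  have em[measurable]: "encode d \<in> measurable (\<sigma> k) borel" for k
    using measurable_cong_sets[OF PpD(2)[OF \<sigma>] refl] encode_measurable by blast
  have rd: "real_distribution (\<nu> k)" for k
    unfolding \<nu>_def by (intro prob_space.real_distribution_distr PpD[OF \<sigma>] em)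
  have full: "measure (\<nu> n) {-1<..1} = 1" for n
  proof -
    interpret prob_space "\<sigma> n" by (rule PpD[OF \<sigma>])
    have "encode d x \<in> {-1<..1}" for x
      using bit_val_bounds[of "\<lambda>q. near_idx d (fst (prod_decode q)) x = snd (prod_decode q)"] by (simp add: encode_def)
    then have "encode d -` {-1<..1} \<inter> space (\<sigma> n) = space (\<sigma> n)" by auto
    then show ?thesis unfolding \<nu>_def by (subst measure_distr) (auto simp: prob_space)
  qed
  have "\<exists>a b::real. a < b \<and> (\<forall>n. measure (\<nu> n) {a<..b} > 1 - \<epsilon>)" if "0 < \<epsilon>" for \<epsilon>
    by (rule exI[of _ "-1"], rule exI[of _ 1]) (use that full in auto)
  then have "tight \<nu>" using rd unfolding tight_def by blast
  from tight_imp_convergent_subsubsequence[OF this strict_mono_id] obtain r M where r: "strict_mono (r :: nat \<Rightarrow> nat)"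
    and M: "real_distribution M" "weak_conv_m (\<nu> \<circ> id \<circ> r) M" by blast
  have "\<exists>(\<Omega> :: real measure) (Y :: nat \<Rightarrow> real \<Rightarrow> real) (Y' :: real \<Rightarrow> real).
      prob_space \<Omega> \<and> (\<forall>n. Y n \<in> measurable \<Omega> borel) \<and> (\<forall>n. distr \<Omega> borel (Y n) = (\<nu> \<circ> id \<circ> r) n) \<and>
      Y' \<in> measurable \<Omega> lborel \<and> distr \<Omega> borel Y' = M \<and> (\<forall>x\<in>space \<Omega>. (\<lambda>n. Y n x) \<longlonglongrightarrow> Y' x)"
    by (rule Skorohod[OF _ M]) (simp add: rd)
  then obtain \<Omega> :: "real measure" and Y :: "nat \<Rightarrow> real \<Rightarrow> real" and Y' :: "real \<Rightarrow> real" where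
    sk: "prob_space \<Omega> \<and> (\<forall>n. Y n \<in> measurable \<Omega> borel) \<and> (\<forall>n. distr \<Omega> borel (Y n) = (\<nu> \<circ> id \<circ> r) n) \<and>
      Y' \<in> measurable \<Omega> lborel \<and> distr \<Omega> borel Y' = M \<and> (\<forall>x\<in>space \<Omega>. (\<lambda>n. Y n x) \<longlonglongrightarrow> Y' x)"
    by (elim exE)
  from sk have ps: "prob_space \<Omega>" by blast
  from sk have Ym[measurable]: "Y n \<in> measurable \<Omega> borel" for n by blast
  from sk have YL: "distr \<Omega> borel (Y n) = \<nu> (r n)" for n by simp
  from sk have Yc: "(\<lambda>n. Y n x) \<longlonglongrightarrow> Y' x" if "x \<in> space \<Omega>" for x using that by blast
  interpret \<Omega>: prob_space \<Omega> by (rule ps)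
  define Z where "Z = (\<lambda>k \<omega>. decode d (Y k \<omega>))"
  have Zm[measurable]: "Z k \<in> borel_measurable \<Omega>" for k unfolding Z_def by measurable
  have ZL: "distr \<Omega> borel (Z k) = \<sigma> (r k)" for k
  proof -
    have "distr \<Omega> borel (Z k) = distr (distr \<Omega> borel (Y k)) borel (decode d)"
      unfolding Z_def by (subst distr_distr) (auto simp: o_def)
    also have "\<dots> = distr (\<sigma> (r k)) borel (\<lambda>x. decode d (encode d x))"
      unfolding YL \<nu>_def by (subst distr_distr) (auto simp: o_def)
    also have "\<dots> = \<sigma> (r k)" using PpD(2)[OF \<sigma>] by (simp add: decode_encode[OF d] distr_id2)
    finally show ?thesis .
  qed
  \<comment> \<open>The law of \<open>Y k\<close> is an image under \<open>encode\<close>, so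
    \<open>Y k\<close> is almost surely a code and decoding loses nothing.\<close>
  have enc: "AE \<omega> in \<Omega>. \<forall>k. encode d (Z k \<omega>) = Y k \<omega>"
    unfolding AE_all_countable
  proof
    fix k
    have "AE y in distr (\<sigma> (r k)) borel (encode d). encode d (decode d y) = y"
      by (subst AE_distr_iff) (auto simp: decode_encode[OF d])
    then have "AE y in distr \<Omega> borel (Y k). encode d (decode d y) = y" unfolding YL \<nu>_def .
    then show "AE \<omega> in \<Omega>. encode d (Z k \<omega>) = Y k \<omega>"
      unfolding Z_def by (subst (asm) AE_distr_iff) auto
  qed
  define G where "G = (\<lambda>N K. {\<omega>\<in>space \<Omega>. \<forall>k\<ge>K. \<forall>l\<ge>K. near_idx d N (Z k \<omega>) = near_idx d N (Z l \<omega>)})"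
  have ni: "(\<lambda>\<omega>. near_idx d N (Z k \<omega>)) \<in> measurable \<Omega> (count_space UNIV)" for N k
    by (rule measurable_compose[OF Zm near_idx_measurable])
  have Gm[measurable]: "G N K \<in> sets \<Omega>" for N K
  proof -
    have "G N K = (\<Inter>k\<in>{K..}. \<Inter>l\<in>{K..}. {\<omega>\<in>space \<Omega>. near_idx d N (Z k \<omega>) = near_idx d N (Z l \<omega>)})"
      unfolding G_def by auto
    also have "\<dots> \<in> sets \<Omega>"
      by (intro sets.countable_INT' sets_Collect_eq_nat ni image_subsetI) auto
    finally show ?thesis .
  qed
  have G_lim: "(\<lambda>K. measure \<Omega> (space \<Omega> - G N K)) \<longlonglongrightarrow> 0" for N
  proof -
    have "AE \<omega> in \<Omega>. \<omega> \<in> (\<Union>K. G N K)"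
      using enc
    proof (rule AE_mp, intro AE_I2 impI)
      fix \<omega> assume \<omega>: "\<omega> \<in> space \<Omega>" "\<forall>k. encode d (Z k \<omega>) = Y k \<omega>"
      have "Cauchy (\<lambda>k. Y k \<omega>)" using Yc[OF \<omega>(1)] by (rule LIMSEQ_imp_Cauchy)
      \<comment> \<open>The tolerance in \<open>encode_close\<close> depends on the nearest index;
        at level \<open>N\<close> this index is at most \<open>N\<close>, so a common positive
        tolerance exists.\<close>
      have "\<exists>e>0. \<forall>i\<le>N. e \<le> 1 / (6 * 4 ^ prod_encode (N, i) :: real)"
        by (intro exI[of _ "Min ((\<lambda>i. 1 / (6 * 4 ^ prod_encode (N, i))) ` {..N})"]) auto
      then obtain e where e: "e > 0" "\<And>i. i \<le> N \<Longrightarrow> e \<le> 1 / (6 * 4 ^ prod_encode (N, i) :: real)" by blast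
      obtain K where K: "\<And>k l. k \<ge> K \<Longrightarrow> l \<ge> K \<Longrightarrow> \<bar>Y k \<omega> - Y l \<omega>\<bar> < e"
        using CauchyD[OF \<open>Cauchy _\<close> e(1)] by auto
      have "near_idx d N (Z k \<omega>) = near_idx d N (Z l \<omega>)" if "k \<ge> K" "l \<ge> K" for k l
      proof (rule encode_close)
        show "\<bar>encode d (Z k \<omega>) - encode d (Z l \<omega>)\<bar> < 1 / (6 * 4 ^ prod_encode (N, near_idx d N (Z k \<omega>)))"
          using K[OF that] \<omega>(2) e(2)[OF near_idx(2), of d "Z k \<omega>"] by simp
      qed
      then show "\<omega> \<in> (\<Union>K. G N K)" using \<omega>(1) by (auto simp: G_def)
    qed
    then have "measure \<Omega> (\<Union>K. G N K) = 1" by (subst \<Omega>.prob_eq_1) (auto intro!: sets.countable_UN)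
    moreover have "(\<lambda>K. measure \<Omega> (G N K)) \<longlonglongrightarrow> measure \<Omega> (\<Union>K. G N K)"
    proof (rule \<Omega>.finite_Lim_measure_incseq)
      show "incseq (G N)"
      proof (rule incseq_SucI, rule subsetI)
        fix K \<omega> assume "\<omega> \<in> G N K"
        then have "\<omega> \<in> space \<Omega> \<and> (\<forall>k\<ge>K. \<forall>l\<ge>K. near_idx d N (Z k \<omega>) = near_idx d N (Z l \<omega>))"
          unfolding G_def by (rule CollectD)
        note sp = conjunct1[OF this] and eq = conjunct2[OF this]
        show "\<omega> \<in> G N (Suc K)"
          unfolding G_def by (intro CollectI conjI sp allI impI eq[rule_format]) (erule Suc_leD)+
      qed
      show "range (G N) \<subseteq> sets \<Omega>" using Gm by blast
    qed
    ultimately have "(\<lambda>K. 1 - measure \<Omega> (G N K)) \<longlonglongrightarrow> 1 - 1" by (intro tendsto_intros) auto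
    then show ?thesis by (simp add: \<Omega>.prob_compl)
  qed
  have hminZ: "Lp_int p \<Omega> (\<lambda>\<omega>. hmin d N (Z k \<omega>)) = Lp_int p (\<sigma> (r k)) (hmin d N)" for N k
    unfolding ZL[symmetric] by (subst nn_integral_distr) auto
  have cauchy: "\<exists>K. \<forall>k\<ge>K. \<forall>l\<ge>K. Lp_int p \<Omega> (\<lambda>\<omega>. norm (Z k \<omega> - Z l \<omega>)) \<le> ennreal (\<delta> powr p)" if \<delta>: "0 < \<delta>" for \<delta>
  proof -
    obtain N where N: "\<And>k. Lp_int p (\<sigma> k) (hmin d N) \<le> ennreal ((\<delta>/3) powr p)"
      using small[of "\<delta>/3"] \<delta> by auto
    \<comment> \<open>Bounds the distance of any two of the points \<open>d 0, ..., d N\<close>; the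
      summand 1 keeps it positive for the division below.\<close>
    define R where "R = 1 + 2 * (\<Sum>i\<le>N. norm (d i))"
    have R: "norm (d i - d j) \<le> R" if "i \<le> N" "j \<le> N" for i j
    proof -
      have "norm (d k) \<le> (\<Sum>i\<le>N. norm (d i))" if "k \<le> N" for k using that by (intro member_le_sum) auto
      from this[OF that(1)] this[OF that(2)] show ?thesis using norm_triangle_ineq4[of "d i" "d j"] by (simp add: R_def)
    qed
    have R0: "0 < R" unfolding R_def by (intro add_pos_nonneg mult_nonneg_nonneg sum_nonneg) auto
    have "\<forall>\<^sub>F K in sequentially. measure \<Omega> (space \<Omega> - G N K) < (\<delta>/3) powr p / R powr p"
      by (rule order_tendstoD(2)[OF G_lim]) (use \<delta> R0 in simp)
    then obtain K where K: "measure \<Omega> (space \<Omega> - G N K) < (\<delta>/3) powr p / R powr p"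
      unfolding eventually_sequentially by blast
    have "Lp_int p \<Omega> (\<lambda>\<omega>. norm (Z k \<omega> - Z l \<omega>)) \<le> ennreal (\<delta> powr p)" if kl: "k \<ge> K" "l \<ge> K" for k l
    proof -
      \<comment> \<open>Both variables are close in L^p to their nearest points at level
        \<open>N\<close>. These points coincide on \<open>G N K\<close> and otherwise differ by at
        most \<open>R\<close>, on an event too small to contribute more than \<delta>/3.\<close>
      let ?D = "\<lambda>\<omega>. R * indicator (space \<Omega> - G N K) \<omega>"
      have "Lp_int p \<Omega> (\<lambda>\<omega>. norm (Z k \<omega> - Z l \<omega>))
          \<le> Lp_int p \<Omega> (\<lambda>\<omega>. hmin d N (Z k \<omega>) + (hmin d N (Z l \<omega>) + ?D \<omega>))"
      proof (intro nn_integral_mono ennreal_leI powr_mono2)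
        fix \<omega> assume \<omega>: "\<omega> \<in> space \<Omega>"
        let ?i = "near_idx d N (Z k \<omega>)" and ?j = "near_idx d N (Z l \<omega>)"
        have D: "norm (d ?i - d ?j) \<le> ?D \<omega>"
        proof (cases "\<omega> \<in> G N K")
          case True
          then have "?i = ?j" using kl unfolding G_def by blast
          then show ?thesis using True by simp
        qed (use \<omega> R[OF near_idx(2)[of d N "Z k \<omega>"] near_idx(2)[of d N "Z l \<omega>"]] in simp)
        have tri: "norm (Z k \<omega> - Z l \<omega>) \<le> norm (Z k \<omega> - a) + (norm (b - Z l \<omega>) + norm (a - b))" for a b
          using norm_triangle_ineq[of "Z k \<omega> - a" "a - Z l \<omega>"] norm_triangle_ineq[of "b - Z l \<omega>" "a - b"] by simp
        show "norm (Z k \<omega> - Z l \<omega>) \<le> hmin d N (Z k \<omega>) + (hmin d N (Z l \<omega>) + ?D \<omega>)"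
          using tri[of "d ?i" "d ?j"] D near_idx(1)[of "Z k \<omega>" d N] near_idx(1)[of "Z l \<omega>" d N]
          unfolding norm_minus_commute[of "d ?j" "Z l \<omega>"] by linarith
      qed (use p in auto)
      also have "\<dots> \<le> ennreal ((\<delta>/3 + (\<delta>/3 + \<delta>/3)) powr p)"
      proof (rule nn_integral_Minkowski[OF p])
        show "Lp_int p \<Omega> (\<lambda>\<omega>. hmin d N (Z l \<omega>) + ?D \<omega>) \<le> ennreal ((\<delta>/3 + \<delta>/3) powr p)"
        proof (rule nn_integral_Minkowski[OF p])
          have "Lp_int p \<Omega> (\<lambda>\<omega>. ?D \<omega>) = (\<integral>\<^sup>+\<omega>. ennreal (R powr p) * indicator (space \<Omega> - G N K) \<omega> \<partial>\<Omega>)"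
            using p by (intro nn_integral_cong) (auto simp: indicator_def)
          also have "\<dots> = ennreal (R powr p * measure \<Omega> (space \<Omega> - G N K))"
            by (subst nn_integral_cmult_indicator) (auto simp: \<Omega>.emeasure_eq_measure ennreal_mult)
          also have "\<dots> \<le> ennreal ((\<delta>/3) powr p)"
            using K R0 by (intro ennreal_leI) (simp add: field_simps)
          finally show "Lp_int p \<Omega> (\<lambda>\<omega>. ?D \<omega>) \<le> ennreal ((\<delta>/3) powr p)" .
        qed (use \<delta> R0 N hmin_nonneg hminZ in auto)
      qed (use \<delta> R0 N hmin_nonneg hminZ in \<open>auto intro!: add_nonneg_nonneg\<close>)
      finally show ?thesis by simp
    qed
    then show ?thesis by blast
  qed
  obtain V where V[measurable]: "V \<in> borel_measurable \<Omega>"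
    and lim: "\<And>\<delta>. 0 < \<delta> \<Longrightarrow> \<exists>K. \<forall>k\<ge>K. Lp_int p \<Omega> (\<lambda>\<omega>. norm (Z k \<omega> - V \<omega>)) \<le> ennreal (\<delta> powr p)"
    using Lp_complete[OF p Zm cauchy] by blast
  define \<mu> where "\<mu> = distr \<Omega> borel V"
  have "\<mu> \<in> Pp p"
  proof -
    \<comment> \<open>One variable within L^p distance 1 of \<open>V\<close> passes its finite p-th
      moment on to \<open>V\<close>.\<close>
    obtain K where K: "Lp_int p \<Omega> (\<lambda>\<omega>. norm (Z K \<omega> - V \<omega>)) \<le> ennreal (1 powr p)"
      using lim[of 1] by auto
    obtain a where a: "0 \<le> a" "Lp_int p (\<sigma> (r K)) norm = ennreal (a powr p)"
      using Pp_moment[OF \<sigma> p] .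
    have "Lp_int p \<Omega> (\<lambda>\<omega>. norm (V \<omega>)) \<le> Lp_int p \<Omega> (\<lambda>\<omega>. norm (Z K \<omega> - V \<omega>) + norm (Z K \<omega>))"
      using p norm_triangle_sub by (intro nn_integral_mono ennreal_leI powr_mono2) (auto simp: norm_minus_commute add.commute)
    also have "\<dots> \<le> ennreal ((1 + a) powr p)"
    proof (rule nn_integral_Minkowski[OF p])
      show "Lp_int p \<Omega> (\<lambda>\<omega>. norm (Z K \<omega>)) \<le> ennreal (a powr p)"
        using a(2) unfolding ZL[symmetric] by (subst (asm) nn_integral_distr) auto
    qed (use a K in auto)
    finally have "Lp_int p \<Omega> (\<lambda>\<omega>. norm (V \<omega>)) < \<infinity>" by (simp add: le_less_trans)
    then show ?thesis unfolding Pp_def \<mu>_def by (auto simp: nn_integral_distr intro!: \<Omega>.prob_space_distr)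
  qed
  moreover have "\<exists>K. \<forall>k\<ge>K. Wdist p (\<sigma> (r k)) \<mu> \<le> \<delta>" if \<delta>: "0 < \<delta>" for \<delta>
  proof -
    obtain K where "\<forall>k\<ge>K. Lp_int p \<Omega> (\<lambda>\<omega>. norm (Z k \<omega> - V \<omega>)) \<le> ennreal (\<delta> powr p)"
      using lim[OF \<delta>] by blast
    then have "Wdist p (\<sigma> (r k)) \<mu> \<le> \<delta>" if "k \<ge> K" for k
      unfolding ZL[symmetric] \<mu>_def using that \<delta> by (intro Wdist_distr_le[OF ps Zm V p]) auto
    then show ?thesis by blast
  qed
  ultimately show ?thesis using r by blast
qed

section \<open>Dirichlet forms\<close>

lemma L2_measurable: "f \<in> L2 N \<Longrightarrow> f \<in> borel_measurable N"
  and L2_integrable: "f \<in> L2 N \<Longrightarrow> integrable N (\<lambda>x. (f x)\<^sup>2)"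
  by (auto simp: L2_def)

lemma L2_mult:
  assumes "f \<in> L2 N" "g \<in> L2 N"
  shows "integrable N (\<lambda>x. f x * g x)"
proof (rule Bochner_Integration.integrable_bound)
  note [measurable] = L2_measurable[OF assms(1)] L2_measurable[OF assms(2)]
  show "integrable N (\<lambda>x. (f x)\<^sup>2 + (g x)\<^sup>2)" using assms by (auto simp: L2_def)
  have "\<bar>a * b\<bar> \<le> a\<^sup>2 + b\<^sup>2" for a b :: real
    using sum_squares_bound[of "\<bar>a\<bar>" "\<bar>b\<bar>"] mult_nonneg_nonneg[of "\<bar>a\<bar>" "\<bar>b\<bar>"]
    unfolding abs_mult power2_abs by linarith
  then show "AE x in N. norm (f x * g x) \<le> norm ((f x)\<^sup>2 + (g x)\<^sup>2)" by simp
  show "(\<lambda>x. f x * g x) \<in> borel_measurable N" by measurable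
qed

lemma L2_diff:
  assumes "f \<in> L2 N" "g \<in> L2 N"
  shows "(\<lambda>x. f x - g x) \<in> L2 N"
proof -
  note [measurable] = L2_measurable[OF assms(1)] L2_measurable[OF assms(2)]
  have "integrable N (\<lambda>x. (f x)\<^sup>2 + (g x)\<^sup>2 - 2 * (f x * g x))"
    using L2_mult[OF assms] assms by (auto simp: L2_def)
  then have "integrable N (\<lambda>x. (f x - g x)\<^sup>2)" by (simp add: power2_diff algebra_simps)
  then show ?thesis by (simp add: L2_def)
qed

lemma L2_dist_midpoint:
  assumes "f \<in> L2 N" "g \<in> L2 N" "h \<in> L2 N"
  shows "(\<integral>x. ((f x + g x) / 2 - h x)\<^sup>2 \<partial>N) \<le> ((\<integral>x. (f x - h x)\<^sup>2 \<partial>N) + (\<integral>x. (g x - h x)\<^sup>2 \<partial>N)) / 2"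
proof -
  note i = L2_integrable[OF L2_diff[OF assms(1,3)]] L2_integrable[OF L2_diff[OF assms(2,3)]]
  note [measurable] = assms[THEN L2_measurable]
  have le: "((a + b) / 2 - c)\<^sup>2 \<le> ((a - c)\<^sup>2 + (b - c)\<^sup>2) / 2" for a b c :: real
  proof -
    have "((a - c)\<^sup>2 + (b - c)\<^sup>2) / 2 - ((a + b) / 2 - c)\<^sup>2 = ((a - b) / 2)\<^sup>2"
      by (simp add: power2_eq_square field_simps)
    then show ?thesis by (smt (verit) zero_le_power2)
  qed
  have "(\<integral>x. ((f x + g x) / 2 - h x)\<^sup>2 \<partial>N) \<le> (\<integral>x. ((f x - h x)\<^sup>2 + (g x - h x)\<^sup>2) / 2 \<partial>N)"
    by (rule integral_mono', use i le in auto)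
  then show ?thesis using i by simp
qed

definition en :: "'b measure \<Rightarrow> (('b \<Rightarrow> real) \<Rightarrow> ('b \<Rightarrow> real) \<Rightarrow> real) \<Rightarrow> ('b \<Rightarrow> real) \<Rightarrow> real" where
  "en M E f = E1 M E f f"

text \<open>These are convex combinations with dyadic weights of the tail from index
  \<open>n\<close>. The parallelogram law asks for closure under midpoints only, and every property
  stable under midpoints passes to the hull by rule induction.\<close>

inductive_set mid_hull :: "(nat \<Rightarrow> 'b \<Rightarrow> real) \<Rightarrow> nat \<Rightarrow> ('b \<Rightarrow> real) set" for u n where
  base: "n \<le> k \<Longrightarrow> u k \<in> mid_hull u n"
| mid: "a \<in> mid_hull u n \<Longrightarrow> b \<in> mid_hull u n \<Longrightarrow> (\<lambda>x. (a x + b x) / 2) \<in> mid_hull u n"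

lemma mid_hull_mono: "a \<in> mid_hull u n \<Longrightarrow> m \<le> n \<Longrightarrow> a \<in> mid_hull u m"
  by (induction rule: mid_hull.induct) (auto intro: mid_hull.intros)

section \<open>The form norm as a Hilbert space norm\<close>

context
  fixes M :: "'b measure" and D :: "('b \<Rightarrow> real) set" and E :: "('b \<Rightarrow> real) \<Rightarrow> ('b \<Rightarrow> real) \<Rightarrow> real"
  assumes form: "symmetric_dirichlet_form M D E"
begin

lemma form_parts:
  "D \<subseteq> L2 M" "(\<lambda>_. 0) \<in> D"
  "\<forall>f\<in>D. \<forall>g\<in>D. (\<lambda>x. f x + g x) \<in> D"
  "\<forall>c. \<forall>f\<in>D. (\<lambda>x. c * f x) \<in> D"
  "\<forall>f\<in>D. \<forall>g\<in>L2 M. (AE x in M. f x = g x) \<longrightarrow> g \<in> D \<and> (\<forall>h\<in>D. E f h = E g h \<and> E h f = E h g)"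
  "\<forall>f\<in>D. \<forall>g\<in>D. E f g = E g f"
  "\<forall>f\<in>D. \<forall>g\<in>D. \<forall>h\<in>D. E (\<lambda>x. f x + g x) h = E f h + E g h"
  "\<forall>c. \<forall>f\<in>D. \<forall>g\<in>D. E (\<lambda>x. c * f x) g = c * E f g"
  "\<forall>f\<in>D. 0 \<le> E f f"
  by (insert form, unfold symmetric_dirichlet_form_def, (elim conjE, assumption)+)

lemmas form_zero = form_parts(2)
  and form_add = form_parts(3)[rule_format]
  and form_scale = form_parts(4)[rule_format]
  and form_sym = form_parts(6)[rule_format]
  and form_add_left = form_parts(7)[rule_format]
  and form_scale_left = form_parts(8)[rule_format]
  and form_nonneg = form_parts(9)[rule_format]
  and form_L2 = subsetD[OF form_parts(1)]

lemma form_AE: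
  assumes "f \<in> D" "g \<in> L2 M" "AE x in M. f x = g x"
  shows "g \<in> D" "h \<in> D \<Longrightarrow> E f h = E g h" "h \<in> D \<Longrightarrow> E h f = E h g"
  using form_parts(5)[rule_format, OF assms] by blast+

lemma form_complete:
  assumes "\<And>n. u n \<in> D" "\<And>\<epsilon>. \<epsilon> > 0 \<Longrightarrow> \<exists>N. \<forall>m\<ge>N. \<forall>n\<ge>N. E1 M E (\<lambda>x. u m x - u n x) (\<lambda>x. u m x - u n x) < \<epsilon>"
  shows "\<exists>f\<in>D. (\<lambda>n. E1 M E (\<lambda>x. u n x - f x) (\<lambda>x. u n x - f x)) \<longlonglongrightarrow> 0"
proof -
  have "\<forall>u::nat \<Rightarrow> 'b \<Rightarrow> real. (\<forall>n. u n \<in> D) \<and>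
        (\<forall>\<epsilon>>0. \<exists>N. \<forall>m\<ge>N. \<forall>n\<ge>N. E1 M E (\<lambda>x. u m x - u n x) (\<lambda>x. u m x - u n x) < \<epsilon>) \<longrightarrow>
        (\<exists>f\<in>D. (\<lambda>n. E1 M E (\<lambda>x. u n x - f x) (\<lambda>x. u n x - f x)) \<longlonglongrightarrow> 0)"
    using form unfolding symmetric_dirichlet_form_def by (elim conjE)
  then show ?thesis using assms by blast
qed

lemma form_diff: "f \<in> D \<Longrightarrow> g \<in> D \<Longrightarrow> (\<lambda>x. f x - g x) \<in> D"
  using form_add[of f "\<lambda>x. (-1) * g x"] form_scale[of g "-1"] by simp

lemma en_eq: "en M E f = (\<integral>x. (f x)\<^sup>2 \<partial>M) + E f f"
  by (simp add: en_def E1_def power2_eq_square)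

lemma en_nonneg: "f \<in> D \<Longrightarrow> 0 \<le> en M E f"
  unfolding en_eq by (intro add_nonneg_nonneg form_nonneg) auto

lemma en_add:
  assumes "f \<in> D" "g \<in> D"
  shows "en M E (\<lambda>x. f x + g x) = en M E f + en M E g + 2 * E1 M E f g"
proof -
  note l = form_L2[OF assms(1)] form_L2[OF assms(2)]
  have "(\<integral>x. (f x + g x)\<^sup>2 \<partial>M) = (\<integral>x. (f x)\<^sup>2 + (g x)\<^sup>2 + 2 * (f x * g x) \<partial>M)"
    by (simp add: power2_sum algebra_simps)
  also have "\<dots> = (\<integral>x. (f x)\<^sup>2 \<partial>M) + (\<integral>x. (g x)\<^sup>2 \<partial>M) + 2 * (\<integral>x. f x * g x \<partial>M)"
    using L2_mult[OF l] l[THEN L2_integrable] by simp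
  finally have 1: "(\<integral>x. (f x + g x)\<^sup>2 \<partial>M) = \<dots>" .
  have "E (\<lambda>x. f x + g x) (\<lambda>x. f x + g x) = E f f + E g g + 2 * E f g"
    using assms form_add[OF assms] form_add_left[OF assms form_add[OF assms]]
      form_sym[of f "\<lambda>x. f x + g x"] form_sym[of g "\<lambda>x. f x + g x"]
      form_add_left[OF assms assms(1)] form_add_left[OF assms assms(2)] form_sym[OF assms] by simp
  then show ?thesis unfolding en_eq 1 by (simp add: E1_def)
qed

lemma en_scale:
  assumes "f \<in> D"
  shows "en M E (\<lambda>x. c * f x) = c\<^sup>2 * en M E f"
proof -
  note cf = form_scale[OF assms, of c]
  have "(\<integral>x. (c * f x)\<^sup>2 \<partial>M) = c\<^sup>2 * (\<integral>x. (f x)\<^sup>2 \<partial>M)" by (simp add: power_mult_distrib)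
  moreover have "E (\<lambda>x. c * f x) (\<lambda>x. c * f x) = c\<^sup>2 * E f f"
    using form_scale_left[OF assms cf, of c] form_scale_left[OF assms assms, of c] form_sym[OF assms cf]
    by (simp add: power2_eq_square)
  ultimately show ?thesis by (simp add: en_eq distrib_left)
qed

lemma en_parallelogram:
  assumes "f \<in> D" "g \<in> D"
  shows "en M E (\<lambda>x. f x - g x) = 2 * en M E f + 2 * en M E g - 4 * en M E (\<lambda>x. (f x + g x) / 2)"
proof -
  have g: "(\<lambda>x. (-1) * g x) \<in> D" by (rule form_scale[OF assms(2)])
  have "E1 M E f (\<lambda>x. (-1) * g x) = - E1 M E f g"
    using form_scale_left[OF assms(2,1), of "-1"] form_sym[OF assms(1) g] form_sym[OF assms] by (simp add: E1_def)
  then have "en M E (\<lambda>x. f x - g x) = en M E f + en M E g - 2 * E1 M E f g"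
    using en_add[OF assms(1) g] en_scale[OF assms(2), of "-1"] by simp
  moreover have "en M E (\<lambda>x. (f x + g x) / 2) = (en M E f + en M E g + 2 * E1 M E f g) / 4"
    using en_scale[OF form_add[OF assms], of "1/2"] en_add[OF assms] by (simp add: power2_eq_square)
  ultimately show ?thesis by simp
qed

lemma form_midpoint: "f \<in> D \<Longrightarrow> g \<in> D \<Longrightarrow> (\<lambda>x. (f x + g x) / 2) \<in> D"
  using form_scale[OF form_add, of f g "1/2"] by simp

lemma en_midpoint_le:
  assumes "f \<in> D" "g \<in> D"
  shows "en M E (\<lambda>x. (f x + g x) / 2) \<le> (en M E f + en M E g) / 2"
  using en_parallelogram[OF assms] en_nonneg[OF form_diff[OF assms]] by simp

text \<open>The triangle inequality in squared form; the factor 2 is the price for avoiding square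
  roots.\<close>

lemma en_add_le:
  assumes "f \<in> D" "g \<in> D"
  shows "en M E (\<lambda>x. f x + g x) \<le> 2 * en M E f + 2 * en M E g"
proof -
  have "(\<lambda>x. 2 * ((f x + g x) / 2)) = (\<lambda>x. f x + g x)" by auto
  then show ?thesis using en_midpoint_le[OF assms] en_scale[OF form_midpoint[OF assms], of 2] by simp
qed

lemma en_diff_le:
  assumes "f \<in> D" "g \<in> D"
  shows "en M E f \<le> 2 * en M E g + 2 * en M E (\<lambda>x. g x - f x)"
proof -
  have "en M E (\<lambda>x. g x - f x) = en M E (\<lambda>x. f x - g x)"
    using en_scale[OF form_diff[OF assms], of "-1"] by simp
  then show ?thesis using en_add_le[OF assms(2) form_diff[OF assms]] by simp
qed

lemma L2_norm_le_en: "f \<in> D \<Longrightarrow> (\<integral>x. (f x)\<^sup>2 \<partial>M) \<le> en M E f"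
  using form_nonneg[of f] by (simp add: en_eq)

text \<open>The weak-compactness argument in the Hilbert space \<open>(D, E1)\<close>, made elementary: near-minimisers of the
  energy over the tails' midpoint hulls form a Cauchy sequence by the parallelogram law.\<close>

lemma form_Banach_Saks:
  assumes u: "\<And>k. u k \<in> D" and B: "\<And>k. en M E (u k) \<le> B" and f: "f \<in> L2 M"
    and lim: "(\<lambda>k. \<integral>x. (u k x - f x)\<^sup>2 \<partial>M) \<longlonglongrightarrow> 0"
  shows "f \<in> D \<and> en M E f \<le> 2 * B \<and> (\<exists>v. (\<forall>n. v n \<in> mid_hull u n) \<and> (\<lambda>n. en M E (\<lambda>x. v n x - f x)) \<longlonglongrightarrow> 0)"
proof -
  have hullD: "a \<in> D" if "a \<in> mid_hull u n" for a n
    using that by (induction rule: mid_hull.induct) (auto intro: u form_midpoint)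
  have hullB: "en M E a \<le> B" if "a \<in> mid_hull u n" for a n
    using that
  proof (induction rule: mid_hull.induct)
    case (mid a b)
    then show ?case using en_midpoint_le[of a b] hullD by fastforce
  qed (rule B)
  have hullf: "(\<integral>x. (a x - f x)\<^sup>2 \<partial>M) \<le> d" if "a \<in> mid_hull u n" "\<And>k. k \<ge> n \<Longrightarrow> (\<integral>x. (u k x - f x)\<^sup>2 \<partial>M) \<le> d" for a n d
    using that(1)
  proof (induction rule: mid_hull.induct)
    case (mid a b)
    then show ?case using L2_dist_midpoint[OF form_L2 form_L2 f, of a b] hullD[OF mid(1)] hullD[OF mid(2)] by simp
  qed (use that(2) in auto)
  define s where "s = (\<lambda>n. INF a\<in>mid_hull u n. en M E a)"
  have ne: "mid_hull u n \<noteq> {}" for n using mid_hull.base[of n n u] by auto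
  have bdd: "bdd_below (en M E ` mid_hull u n)" for n
    by (intro bdd_belowI2[of _ 0]) (use en_nonneg hullD in blast)
  have s_le: "s n \<le> en M E a" if "a \<in> mid_hull u n" for a n
    unfolding s_def by (rule cINF_lower[OF bdd that])
  have "incseq s"
    unfolding incseq_def s_def by (intro allI impI cINF_superset_mono ne bdd) (auto intro: mid_hull_mono)
  moreover have "s n \<le> B" for n using s_le[OF mid_hull.base[OF order_refl]] B order_trans by blast
  ultimately obtain S where S: "s \<longlonglongrightarrow> S" "\<And>n. s n \<le> S" using incseq_convergent[of s B] by auto
  have "\<exists>a\<in>mid_hull u n. en M E a < s n + 1 / Suc n" for n
    using cINF_less_iff[OF ne bdd, of n "s n + 1 / Suc n"] by (simp add: s_def)
  then obtain v where v: "\<And>n. v n \<in> mid_hull u n" "\<And>n. en M E (v n) < s n + 1 / Suc n" by metis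
  note vD = hullD[OF v(1)]
  \<comment> \<open>The midpoint stays in the hull of the tail from \<open>N\<close>, so its energy
    is at least \<open>s N\<close>, whereas the two energies are at most
    \<open>S + 1 / Suc N\<close>; the parallelogram law compares them.\<close>
  have cauchy: "en M E (\<lambda>x. v m x - v n x) \<le> 4 * (S - s N) + 4 / Suc N" if "N \<le> m" "N \<le> n" for m n N
  proof -
    have "(\<lambda>x. (v m x + v n x) / 2) \<in> mid_hull u N"
      using that v(1) by (intro mid_hull.mid) (auto intro: mid_hull_mono)
    then have "s N \<le> en M E (\<lambda>x. (v m x + v n x) / 2)" by (rule s_le)
    moreover have "1 / Suc m \<le> 1 / Suc N" "1 / Suc n \<le> 1 / Suc N" using that by (auto simp: frac_le)
    then have "en M E (v m) \<le> S + 1 / Suc N" "en M E (v n) \<le> S + 1 / Suc N"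
      using v(2)[of m] v(2)[of n] S(2)[of m] S(2)[of n] by linarith+
    ultimately show ?thesis unfolding en_parallelogram[OF vD vD] by simp
  qed
  have "\<exists>g\<in>D. (\<lambda>n. en M E (\<lambda>x. v n x - g x)) \<longlonglongrightarrow> 0"
    unfolding en_def
  proof (rule form_complete[OF vD])
    fix e :: real assume "e > 0"
    have "(\<lambda>N. 4 * (S - s N) + 4 / Suc N) \<longlonglongrightarrow> 4 * (S - S) + 0"
      by (intro tendsto_intros S lim_const_over_n[THEN LIMSEQ_Suc])
    then obtain N where "4 * (S - s N) + 4 / Suc N < e"
      using order_tendstoD(2)[of _ "0::real" sequentially e] \<open>e > 0\<close> eventually_sequentially by (metis (no_types, lifting) add_0_right cancel_comm_monoid_add_class.diff_cancel mult_zero_right order_refl)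
    then show "\<exists>N. \<forall>m\<ge>N. \<forall>n\<ge>N. E1 M E (\<lambda>x. v m x - v n x) (\<lambda>x. v m x - v n x) < e"
      using cauchy unfolding en_def by (meson order.strict_trans1)
  qed
  then obtain g where g: "g \<in> D" "(\<lambda>n. en M E (\<lambda>x. v n x - g x)) \<longlonglongrightarrow> 0" by blast
  have vg: "(\<lambda>n. \<integral>x. (v n x - g x)\<^sup>2 \<partial>M) \<longlonglongrightarrow> 0"
    using L2_norm_le_en[OF form_diff[OF vD g(1)]]
    by (intro tendsto_sandwich[OF _ _ tendsto_const g(2)]) auto
  have vf: "(\<lambda>n. \<integral>x. (v n x - f x)\<^sup>2 \<partial>M) \<longlonglongrightarrow> 0"
  proof (rule LIMSEQ_I)
    fix r :: real assume r: "r > 0"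
    then obtain N where N: "\<And>k. k \<ge> N \<Longrightarrow> (\<integral>x. (u k x - f x)\<^sup>2 \<partial>M) < r/2"
      using LIMSEQ_D[OF lim, of "r/2"] by auto
    have "(\<integral>x. (v n x - f x)\<^sup>2 \<partial>M) \<le> r/2" if "n \<ge> N" for n
      using that N by (intro hullf[OF v(1)[of n]] less_imp_le) auto
    then show "\<exists>no. \<forall>n\<ge>no. norm ((\<integral>x. (v n x - f x)\<^sup>2 \<partial>M) - 0) < r" using r by (intro exI[of _ N]) fastforce
  qed
  \<comment> \<open>Completeness provides some limit \<open>g\<close> in the domain. Convergence in
    \<open>E1\<close> implies convergence in L^2, where the limit is \<open>f\<close>, and the
    domain is closed under modification on null sets.\<close>
  have gf: "AE x in M. g x = f x"
  proof -
    note [measurable] = L2_measurable[OF f] L2_measurable[OF form_L2[OF g(1)]]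
    have le: "(\<integral>x. (g x - f x)\<^sup>2 \<partial>M) \<le> 2 * (\<integral>x. (v n x - g x)\<^sup>2 \<partial>M) + 2 * (\<integral>x. (v n x - f x)\<^sup>2 \<partial>M)" for n
    proof -
      note i = L2_integrable[OF L2_diff[OF form_L2[OF vD] f], of n] L2_integrable[OF L2_diff[OF form_L2[OF vD] form_L2[OF g(1)]], of n]
      have "(a - b)\<^sup>2 \<le> 2 * (c - a)\<^sup>2 + 2 * (c - b)\<^sup>2" for a b c :: real
      proof -
        have "2 * (c - a)\<^sup>2 + 2 * (c - b)\<^sup>2 - (a - b)\<^sup>2 = (2 * c - a - b)\<^sup>2" by (simp add: power2_eq_square algebra_simps)
        then show ?thesis by (smt (verit) zero_le_power2)
      qed
      then have "(\<integral>x. (g x - f x)\<^sup>2 \<partial>M) \<le> (\<integral>x. 2 * (v n x - g x)\<^sup>2 + 2 * (v n x - f x)\<^sup>2 \<partial>M)"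
        by (intro integral_mono') (use i in auto)
      then show ?thesis using i by simp
    qed
    have "(\<lambda>n. 2 * (\<integral>x. (v n x - g x)\<^sup>2 \<partial>M) + 2 * (\<integral>x. (v n x - f x)\<^sup>2 \<partial>M)) \<longlonglongrightarrow> 2 * 0 + 2 * 0"
      by (intro tendsto_intros vg vf)
    then have "(\<integral>x. (g x - f x)\<^sup>2 \<partial>M) \<le> 0" using le by (intro LIMSEQ_le_const) auto
    then have "(\<integral>x. (g x - f x)\<^sup>2 \<partial>M) = 0" by (simp add: order.antisym)
    then have "AE x in M. (g x - f x)\<^sup>2 = 0"
      by (subst (asm) integral_nonneg_eq_0_iff_AE) (auto intro: L2_integrable[OF L2_diff[OF form_L2[OF g(1)] f]])
    then show ?thesis by simp
  qed
  have fD: "f \<in> D" by (rule form_AE(1)[OF g(1) f gf])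
  have "en M E (\<lambda>x. v n x - f x) = en M E (\<lambda>x. v n x - g x)" for n
  proof -
    have ae: "AE x in M. v n x - g x = v n x - f x" using gf by eventually_elim simp
    note d = form_diff[OF vD[of n] g(1)] form_diff[OF vD[of n] fD]
    have "E (\<lambda>x. v n x - g x) (\<lambda>x. v n x - g x) = E (\<lambda>x. v n x - f x) (\<lambda>x. v n x - f x)"
      using form_AE(2,3)[OF d(1) form_L2[OF d(2)] ae] d by metis
    moreover have "(\<integral>x. (v n x - g x)\<^sup>2 \<partial>M) = (\<integral>x. (v n x - f x)\<^sup>2 \<partial>M)"
      using ae d[THEN form_L2, THEN L2_measurable] by (intro integral_cong_AE) auto
    ultimately show ?thesis by (simp add: en_eq)
  qed
  then have vf_en: "(\<lambda>n. en M E (\<lambda>x. v n x - f x)) \<longlonglongrightarrow> 0" using g(2) by simp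
  moreover have "en M E f \<le> 2 * B"
  proof -
    have "(\<lambda>n. 2 * B + 2 * en M E (\<lambda>x. v n x - f x)) \<longlonglongrightarrow> 2 * B + 2 * 0"
      by (intro tendsto_intros vf_en)
    moreover have "en M E f \<le> 2 * B + 2 * en M E (\<lambda>x. v n x - f x)" for n
      using en_diff_le[OF fD vD[of n]] hullB[OF v(1)[of n]] by simp
    ultimately show ?thesis by (intro LIMSEQ_le_const) auto
  qed
  ultimately show ?thesis using fD v(1) by blast
qed

text \<open>The sum of the \<open>w j\<close> serves as a test function for the whole union, so that countable subadditivity of
  the capacity is not needed.\<close>

lemma Cap1_open_le:
  assumes w: "\<And>j. w j \<in> D" "\<And>j x. 0 \<le> w j x" and en_w: "\<And>j. en M E (w j) \<le> (1/8) ^ j"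
    and U: "\<And>x. x \<in> U \<Longrightarrow> \<exists>j\<ge>m. 1 < w j x"
  shows "Cap1_open M D E U \<le> ennreal (8 * (1/8) ^ m)"
proof -
  define S where "S = (\<lambda>a n x. \<Sum>j=a..<a+n. w j x)"
  have SS: "S a (Suc n) = (\<lambda>x. w a x + S (Suc a) n x)" for a n
    by (auto simp: S_def sum.atLeast_Suc_lessThan)
  have SD: "S a n \<in> D" for a n
  proof (induction n arbitrary: a)
    case 0
    show ?case using form_zero by (simp add: S_def)
  next
    case (Suc n)
    show ?case unfolding SS by (rule form_add[OF w(1) Suc])
  qed
  \<comment> \<open>Peeling off the first summand gives 2 * 8^-a + 2 * 4 * 8^-(a+1) = 3 * 8^-a: the
    ratio 1/8 beats the doubling in \<open>en_add_le\<close>.\<close>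
  have Sle: "en M E (S a n) \<le> 4 * (1/8) ^ a" for a n
  proof (induction n arbitrary: a)
    case 0
    have "en M E (\<lambda>x. 0) = 0" using en_scale[OF form_zero, of 0] by simp
    then show ?case by (simp add: S_def)
  next
    case (Suc n)
    have "(0::real) \<le> (1/8) ^ a" "(1/8::real) ^ Suc a = (1/8) ^ a / 8" by simp_all
    then show ?case using en_add_le[OF w(1)[of a] SD[of "Suc a" n]] en_w[of a] Suc.IH[of "Suc a"]
      unfolding SS by linarith
  qed
  have Sdiff: "(\<lambda>x. S m n x - S m k x) = S (m + k) (n - k)" if "k \<le> n" for k n
  proof
    fix x
    have "S m n x = S m k x + S (m + k) (n - k) x"
      unfolding S_def using that by (subst sum.atLeastLessThan_concat) auto
    then show "S m n x - S m k x = S (m + k) (n - k) x" by simp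
  qed
  have Scauchy: "en M E (\<lambda>x. S m n x - S m k x) \<le> 4 * (1/8) ^ N" if "N \<le> k" "N \<le> n" for n k N
  proof -
    have *: "en M E (\<lambda>x. S m n x - S m k x) \<le> 4 * (1/8) ^ N" if "N \<le> k" "k \<le> n" for n k
      unfolding Sdiff[OF that(2)] using that
      by (intro order_trans[OF Sle] mult_left_mono power_decreasing) auto
    have "en M E (\<lambda>x. S m n x - S m k x) = en M E (\<lambda>x. S m k x - S m n x)"
      using en_scale[OF form_diff[OF SD SD], of "-1" m k m n] by simp
    then show ?thesis using *[of k n] *[of n k] that by (cases "k \<le> n") auto
  qed
  have "\<exists>g\<in>D. (\<lambda>n. en M E (\<lambda>x. S m n x - g x)) \<longlonglongrightarrow> 0"
    unfolding en_def
  proof (rule form_complete[OF SD])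
    fix e :: real assume "e > 0"
    then obtain N where N: "(1/8::real) ^ N < e / 4" using real_arch_pow_inv[of "e/4" "1/8"] by auto
    show "\<exists>N. \<forall>k\<ge>N. \<forall>n\<ge>N. E1 M E (\<lambda>x. S m k x - S m n x) (\<lambda>x. S m k x - S m n x) < e"
    proof (intro exI allI impI)
      fix k n assume "N \<le> k" "N \<le> n"
      then have "en M E (\<lambda>x. S m k x - S m n x) \<le> 4 * (1/8) ^ N" by (intro Scauchy)
      with N show "E1 M E (\<lambda>x. S m k x - S m n x) (\<lambda>x. S m k x - S m n x) < e" by (simp add: en_def)
    qed
  qed
  then obtain g where g: "g \<in> D" "(\<lambda>n. en M E (\<lambda>x. S m n x - g x)) \<longlonglongrightarrow> 0" by blast
  have "en M E g \<le> 8 * (1/8) ^ m"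
  proof -
    have "(\<lambda>n. 2 * (4 * (1/8) ^ m) + 2 * en M E (\<lambda>x. S m n x - g x)) \<longlonglongrightarrow> 2 * (4 * (1/8) ^ m) + 2 * 0"
      by (intro tendsto_intros g)
    moreover have "en M E g \<le> 2 * (4 * (1/8) ^ m) + 2 * en M E (\<lambda>x. S m n x - g x)" for n
      using en_diff_le[OF g(1) SD[of m n]] Sle[of m n] by simp
    ultimately show ?thesis using LIMSEQ_le_const by fastforce
  qed
  \<comment> \<open>Every partial sum that contains \<open>w j\<close> dominates it since all
    summands are non-negative, and convergence in L^2 preserves the inequality almost
    everywhere.\<close>
  moreover have "AE x in M. w j x \<le> g x" if j: "m \<le> j" for j
  proof -
    note [measurable] = L2_measurable[OF form_L2[OF g(1)]] L2_measurable[OF form_L2[OF w(1)]]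
    have le: "(max 0 (w j x - g x))\<^sup>2 \<le> (S m n x - g x)\<^sup>2" if "n > j" for n x
    proof -
      have "w j x \<le> S m n x" unfolding S_def using w(2) j that by (intro member_le_sum) auto
      then show ?thesis by (cases "w j x \<le> g x") (auto intro!: power_mono)
    qed
    note i = L2_integrable[OF form_L2[OF form_diff[OF SD[of m] g(1)]]]
    have int: "integrable M (\<lambda>x. (max 0 (w j x - g x))\<^sup>2)"
      using le[OF lessI] by (intro Bochner_Integration.integrable_bound[OF i[of "Suc j"]]) auto
    have "(\<integral>x. (max 0 (w j x - g x))\<^sup>2 \<partial>M) \<le> 0"
    proof (rule LIMSEQ_le_const[OF g(2)], intro exI[of _ "Suc j"] allI impI)
      fix n assume "Suc j \<le> n"
      then have "(\<integral>x. (max 0 (w j x - g x))\<^sup>2 \<partial>M) \<le> (\<integral>x. (S m n x - g x)\<^sup>2 \<partial>M)"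
        using le int i by (intro integral_mono) auto
      also have "\<dots> \<le> en M E (\<lambda>x. S m n x - g x)" by (rule L2_norm_le_en[OF form_diff[OF SD g(1)]])
      finally show "(\<integral>x. (max 0 (w j x - g x))\<^sup>2 \<partial>M) \<le> en M E (\<lambda>x. S m n x - g x)" .
    qed
    then have "(\<integral>x. (max 0 (w j x - g x))\<^sup>2 \<partial>M) = 0" by (simp add: order.antisym)
    then have "AE x in M. (max 0 (w j x - g x))\<^sup>2 = 0"
      by (subst (asm) integral_nonneg_eq_0_iff_AE[OF int]) auto
    then show ?thesis by eventually_elim (simp add: max_def split: if_splits)
  qed
  then have "AE x in M. \<forall>j\<ge>m. w j x \<le> g x" by (simp add: AE_all_countable)
  then have "AE x in M. x \<in> U \<longrightarrow> 1 \<le> g x" by eventually_elim (use U in force)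
  then have "Cap1_open M D E U \<le> ennreal (en M E g)"
    unfolding Cap1_open_def en_def using g(1) by (intro INF_lower) auto
  ultimately show ?thesis by (meson ennreal_leI order_trans)
qed

end

section \<open>Quasi-regularity\<close>

text \<open>Distance zero forces equality because integrals of soft cylinder functions are Lipschitz
  for the distance and determine the measure.\<close>

lemma Metric_space_Wdist:
  assumes p: "1 \<le> p"
  shows "Metric_space (Pp p :: 'a::{banach,second_countable_topology} measure set) (Wdist p)"
proof
  fix \<mu> \<nu> \<rho> :: "'a measure"
  show "0 \<le> Wdist p \<mu> \<nu>" by (rule Wdist_nonneg)
  show "Wdist p \<mu> \<nu> = Wdist p \<nu> \<mu>" by (rule Wdist_sym)
  assume \<mu>: "\<mu> \<in> Pp p" and \<nu>: "\<nu> \<in> Pp p"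
  show "Wdist p \<mu> \<rho> \<le> Wdist p \<mu> \<nu> + Wdist p \<nu> \<rho>" if "\<rho> \<in> Pp p"
    by (rule Wdist_triangle[OF \<mu> \<nu> that p])
  obtain l :: "nat \<Rightarrow> 'a \<Rightarrow>\<^sub>L real" where l: "norming_seq l" using norming_seq_exists by blast
  have "\<mu> = \<nu>" if "Wdist p \<mu> \<nu> = 0"
  proof (rule measure_eqI_soft_cylinder[OF l PpD(1)[OF \<mu>] PpD(1)[OF \<nu>] PpD(2)[OF \<mu>] PpD(2)[OF \<nu>]])
    fix xs k
    obtain L where L0: "0 \<le> L" and L: "\<And>x y. \<bar>soft_cylinder l xs k x - soft_cylinder l xs k y\<bar> \<le> L * norm (x - y)"
      using FCb1_X_Lipschitz[OF soft_cylinder_FCb1_X] by metis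
    have "\<bar>(\<integral>x. soft_cylinder l xs k x \<partial>\<mu>) - (\<integral>x. soft_cylinder l xs k x \<partial>\<nu>)\<bar> \<le> 2 * L * Wdist p \<mu> \<nu>"
      by (rule integral_Lipschitz_Wdist[OF \<mu> \<nu> p L0 L soft_cylinder_bounds FCb1_X_measurable[OF soft_cylinder_FCb1_X]])
    then show "(\<integral>x. soft_cylinder l xs k x \<partial>\<mu>) = (\<integral>x. soft_cylinder l xs k x \<partial>\<nu>)" using that by simp
  qed
  then show "Wdist p \<mu> \<nu> = 0 \<longleftrightarrow> \<mu> = \<nu>" using Wdist_self[OF \<mu> p] by blast
qed

lemma topspace_Wtop: "1 \<le> p \<Longrightarrow> topspace (Wtop p) = Pp p"
  unfolding Wtop_def by (rule Metric_space.topspace_mtopology[OF Metric_space_Wdist])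

lemma space_Wborel: "1 \<le> p \<Longrightarrow> space (Wborel p) = Pp p"
  unfolding Wborel_def using openin_subset[of "Wtop p"] by (subst space_measure_of) (auto simp: topspace_Wtop)

lemma continuous_map_WtopI:
  assumes p: "1 \<le> p" 
    and c: "\<And>\<mu> \<nu>. \<mu> \<in> Pp p \<Longrightarrow> \<nu> \<in> Pp p \<Longrightarrow> \<bar>f \<mu> - f \<nu>\<bar> \<le> c * Wdist p \<mu> \<nu>"
  shows "continuous_map (Wtop p) euclideanreal f"
  unfolding continuous_map_def
proof (intro conjI allI impI)
  interpret W: Metric_space "Pp p" "Wdist p" by (rule Metric_space_Wdist[OF p])
  fix U :: "real set" assume U: "openin euclideanreal U"
  show "openin (Wtop p) {\<mu> \<in> topspace (Wtop p). f \<mu> \<in> U}"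
    unfolding topspace_Wtop[OF p] unfolding Wtop_def W.openin_mtopology
  proof (intro conjI allI impI)
    fix \<mu> assume "\<mu> \<in> {\<mu> \<in> Pp p. f \<mu> \<in> U}"
    then have \<mu>: "\<mu> \<in> Pp p" "f \<mu> \<in> U" by auto
    then obtain e where e: "e > 0" "ball (f \<mu>) e \<subseteq> U" using U openE[of U "f \<mu>"] by auto
    define r where "r = e / (\<bar>c\<bar> + 1)"
    have "W.mball \<mu> r \<subseteq> {\<mu> \<in> Pp p. f \<mu> \<in> U}"
    proof
      fix \<nu> assume "\<nu> \<in> W.mball \<mu> r"
      then have \<nu>: "\<nu> \<in> Pp p" "Wdist p \<mu> \<nu> < r" by (auto simp: W.in_mball)
      have "\<bar>f \<mu> - f \<nu>\<bar> \<le> (\<bar>c\<bar> + 1) * Wdist p \<mu> \<nu>"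
        by (rule order_trans[OF c[OF \<mu>(1) \<nu>(1)] mult_right_mono]) auto
      also have "\<dots> < (\<bar>c\<bar> + 1) * r" using \<nu>(2) by (intro mult_strict_left_mono) auto
      also have "\<dots> = e" by (simp add: r_def)
      finally show "\<nu> \<in> {\<mu> \<in> Pp p. f \<mu> \<in> U}" using e(2) \<nu>(1) by (auto simp: dist_real_def)
    qed
    then show "\<exists>r>0. W.mball \<mu> r \<subseteq> {\<mu> \<in> Pp p. f \<mu> \<in> U}"
      using e(1) by (intro exI[of _ r]) (auto simp: r_def)
  qed auto
qed auto

lemma continuous_map_integral_FCb1_X:
  assumes p: "1 \<le> p" and \<psi>: "\<psi> \<in> FCb1_X"
  shows "continuous_map (Wtop p) euclideanreal (\<lambda>\<mu>. \<integral>x. \<psi> x \<partial>\<mu>)"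
proof -
  obtain L where L0: "0 \<le> L" and L: "\<And>x y. \<bar>\<psi> x - \<psi> y\<bar> \<le> L * norm (x - y)" using FCb1_X_Lipschitz[OF \<psi>] by metis
  obtain B where B: "\<And>x. \<bar>\<psi> x\<bar> \<le> B" using FCb1_X_bounded[OF \<psi>] by metis
  show ?thesis
    by (rule continuous_map_WtopI[OF p integral_Lipschitz_Wdist[OF _ _ p L0 L B FCb1_X_measurable[OF \<psi>]]])
qed

section \<open>Continuous functions whose sublevel sets control compactness\<close>

definition tight_fun :: "real \<Rightarrow> (nat \<Rightarrow> 'a::{banach,second_countable_topology}) \<Rightarrow> nat \<Rightarrow> 'a measure \<Rightarrow> real" where
  "tight_fun p d n \<mu> = arctan (\<integral>x. hmin d n x powr p \<partial>\<mu>)"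

lemma tight_fun_nonneg: "0 \<le> tight_fun p d n \<mu>"
  unfolding tight_fun_def by simp

context
  fixes p :: real and d :: "nat \<Rightarrow> 'a::{banach,second_countable_topology}"
  assumes p: "1 \<le> p" and d0: "d 0 = 0"
begin

lemma hmin_integrable:
  assumes "\<mu> \<in> Pp p"
  shows "integrable \<mu> (\<lambda>x. hmin d n x powr p)"
proof (rule Bochner_Integration.integrable_bound[OF Pp_norm_integrable[OF assms p, of 0]])
  note [measurable_cong] = PpD(2)[OF assms]
  show "(\<lambda>x. hmin d n x powr p) \<in> borel_measurable \<mu>" by measurable
  show "AE x in \<mu>. norm (hmin d n x powr p) \<le> norm ((0 + norm x) powr p)"
    using hmin_le_norm[of d n, OF d0] hmin_nonneg[of d n] p by (intro AE_I2) (auto intro!: powr_mono2)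
qed simp

lemma nn_integral_hmin:
  "\<mu> \<in> Pp p \<Longrightarrow> Lp_int p \<mu> (hmin d n) = ennreal (\<integral>x. hmin d n x powr p \<partial>\<mu>)"
  by (rule nn_integral_eq_integral[OF hmin_integrable]) auto

lemma tight_fun_antimono:
  assumes "\<mu> \<in> Pp p" "m \<le> n"
  shows "tight_fun p d n \<mu> \<le> tight_fun p d m \<mu>"
  unfolding tight_fun_def using hmin_antimono[OF assms(2), of d] hmin_nonneg[of d n] p
  by (intro arctan_monotone' integral_mono hmin_integrable assms powr_mono2) auto

lemma tight_fun_tendsto_0:
  assumes \<mu>: "\<mu> \<in> Pp p" and dense: "\<And>x e. 0 < e \<Longrightarrow> \<exists>i. dist x (d i) < e"
  shows "(\<lambda>n. tight_fun p d n \<mu>) \<longlonglongrightarrow> 0"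
proof -
  note [measurable_cong] = PpD(2)[OF \<mu>]
  have "(\<lambda>n. \<integral>x. hmin d n x powr p \<partial>\<mu>) \<longlonglongrightarrow> (\<integral>x. 0 \<partial>\<mu>)"
  proof (rule integral_dominated_convergence[where w="\<lambda>x. (0 + norm x) powr p"])
    show "AE x in \<mu>. (\<lambda>n. hmin d n x powr p) \<longlonglongrightarrow> 0"
      using tendsto_powr'[OF hmin_tendsto_0[OF dense] tendsto_const[of p]] p hmin_nonneg[of d] by (intro AE_I2) simp
    show "integrable \<mu> (\<lambda>x. (0 + norm x) powr p)" by (rule Pp_norm_integrable[OF \<mu> p]) simp
    show "AE x in \<mu>. norm (hmin d n x powr p) \<le> (0 + norm x) powr p" for n
      using hmin_le_norm[of d n, OF d0] hmin_nonneg[of d n] p by (intro AE_I2) (auto intro!: powr_mono2)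
  qed auto
  then have "(\<lambda>n. arctan (\<integral>x. hmin d n x powr p \<partial>\<mu>)) \<longlonglongrightarrow> arctan 0"
    by (intro tendsto_arctan) simp
  then show ?thesis unfolding tight_fun_def by simp
qed

text \<open>Not the integral but its p-th root is 1-Lipschitz for the distance. Composition with
  \<open>arctan (\<bar>x\<bar> powr p)\<close> follows, where the absolute value makes the outer
  function continuous on the whole line.\<close>

lemma continuous_map_tight_fun: "continuous_map (Wtop p) euclideanreal (tight_fun p d n)"
proof -
  define N where "N = (\<lambda>\<mu>. (\<integral>x. hmin d n x powr p \<partial>\<mu>) powr (1/p))"
  have Np: "N \<mu> powr p = (\<integral>x. hmin d n x powr p \<partial>\<mu>)" "0 \<le> N \<mu>" for \<mu>
    unfolding N_def using p by (auto simp: powr_powr)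
  have le: "N \<mu> \<le> N \<nu> + Wdist p \<mu> \<nu>" if "\<mu> \<in> Pp p" "\<nu> \<in> Pp p" for \<mu> \<nu>
  proof (rule field_le_epsilon)
    fix e :: real assume e: "0 < e"
    have "Lp_int p \<mu> (hmin d n) \<le> ennreal ((N \<nu> + (Wdist p \<mu> \<nu> + e)) powr p)"
      by (rule Lp_norm_Lipschitz_Wdist[OF that p hmin_triangle hmin_nonneg hmin_measurable Np(2)])
         (use e in \<open>auto simp: nn_integral_hmin[OF that(2)] Np\<close>)
    then have "ennreal (N \<mu> powr p) \<le> ennreal ((N \<nu> + (Wdist p \<mu> \<nu> + e)) powr p)"
      unfolding nn_integral_hmin[OF that(1)] Np(1) .
    then have "N \<mu> powr p \<le> (N \<nu> + (Wdist p \<mu> \<nu> + e)) powr p" by simp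
    then have "(N \<mu> powr p) powr (1/p) \<le> ((N \<nu> + (Wdist p \<mu> \<nu> + e)) powr p) powr (1/p)"
      by (rule powr_mono2[rotated 2]) (use p in auto)
    then show "N \<mu> \<le> N \<nu> + Wdist p \<mu> \<nu> + e"
      using p Np(2)[of \<mu>] Np(2)[of \<nu>] e Wdist_nonneg[of p \<mu> \<nu>] by (simp add: powr_powr)
  qed
  have "continuous_map (Wtop p) euclideanreal N"
  proof (rule continuous_map_WtopI[OF p, where c=1])
    fix \<mu> \<nu> :: "'a measure" assume "\<mu> \<in> Pp p" "\<nu> \<in> Pp p"
    then show "\<bar>N \<mu> - N \<nu>\<bar> \<le> 1 * Wdist p \<mu> \<nu>"
      using le[of \<mu> \<nu>] le[of \<nu> \<mu>] Wdist_sym[of p \<mu> \<nu>] by auto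
  qed
  moreover have "continuous_map euclideanreal euclideanreal (\<lambda>x. arctan (\<bar>x\<bar> powr p))"
    using p by (intro continuous_map_iff_continuous2[THEN iffD2] continuous_on_arctan continuous_on_powr' continuous_intros) auto
  ultimately have "continuous_map (Wtop p) euclideanreal ((\<lambda>x. arctan (\<bar>x\<bar> powr p)) \<circ> N)"
    by (rule continuous_map_compose)
  moreover have "(\<lambda>x. arctan (\<bar>x\<bar> powr p)) \<circ> N = tight_fun p d n"
    using Np by (auto simp: tight_fun_def fun_eq_iff)
  ultimately show ?thesis by simp
qed

lemma mid_hull_tight_fun:
  assumes "v \<in> mid_hull (tight_fun p d) n"
  shows "0 \<le> v \<mu>" "continuous_map (Wtop p) euclideanreal v" "\<exists>N. \<forall>\<mu>\<in>Pp p. tight_fun p d N \<mu> \<le> v \<mu>"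
proof -
  have "(\<forall>\<mu>. 0 \<le> v \<mu>) \<and> continuous_map (Wtop p) euclideanreal v \<and> (\<exists>N. \<forall>\<mu>\<in>Pp p. tight_fun p d N \<mu> \<le> v \<mu>)"
    using assms
  proof (induction rule: mid_hull.induct)
    case (base k)
    then show ?case using tight_fun_nonneg continuous_map_tight_fun by blast
  next
    case (mid a b)
    then obtain M N where MN: "\<forall>\<mu>\<in>Pp p. tight_fun p d M \<mu> \<le> a \<mu>" "\<forall>\<mu>\<in>Pp p. tight_fun p d N \<mu> \<le> b \<mu>" by blast
    have "tight_fun p d (max M N) \<mu> \<le> (a \<mu> + b \<mu>) / 2" if "\<mu> \<in> Pp p" for \<mu>
    proof -
      have "tight_fun p d (max M N) \<mu> \<le> a \<mu>" "tight_fun p d (max M N) \<mu> \<le> b \<mu>"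
        using MN that tight_fun_antimono[OF that, of M "max M N"] tight_fun_antimono[OF that, of N "max M N"] by force+
      then show ?thesis by simp
    qed
    moreover have "continuous_map (Wtop p) euclideanreal (\<lambda>\<mu>. (a \<mu> + b \<mu>) / 2)"
      using mid by (intro continuous_map_real_divide continuous_map_add) auto
    ultimately show ?case using mid by (auto intro!: add_nonneg_nonneg)
  qed
  then show "0 \<le> v \<mu>" "continuous_map (Wtop p) euclideanreal v" "\<exists>N. \<forall>\<mu>\<in>Pp p. tight_fun p d N \<mu> \<le> v \<mu>" by auto
qed

lemma compactin_WtopI:
  assumes dense: "\<And>x e. 0 < e \<Longrightarrow> \<exists>i. dist x (d i) < e"
    and closed: "closedin (Wtop p) K" and small: "\<And>e. 0 < e \<Longrightarrow> \<exists>N. \<forall>\<mu>\<in>K. tight_fun p d N \<mu> < e"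
  shows "compactin (Wtop p) K"
proof -
  interpret W: Metric_space "Pp p :: 'a measure set" "Wdist p" by (rule Metric_space_Wdist[OF p])
  have K: "K \<subseteq> Pp p" using closedin_subset[OF closed] by (simp add: topspace_Wtop[OF p])
  have "\<exists>\<mu> r. \<mu> \<in> K \<and> strict_mono r \<and> limitin W.mtopology (\<sigma> \<circ> r) \<mu> sequentially"
    if \<sigma>: "range \<sigma> \<subseteq> K" for \<sigma> :: "nat \<Rightarrow> 'a measure"
  proof -
    have \<sigma>P: "\<sigma> k \<in> Pp p" for k using \<sigma> K by auto
    have sm: "\<exists>N. \<forall>k. Lp_int p (\<sigma> k) (hmin d N) \<le> ennreal (\<delta> powr p)" if "0 < \<delta>" for \<delta>
    proof -
      have "0 < arctan (\<delta> powr p)" using that by simp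
      then obtain N where N: "\<forall>\<mu>\<in>K. tight_fun p d N \<mu> < arctan (\<delta> powr p)" using small by blast
      have "Lp_int p (\<sigma> k) (hmin d N) \<le> ennreal (\<delta> powr p)" for k
        using N \<sigma> unfolding nn_integral_hmin[OF \<sigma>P] tight_fun_def arctan_less_iff
        by (intro ennreal_leI less_imp_le) auto
      then show ?thesis by blast
    qed
    have "\<exists>\<mu>\<in>Pp p. \<exists>r::nat \<Rightarrow> nat. strict_mono r \<and> (\<forall>\<delta>>0. \<exists>K. \<forall>k\<ge>K. Wdist p (\<sigma> (r k)) \<mu> \<le> \<delta>)"
      by (rule Wdist_convergent_subseq[OF p]) (rule dense \<sigma>P sm; assumption)+
    then obtain \<mu> r where \<mu>: "\<mu> \<in> Pp p" and r: "strict_mono (r :: nat \<Rightarrow> nat)"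
      and lim: "\<And>\<delta>. 0 < \<delta> \<Longrightarrow> \<exists>K. \<forall>k\<ge>K. Wdist p (\<sigma> (r k)) \<mu> \<le> \<delta>"
      by blast
    have L: "limitin W.mtopology (\<sigma> \<circ> r) \<mu> sequentially"
      unfolding W.limit_metric_sequentially
    proof (intro conjI allI impI \<mu>)
      fix e :: real assume "0 < e"
      then obtain N where "\<forall>k\<ge>N. Wdist p (\<sigma> (r k)) \<mu> \<le> e / 2" using lim[of "e/2"] by auto
      then show "\<exists>N. \<forall>k\<ge>N. (\<sigma> \<circ> r) k \<in> Pp p \<and> Wdist p ((\<sigma> \<circ> r) k) \<mu> < e"
        using \<open>0 < e\<close> \<sigma>P by (intro exI[of _ N]) fastforce
    qed
    have "\<mu> \<in> K"
      by (rule limitin_closedin[OF L closed[unfolded Wtop_def]]) (use \<sigma> in \<open>auto intro!: always_eventually\<close>)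
    then show ?thesis using r L by blast
  qed
  then show ?thesis unfolding Wtop_def W.compactin_sequentially using K by blast
qed

end

section \<open>The compact nest and the separating family\<close>

context
  fixes p :: real and C :: real
    and \<Lambda> :: "('a::{banach,second_countable_topology}) measure measure"
    and D :: "('a measure \<Rightarrow> real) set"
    and E :: "('a measure \<Rightarrow> real) \<Rightarrow> ('a measure \<Rightarrow> real) \<Rightarrow> real"
    and d :: "nat \<Rightarrow> 'a"
  assumes p: "1 \<le> p"
    and Lambda: "prob_space \<Lambda>" "sets \<Lambda> = sets (Wborel p)"
    and form: "symmetric_dirichlet_form \<Lambda> D E"
    and C1: "FCb1_P \<subseteq> D" "0 < C"
      "\<forall>f\<in>FCb1_P. ennreal (E f f) \<le> ennreal C * (SUP \<mu>\<in>Pp p. Dnorm p f \<mu>)\<^sup>2"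
    and d0: "d 0 = 0" and dense: "\<And>x e. 0 < e \<Longrightarrow> \<exists>i. dist x (d i) < e"
begin

lemma space_Lambda: "space \<Lambda> = Pp p"
  using sets_eq_imp_space_eq[OF Lambda(2)] space_Wborel[OF p] by simp

lemma bounded_L2:
  fixes f :: "'a measure \<Rightarrow> real"
  assumes [measurable]: "f \<in> borel_measurable \<Lambda>" and b: "\<And>\<mu>. \<bar>f \<mu>\<bar> \<le> B"
  shows "f \<in> L2 \<Lambda>" "(\<integral>\<mu>. (f \<mu>)\<^sup>2 \<partial>\<Lambda>) \<le> B\<^sup>2"
proof -
  interpret prob_space \<Lambda> by (rule Lambda)
  have b2: "(f \<mu>)\<^sup>2 \<le> B\<^sup>2" for \<mu> using b[of \<mu>] by (rule abs_le_square_iff[THEN iffD1, OF order_trans]) simp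
  have i: "integrable \<Lambda> (\<lambda>\<mu>. (f \<mu>)\<^sup>2)" by (rule integrable_const_bound[where B="B\<^sup>2"]) (use b2 in auto)
  then show "f \<in> L2 \<Lambda>" by (simp add: L2_def)
  have "(\<integral>\<mu>. (f \<mu>)\<^sup>2 \<partial>\<Lambda>) \<le> (\<integral>\<mu>. B\<^sup>2 \<partial>\<Lambda>)" by (intro integral_mono i b2) simp
  then show "(\<integral>\<mu>. (f \<mu>)\<^sup>2 \<partial>\<Lambda>) \<le> B\<^sup>2" by (simp add: prob_space)
qed

lemma bounded_L2_tendsto:
  fixes f :: "'a measure \<Rightarrow> real"
  assumes [measurable]: "\<And>m. u m \<in> borel_measurable \<Lambda>" "f \<in> borel_measurable \<Lambda>"
    and b: "\<And>m \<mu>. \<bar>u m \<mu>\<bar> \<le> B" "\<And>\<mu>. \<bar>f \<mu>\<bar> \<le> B" and lim: "\<And>\<mu>. \<mu> \<in> Pp p \<Longrightarrow> (\<lambda>m. u m \<mu>) \<longlonglongrightarrow> f \<mu>"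
  shows "(\<lambda>m. \<integral>\<mu>. (u m \<mu> - f \<mu>)\<^sup>2 \<partial>\<Lambda>) \<longlonglongrightarrow> 0"
proof -
  interpret prob_space \<Lambda> by (rule Lambda)
  have "(\<lambda>m. \<integral>\<mu>. (u m \<mu> - f \<mu>)\<^sup>2 \<partial>\<Lambda>) \<longlonglongrightarrow> (\<integral>\<mu>. 0 \<partial>\<Lambda>)"
  proof (rule integral_dominated_convergence[where w="\<lambda>_. (2 * B)\<^sup>2"])
    show "AE \<mu> in \<Lambda>. (\<lambda>m. (u m \<mu> - f \<mu>)\<^sup>2) \<longlonglongrightarrow> 0"
    proof (rule AE_I2)
      fix \<mu> assume "\<mu> \<in> space \<Lambda>"
      then have "(\<lambda>m. (u m \<mu> - f \<mu>)\<^sup>2) \<longlonglongrightarrow> (f \<mu> - f \<mu>)\<^sup>2"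
        by (intro tendsto_intros lim) (simp add: space_Lambda)
      then show "(\<lambda>m. (u m \<mu> - f \<mu>)\<^sup>2) \<longlonglongrightarrow> 0" by simp
    qed
    show "AE \<mu> in \<Lambda>. norm ((u m \<mu> - f \<mu>)\<^sup>2) \<le> (2 * B)\<^sup>2" for m
    proof (rule AE_I2)
      fix \<mu>
      have "\<bar>u m \<mu> - f \<mu>\<bar> \<le> \<bar>2 * B\<bar>" using b(1)[of m \<mu>] b(2)[of \<mu>] by linarith
      then show "norm ((u m \<mu> - f \<mu>)\<^sup>2) \<le> (2 * B)\<^sup>2" unfolding abs_le_square_iff real_norm_def abs_power2 .
    qed
  qed auto
  then show ?thesis by simp
qed

lemma abs_arctan_le: "\<bar>arctan x\<bar> \<le> pi / 2"
  using arctan_lbound[of x] arctan_ubound[of x] by linarith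

text \<open>The cylinder functions \<open>u m\<close> have form energy at most C(2p)^2 and converge
  boundedly, hence in L^2, so \<open>form_Banach_Saks\<close> puts the limit into the domain. The
  summand (pi/2)^2 bounds the L^2 part, and the outer factor 2 comes from
  \<open>form_Banach_Saks\<close>.\<close>

lemma tight_fun_in_form: "tight_fun p d n \<in> D" "en \<Lambda> E (tight_fun p d n) \<le> 2 * ((pi/2)\<^sup>2 + C * (2 * p)\<^sup>2)"
proof -
  obtain l :: "nat \<Rightarrow> 'a \<Rightarrow>\<^sub>L real" where l: "norming_seq l" using norming_seq_exists by blast
  define u where "u = (\<lambda>m \<mu>. arctan (\<integral>x. dist_cyl d l p n m x \<partial>\<mu>))"
  have uF: "u m \<in> FCb1_P" for m
    unfolding u_def by (rule arctan_integral_FCb1_P[OF dist_cyl_FCb1_X[where d=d, OF l d0 p]])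
  then have uD: "u m \<in> D" for m using C1(1) by blast
  note um = L2_measurable[OF form_L2[OF form uD]]
  have uE: "E (u m) (u m) \<le> C * (2 * p)\<^sup>2" for m
  proof -
    have "(SUP \<mu>\<in>Pp p. Dnorm p (u m) \<mu>) \<le> ennreal (2 * p)"
      unfolding u_def by (intro SUP_least dist_cyl_Dnorm_le[where d=d, OF l d0 p])
    then have "(SUP \<mu>\<in>Pp p. Dnorm p (u m) \<mu>)\<^sup>2 \<le> (ennreal (2 * p))\<^sup>2" by (rule power_mono) simp
    then have "ennreal (E (u m) (u m)) \<le> ennreal C * (ennreal (2 * p))\<^sup>2"
      using C1(3)[rule_format, OF uF[of m]] by (meson mult_left_mono order_trans zero_le)
    also have "\<dots> = ennreal (C * (2 * p)\<^sup>2)" using C1(2) p by (simp add: ennreal_mult ennreal_power)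
    finally show ?thesis using C1(2) by (subst (asm) ennreal_le_iff) auto
  qed
  have ub: "\<bar>u m \<mu>\<bar> \<le> pi / 2" for m \<mu> unfolding u_def by (rule abs_arctan_le)
  have uen: "en \<Lambda> E (u m) \<le> (pi/2)\<^sup>2 + C * (2 * p)\<^sup>2" for m
    unfolding en_eq[OF form] by (intro add_mono uE bounded_L2(2) um ub)
  have lim: "(\<lambda>m. u m \<mu>) \<longlonglongrightarrow> tight_fun p d n \<mu>" if "\<mu> \<in> Pp p" for \<mu>
    unfolding u_def tight_fun_def by (intro tendsto_arctan integral_dist_cyl_tendsto[where d=d, OF l d0 p that])
  have fm: "tight_fun p d n \<in> borel_measurable \<Lambda>"
    by (rule borel_measurable_LIMSEQ_real[of \<Lambda> u]) (auto simp: space_Lambda lim um)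
  have fb: "\<bar>tight_fun p d n \<mu>\<bar> \<le> pi / 2" for \<mu> unfolding tight_fun_def by (rule abs_arctan_le)
  have "(\<lambda>m. \<integral>\<mu>. (u m \<mu> - tight_fun p d n \<mu>)\<^sup>2 \<partial>\<Lambda>) \<longlonglongrightarrow> 0"
    by (rule bounded_L2_tendsto[OF um fm ub fb lim])
  from form_Banach_Saks[OF form uD uen bounded_L2(1)[OF fm fb] this]
  show "tight_fun p d n \<in> D" "en \<Lambda> E (tight_fun p d n) \<le> 2 * ((pi/2)\<^sup>2 + C * (2 * p)\<^sup>2)" by blast+
qed

lemma compact_nest: "\<exists>K. nest (Wtop p) \<Lambda> D E K \<and> (\<forall>n. compactin (Wtop p) (K n))"
proof -
  note Fm = L2_measurable[OF form_L2[OF form tight_fun_in_form(1)]]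
  have fb: "\<bar>tight_fun p d n \<mu>\<bar> \<le> pi / 2" for n \<mu> unfolding tight_fun_def by (rule abs_arctan_le)
  \<comment> \<open>The second use of \<open>form_Banach_Saks\<close>, now with limit 0: its
    conclusion on midpoint combinations is what yields functions of small energy.\<close>
  have "(\<lambda>n. \<integral>\<mu>. (tight_fun p d n \<mu> - 0)\<^sup>2 \<partial>\<Lambda>) \<longlonglongrightarrow> 0"
    by (rule bounded_L2_tendsto[OF Fm _ fb _ tight_fun_tendsto_0[where d=d, OF p d0 _ dense]]) auto
  from form_Banach_Saks[OF form tight_fun_in_form form_L2[OF form form_zero[OF form]] this]
  obtain v where v: "\<And>n. v n \<in> mid_hull (tight_fun p d) n" and "(\<lambda>n. en \<Lambda> E (\<lambda>\<mu>. v n \<mu> - 0)) \<longlonglongrightarrow> 0" by blast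
  then have vlim: "(\<lambda>n. en \<Lambda> E (v n)) \<longlonglongrightarrow> 0" by simp
  note h = mid_hull_tight_fun[where d=d, OF p d0 v]
  have vD: "v n \<in> D" for n
    using v[of n] by (induction rule: mid_hull.induct) (auto intro: tight_fun_in_form form_midpoint[OF form])
  \<comment> \<open>Scaling by 2^j multiplies the energy by 4^j, and 4^j / 32^j = 8^-j is the rate
    that \<open>Cap1_open_le\<close> asks for. The scaled condition \<open>w j \<mu> \<le> 1\<close>
    says that \<open>v (s j) \<mu>\<close> is at most 2^-j.\<close>
  have "\<exists>n. en \<Lambda> E (v n) \<le> (1/32) ^ j" for j
    using order_tendstoD(2)[OF vlim, of "(1/32) ^ j"] unfolding eventually_sequentially by (auto intro: less_imp_le)
  then obtain s where s: "\<And>j. en \<Lambda> E (v (s j)) \<le> (1/32) ^ j" by metis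
  define w where "w = (\<lambda>j \<mu>. 2 ^ j * v (s j) \<mu>)"
  have wD: "w j \<in> D" for j unfolding w_def by (rule form_scale[OF form vD])
  have w0: "0 \<le> w j \<mu>" for j \<mu> unfolding w_def using h(1) by simp
  have wen: "en \<Lambda> E (w j) \<le> (1/8) ^ j" for j
  proof -
    have "en \<Lambda> E (w j) = (2 ^ j)\<^sup>2 * en \<Lambda> E (v (s j))" unfolding w_def by (rule en_scale[OF form vD])
    also have "\<dots> \<le> (2 ^ j)\<^sup>2 * (1/32) ^ j" by (intro mult_left_mono s) simp
    also have "\<dots> = (1/8) ^ j" by (simp add: power2_eq_square power_mult_distrib[symmetric])
    finally show ?thesis .
  qed
  have wc: "continuous_map (Wtop p) euclideanreal (w j)" for j
    unfolding w_def by (intro continuous_map_real_mult continuous_map_canonical_const h(2))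
  define K where "K = (\<lambda>m. {\<mu>\<in>Pp p. \<forall>j\<ge>m. w j \<mu> \<le> 1})"
  have Kc: "closedin (Wtop p) (K m)" for m
  proof -
    have "K m = (\<Inter>j\<in>{m..}. {\<mu>\<in>topspace (Wtop p). w j \<mu> \<in> {..1}})"
      unfolding K_def topspace_Wtop[OF p] by auto
    also have "closedin (Wtop p) \<dots>"
      by (intro closedin_INT closedin_continuous_map_preimage[OF wc]) auto
    finally show ?thesis .
  qed
  have "nest (Wtop p) \<Lambda> D E K"
    unfolding nest_def
  proof (intro conjI allI Kc)
    show "incseq K" by (rule incseq_SucI) (auto simp: K_def)
    have le: "Cap1 (Wtop p) \<Lambda> D E (topspace (Wtop p) - K m) \<le> ennreal (8 * (1/8) ^ m)" for m
    proof -
      \<comment> \<open>The complement is itself open, so it competes in the infimum that defines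
        \<open>Cap1\<close>.\<close>
      have "Cap1 (Wtop p) \<Lambda> D E (topspace (Wtop p) - K m) \<le> Cap1_open \<Lambda> D E (topspace (Wtop p) - K m)"
        unfolding Cap1_def using Kc[of m] by (intro INF_lower) auto
      also have "\<dots> \<le> ennreal (8 * (1/8) ^ m)"
        by (rule Cap1_open_le[OF form wD w0 wen]) (auto simp: K_def topspace_Wtop[OF p] not_le)
      finally show ?thesis .
    qed
    have "(\<lambda>m. 8 * (1/8::real) ^ m) \<longlonglongrightarrow> 8 * 0" by (intro tendsto_intros LIMSEQ_power_zero) simp
    then have "(\<lambda>m. ennreal (8 * (1/8) ^ m)) \<longlonglongrightarrow> 0" using tendsto_ennrealI by fastforce
    then show "(\<lambda>m. Cap1 (Wtop p) \<Lambda> D E (topspace (Wtop p) - K m)) \<longlonglongrightarrow> 0"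
      by (rule tendsto_sandwich[OF _ _ tendsto_const, rotated 2]) (use le in auto)
  qed
  moreover have "compactin (Wtop p) (K m)" for m
  proof (rule compactin_WtopI[where d=d, OF p d0 dense Kc])
    fix e :: real assume e: "0 < e"
    obtain i where i: "(1/2::real) ^ i < e" using real_arch_pow_inv[OF e, of "1/2"] by auto
    \<comment> \<open>At least \<open>m\<close>, so that the condition on \<open>w j\<close> is one
      of those defining \<open>K m\<close>, and at least \<open>i\<close>, so that 2^-j < e.\<close>
    define j where "j = max m i"
    have "(1/2::real) ^ j \<le> (1/2) ^ i" by (rule power_decreasing) (auto simp: j_def)
    then have j: "m \<le> j" "(1/2) ^ j < e" using i unfolding j_def by (simp, linarith)
    obtain N where N: "\<forall>\<mu>\<in>Pp p. tight_fun p d N \<mu> \<le> v (s j) \<mu>" using h(3) by blast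
    have "tight_fun p d N \<mu> < e" if "\<mu> \<in> K m" for \<mu>
    proof -
      have "\<mu> \<in> Pp p" "2 ^ j * v (s j) \<mu> \<le> 1" using that j(1) by (auto simp: K_def w_def)
      then have "tight_fun p d N \<mu> \<le> v (s j) \<mu>" "v (s j) \<mu> \<le> (1/2) ^ j"
        using N by (auto simp: power_one_over field_simps)
      then show ?thesis using j(2) by simp
    qed
    then show "\<exists>N. \<forall>\<mu>\<in>K m. tight_fun p d N \<mu> < e" by blast
  qed
  ultimately show ?thesis by blast
qed

lemma Cap1_empty: "Cap1 (Wtop p) \<Lambda> D E {} = 0"
proof -
  have "Cap1 (Wtop p) \<Lambda> D E {} \<le> Cap1_open \<Lambda> D E {}"
    unfolding Cap1_def by (intro INF_lower) auto
  also have "\<dots> \<le> ennreal (E1 \<Lambda> E (\<lambda>_. 0) (\<lambda>_. 0))"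
    unfolding Cap1_open_def using form_zero[OF form] by (intro INF_lower) auto
  also have "E1 \<Lambda> E (\<lambda>_. 0) (\<lambda>_. 0) = 0"
    using en_scale[OF form form_zero[OF form], of 0] by (simp add: en_def)
  finally show ?thesis by simp
qed

text \<open>Pairs of a list of rational half-spaces and a softness \<open>k\<close> are countable,
  and the integrals of their soft cylinder functions determine the measure. The injective
  \<open>arctan\<close> loses no information and meets the boundedness demanded of the outer
  function in \<open>FCb1_P\<close>. All members are continuous, so the constant nest witnesses
  quasi-continuity.\<close>

lemma separating_family:
  "\<exists>f :: nat \<Rightarrow> 'a measure \<Rightarrow> real. (\<forall>i. f i \<in> D \<and> quasi_continuous (Wtop p) \<Lambda> D E (f i)) \<and>
     (\<forall>\<mu>\<in>Pp p. \<forall>\<nu>\<in>Pp p. \<mu> \<noteq> \<nu> \<longrightarrow> (\<exists>i. f i \<mu> \<noteq> f i \<nu>))"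
proof -
  obtain l :: "nat \<Rightarrow> 'a \<Rightarrow>\<^sub>L real" where l: "norming_seq l" using norming_seq_exists by blast
  define f where "f = (\<lambda>i \<mu>. arctan (\<integral>x. soft_cylinder l (fst (from_nat i :: (nat \<times> rat) list \<times> nat)) (snd (from_nat i :: (nat \<times> rat) list \<times> nat)) x \<partial>\<mu>))"
  have nest: "nest (Wtop p) \<Lambda> D E (\<lambda>_. topspace (Wtop p))"
    unfolding nest_def by (simp add: Cap1_empty)
  have "f i \<in> D" for i
    using arctan_integral_FCb1_P[OF soft_cylinder_FCb1_X] C1(1) unfolding f_def by blast
  moreover have "quasi_continuous (Wtop p) \<Lambda> D E (f i)" for i
  proof -
    have "continuous_map (Wtop p) euclideanreal (arctan \<circ> (\<lambda>\<mu>. \<integral>x. soft_cylinder l (fst (from_nat i :: (nat \<times> rat) list \<times> nat)) (snd (from_nat i :: (nat \<times> rat) list \<times> nat)) x \<partial>\<mu>))"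
      by (rule continuous_map_compose[OF continuous_map_integral_FCb1_X[OF p soft_cylinder_FCb1_X]])
         (auto intro!: continuous_intros)
    then have "continuous_map (Wtop p) euclideanreal (f i)" by (simp add: f_def o_def)
    then show ?thesis unfolding quasi_continuous_def using nest by (auto intro: continuous_map_from_subtopology)
  qed
  moreover have "\<exists>i. f i \<mu> \<noteq> f i \<nu>" if "\<mu> \<in> Pp p" "\<nu> \<in> Pp p" "\<mu> \<noteq> \<nu>" for \<mu> \<nu>
  proof (rule ccontr)
    assume "\<nexists>i. f i \<mu> \<noteq> f i \<nu>"
    then have eq: "f (to_nat (xs, k)) \<mu> = f (to_nat (xs, k)) \<nu>" for xs :: "(nat \<times> rat) list" and k :: nat by blast
    have "\<mu> = \<nu>"
      by (rule measure_eqI_soft_cylinder[OF l PpD(1)[OF that(1)] PpD(1)[OF that(2)] PpD(2)[OF that(1)] PpD(2)[OF that(2)]])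
         (use eq in \<open>simp add: f_def arctan_eq_iff\<close>)
    then show False using that(3) by simp
  qed
  ultimately show ?thesis by blast
qed

end

theorem theorem2p3:
  fixes p :: real and C :: real
    and \<Lambda> :: "('a::{banach,second_countable_topology}) measure measure"
    and D :: "('a measure \<Rightarrow> real) set"
    and E :: "('a measure \<Rightarrow> real) \<Rightarrow> ('a measure \<Rightarrow> real) \<Rightarrow> real"
  assumes reflexive: "reflexive_space TYPE('a)"
    and p: "1 \<le> p"
    and Lambda: "prob_space \<Lambda>" "sets \<Lambda> = sets (Wborel p)"
    and form: "symmetric_dirichlet_form \<Lambda> D E" "conservative D E"
    and C1: "FCb1_P \<subseteq> D" "0 < C"
      "\<forall>f\<in>FCb1_P. ennreal (E f f) \<le> ennreal C * (SUP \<mu>\<in>Pp p. Dnorm p f \<mu>)\<^sup>2"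
    and C2: "\<exists>S. E1_dense_subspace \<Lambda> D E S \<and> (\<forall>f\<in>S. quasi_continuous (Wtop p) \<Lambda> D E f)"
  shows "quasi_regular (Wtop p) \<Lambda> D E"
proof -
  obtain d :: "nat \<Rightarrow> 'a" where d: "d 0 = 0" "\<And>x e. 0 < e \<Longrightarrow> \<exists>i. dist x (d i) < e"
    using dense_sequence by metis
  note nest = compact_nest[OF p Lambda form(1) C1, where d=d, OF d]
  obtain f :: "nat \<Rightarrow> 'a measure \<Rightarrow> real" where f: "\<forall>i. f i \<in> D \<and> quasi_continuous (Wtop p) \<Lambda> D E (f i)"
    "\<forall>\<mu>\<in>Pp p. \<forall>\<nu>\<in>Pp p. \<mu> \<noteq> \<nu> \<longrightarrow> (\<exists>i. f i \<mu> \<noteq> f i \<nu>)"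
    using separating_family[OF p Lambda form(1) C1, where d=d, OF d] by blast
  have "\<exists>N (f :: nat \<Rightarrow> 'a measure \<Rightarrow> real). Cap1 (Wtop p) \<Lambda> D E N = 0 \<and>
        (\<forall>i. f i \<in> D \<and> quasi_continuous (Wtop p) \<Lambda> D E (f i)) \<and>
        (\<forall>x\<in>topspace (Wtop p) - N. \<forall>y\<in>topspace (Wtop p) - N. x \<noteq> y \<longrightarrow> (\<exists>i. f i x \<noteq> f i y))"
    using Cap1_empty[OF p Lambda form(1) C1, where d=d, OF d] f by (intro exI[of _ "{}"] exI[of _ f]) (simp add: topspace_Wtop[OF p])
  then show ?thesis unfolding quasi_regular_def by (intro conjI nest C2)
qed

end
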